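(* There are absolute constants $c_3,c_4$ such that for every positive integer $k$, every bipartite simple topological graph on $n\ge 2$ vertices that contains no $(k,1)$-crossing family has at most $c_3\, n\log^{c_4\log k}n$ edges.
   Context: A topological graph is a graph drawn in the plane with vertices as points and edges as non-self-intersecting arcs joining their endpoints, not passing through other vertices, with no tangencies; no parallel edges or loops. It is simple if every pair of edges has at most one point in common. Two edges cross if their interiors share a point; they are disjoint if they share no point (including endpoints). A $(k,1)$-crossing family consists of $k$ pairwise crossing edges together with one further edge disjoint from each of these $k$ edges. *)

theory Defs
  imports "HOL-Analysis.Analysis"
begin

text \<open>The plane is the type complex. A topological graph is given by a finite vertex
set V, an edge set E of 2-element subsets of V (so no loops and no parallel edges),
and a drawing that assigns to every edge an arc (injective continuous path on [0,1]).\<close>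

definition edge_interior :: "(complex set \<Rightarrow> real \<Rightarrow> complex) \<Rightarrow> complex set \<Rightarrow> complex set" where
  "edge_interior dr e = path_image (dr e) - e"

text \<open>Two arcs cross properly (no tangency) at the point p: near p there is a
homeomorphism of a neighbourhood onto the unit disc straightening the first arc to the
real diameter and the second arc to the imaginary diameter.\<close>
definition proper_crossing_at :: "(real \<Rightarrow> complex) \<Rightarrow> (real \<Rightarrow> complex) \<Rightarrow> complex \<Rightarrow> bool" where
  "proper_crossing_at a b p \<longleftrightarrow>
     (\<exists>U h h'. open U \<and> p \<in> U \<and> homeomorphism U (ball 0 1) h h' \<and> h p = 0 \<and>
        h ` (path_image a \<inter> U) = {z \<in> ball 0 1. Im z = 0} \<and>
        h ` (path_image b \<inter> U) = {z \<in> ball 0 1. Re z = 0})"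

definition topological_graph ::
  "complex set \<Rightarrow> complex set set \<Rightarrow> (complex set \<Rightarrow> real \<Rightarrow> complex) \<Rightarrow> bool" where
  "topological_graph V E dr \<longleftrightarrow>
     finite V \<and>
     (\<forall>e\<in>E. e \<subseteq> V \<and> card e = 2) \<and>
     (\<forall>e\<in>E. arc (dr e) \<and> {pathstart (dr e), pathfinish (dr e)} = e \<and>
             path_image (dr e) \<inter> V = e) \<and>
     (\<forall>e\<in>E. \<forall>f\<in>E. e \<noteq> f \<longrightarrow>
        (\<forall>p \<in> edge_interior dr e \<inter> edge_interior dr f. proper_crossing_at (dr e) (dr f) p))"

definition simple_topological_graph ::
  "complex set \<Rightarrow> complex set set \<Rightarrow> (complex set \<Rightarrow> real \<Rightarrow> complex) \<Rightarrow> bool" where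
  "simple_topological_graph V E dr \<longleftrightarrow>
     topological_graph V E dr \<and>
     (\<forall>e\<in>E. \<forall>f\<in>E. e \<noteq> f \<longrightarrow>
        (\<forall>p q. p \<in> path_image (dr e) \<inter> path_image (dr f) \<longrightarrow>
               q \<in> path_image (dr e) \<inter> path_image (dr f) \<longrightarrow> p = q))"

definition bipartite_graph :: "complex set \<Rightarrow> complex set set \<Rightarrow> bool" where
  "bipartite_graph V E \<longleftrightarrow>
     (\<exists>A B. A \<union> B = V \<and> A \<inter> B = {} \<and> (\<forall>e\<in>E. e \<inter> A \<noteq> {} \<and> e \<inter> B \<noteq> {}))"

definition edges_cross :: "(complex set \<Rightarrow> real \<Rightarrow> complex) \<Rightarrow> complex set \<Rightarrow> complex set \<Rightarrow> bool" where
  "edges_cross dr e f \<longleftrightarrow> edge_interior dr e \<inter> edge_interior dr f \<noteq> {}"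

definition edges_disjoint :: "(complex set \<Rightarrow> real \<Rightarrow> complex) \<Rightarrow> complex set \<Rightarrow> complex set \<Rightarrow> bool" where
  "edges_disjoint dr e f \<longleftrightarrow> path_image (dr e) \<inter> path_image (dr f) = {}"

definition has_k1_crossing_family ::
  "nat \<Rightarrow> complex set set \<Rightarrow> (complex set \<Rightarrow> real \<Rightarrow> complex) \<Rightarrow> bool" where
  "has_k1_crossing_family k E dr \<longleftrightarrow>
     (\<exists>F f. F \<subseteq> E \<and> card F = k \<and> f \<in> E \<and>
        (\<forall>e\<in>F. \<forall>e'\<in>F. e \<noteq> e' \<longrightarrow> edges_cross dr e e') \<and>
        (\<forall>e\<in>F. edges_disjoint dr e f))"

end

theory Submission
  imports Defs "HOL-Complex_Analysis.Complex_Analysis" "HOL-Library.Z2" "HOL-Probability.Product_PMF"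
begin

text \<open>
  Comparing the winding number of an edge around a vertex with a fixed branch of the logarithm expresses the crossing
  parity of two disjoint edges \<open>uv\<close>, \<open>xy\<close> as a sum of terms depending on one end of each edge, with
  t(a, b) + t(b, a) = 1, and of terms depending on one edge and one end of the other (\<open>parity_rep\<close>). In a bipartite
  graph the complementary relation has a representation of the same form. Along walks these terms telescope, and van
  Kampen's parity count for \<open>K\<^sub>5\<close> shows that walks joining five vertices pairwise always contain an odd pair of
  disjoint edges, provided that walks without a common end are vertex-disjoint. A dense graph contains a subgraph with edge
  expansion of order \<open>1 / log n\<close>; on it, lazy random walks mix in polylogarithmic time, and routing a random
  \<open>K\<^sub>5\<close> along them shows that at least a \<open>1 / polylog n\<close> fraction of all pairs of edges is disjoint and odd.

  Applied to the crossing relation this gives many crossing pairs. Counting copies of grid-like patterns, and using that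
  two arcs on the same side of a closed curve with interleaved ends must meet, one finds two large sets of edges that cross
  completely. One of them has no \<open>k/2\<close> pairwise crossing edges, and induction on \<open>log k\<close> bounds graphs without
  \<open>k\<close> pairwise crossing edges. Applied to the complement in the bipartite case, the count of odd pairs gives an
  edge disjoint from many others, which contain no \<open>k\<close> pairwise crossing edges. For \<open>k = 1\<close> a bound linear
  in \<open>n\<close> is required; there a \<open>K\<^sub>5\<close> minor supplies the walks.
\<close>

section \<open>Intersection numbers and crossing parity\<close>

text \<open>One odd pair alone only gives a linear bound; that suffices for \<open>k = 1\<close>,
  where the exponent \<open>c4 * log 2 k\<close> is 0 and no logarithm may be lost. For larger
  \<open>k\<close> the odd pairs have to make up a fixed power of \<open>1 / log n\<close> of all
  pairs: each halving of \<open>k\<close> costs one such factor, and \<open>log k\<close> halvings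
  then cost \<open>log n\<close> to the power \<open>O(log k)\<close>. Bipartiteness enters as a
  constant 1 written in terms of one edge and one vertex, which turns the representation of crossing
  into one of non-crossing. The walks are lazy because a plain walk on a bipartite graph never
  mixes. The subgraphs chosen on the way have fewer vertices, so all losses are measured by a number
  \<open>N\<close> fixed in advance. Three edges may pass through one point, which spoils the strict
  orders that the grid patterns need; but edges crossing a common edge at one point cross each
  other, and a large bundle of them, cut in half, is itself a biclique.\<close>

text \<open>This is the winding number around 0 of \<open>f t - e s\<close> as \<open>(s, t)\<close>
  runs round the boundary of the unit square: each side of the square contributes one of the four
  fractional winding numbers. It therefore counts the crossings of \<open>e\<close> and
  \<open>f\<close> with sign.\<close>

definition intersection_number :: "(real \<Rightarrow> complex) \<Rightarrow> (real \<Rightarrow> complex) \<Rightarrow> complex" where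
  "intersection_number e f =
     winding_number f (pathstart e) - winding_number f (pathfinish e)
     + winding_number e (pathfinish f) - winding_number e (pathstart f)"

lemma intersection_number_commute:
  "intersection_number f e = - intersection_number e f"
  by (simp add: intersection_number_def)

text \<open>While \<open>f t\<close> moves off \<open>e\<close>, its logarithms relative to the two
  ends of \<open>e\<close> and the winding number of \<open>e\<close> around it vary continuously,
  and a combination of them is always an integer, hence constant. Its values at the two ends of
  \<open>f\<close> differ by the intersection number.\<close>

lemma intersection_number_disjoint:
  assumes e: "path e" and f: "path f" and dis: "path_image e \<inter> path_image f = {}"
  shows "intersection_number e f = 0"
proof -
  let ?a = "pathstart e" and ?b = "pathfinish e"
  have ab: "?a \<notin> path_image f" "?b \<notin> path_image f"
    using dis by auto
  obtain qa where qa: "path qa" "pathfinish qa - pathstart qa = 2 * of_real pi * \<i> * winding_number f ?a"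
      "\<And>t. t \<in> {0..1} \<Longrightarrow> f t = ?a + exp (qa t)"
    using winding_number_as_continuous_log[OF f ab(1)] by blast
  obtain qb where qb: "path qb" "pathfinish qb - pathstart qb = 2 * of_real pi * \<i> * winding_number f ?b"
      "\<And>t. t \<in> {0..1} \<Longrightarrow> f t = ?b + exp (qb t)"
    using winding_number_as_continuous_log[OF f ab(2)] by blast
  define F where "F t = (qa t - qb t) / (2 * of_real pi * \<i>) + winding_number e (f t)" for t
  have fe: "f t \<notin> path_image e" if "t \<in> {0..1}" for t
    using dis that unfolding path_image_def by blast
  have "continuous_on {0..1} (\<lambda>t. winding_number e (f t))"
    by (rule continuous_on_compose2[OF continuous_on_winding_number[OF e]])
       (use f fe in \<open>auto simp: path_def\<close>)
  then have cont: "continuous_on {0..1} F"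
    using qa(1) qb(1) unfolding F_def path_def by (intro continuous_intros) auto
  \<comment> \<open>The ratio of \<open>f t - ?a\<close> to \<open>f t - ?b\<close>, which comes
    from the two logarithms, is undone by the exponential of the winding number of \<open>e\<close>
    around \<open>f t\<close>.\<close>
  have Z: "F t \<in> \<int>" if t: "t \<in> {0..1}" for t
  proof -
    have 1: "?b - f t = exp (2 * pi * \<i> * winding_number e (f t)) * (?a - f t)"
      using winding_number_exp_2pi[OF e fe[OF t]] by simp
    have "exp (2 * pi * \<i> * F t) = exp (qa t) / exp (qb t) * exp (2 * pi * \<i> * winding_number e (f t))"
    proof -
      have "2 * pi * \<i> * F t = (qa t - qb t) + 2 * pi * \<i> * winding_number e (f t)"
        by (simp add: F_def distrib_left)
      then show ?thesis by (simp add: exp_add exp_diff)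
    qed
    also have "\<dots> = 1"
    proof -
      have "exp (qa t) = f t - ?a" "exp (qb t) = f t - ?b" using qa(3)[OF t] qb(3)[OF t] by (metis add_diff_cancel_left')+
      moreover have "f t - ?b \<noteq> 0" using ab t by (metis eq_iff_diff_eq_0 image_eqI path_image_def)
      moreover have "f t - ?b = exp (2 * pi * \<i> * winding_number e (f t)) * (f t - ?a)"
        using 1 by (metis minus_diff_eq mult_minus_right)
      ultimately show ?thesis by simp
    qed
    finally obtain n where "Re (2 * pi * \<i> * F t) = 0" "Im (2 * pi * \<i> * F t) = of_int (2 * n) * pi"
      unfolding exp_eq_1 by blast
    then have "F t = of_int n" by (auto simp: complex_eq_iff)
    then show ?thesis by simp
  qed
  have "F constant_on {0..1}"
  proof (rule continuous_discrete_range_constant[OF _ cont])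
    show "connected {0..1::real}" by simp
    fix t :: real assume t: "t \<in> {0..1}"
    show "\<exists>d>0. \<forall>y. y \<in> {0..1} \<and> F y \<noteq> F t \<longrightarrow> d \<le> norm (F y - F t)"
    proof (intro exI[of _ 1] conjI allI impI)
      fix y assume y: "y \<in> {0..1} \<and> F y \<noteq> F t"
      have "F y - F t \<in> \<int>" using Z t y by auto
      then obtain n where n: "F y - F t = of_int n" by (auto elim: Ints_cases)
      then have "n \<noteq> 0" using y by auto
      then show "1 \<le> norm (F y - F t)" unfolding n by (simp del: of_int_abs add: of_int_abs[symmetric])
    qed simp
  qed
  then have "F 1 = F 0"
    by (metis atLeastAtMost_iff constant_on_def order_refl zero_le_one)
  then have "((qa 1 - qa 0) - (qb 1 - qb 0)) / (2 * of_real pi * \<i>) + winding_number e (f 1) - winding_number e (f 0) = 0"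
    by (simp add: F_def field_simps)
  moreover have "qa 1 - qa 0 = 2 * of_real pi * \<i> * winding_number f ?a"
      "qb 1 - qb 0 = 2 * of_real pi * \<i> * winding_number f ?b"
    using qa(2) qb(2) by (auto simp: pathstart_def pathfinish_def)
  ultimately have "(2 * of_real pi * \<i> * winding_number f ?a - 2 * of_real pi * \<i> * winding_number f ?b)
      / (2 * of_real pi * \<i>) + winding_number e (f 1) - winding_number e (f 0) = 0" by simp
  then have "winding_number f ?a - winding_number f ?b + winding_number e (f 1) - winding_number e (f 0) = 0"
    unfolding right_diff_distrib[symmetric] by simp
  then show ?thesis
    by (simp add: intersection_number_def pathstart_def pathfinish_def)
qed

lemma intersection_number_subpath_combine:
  assumes "path e" "pathstart f \<notin> path_image e" "pathfinish f \<notin> path_image e"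
    and "u \<in> {0..1}" "v \<in> {0..1}" "w \<in> {0..1}"
  shows "intersection_number (subpath u v e) f + intersection_number (subpath v w e) f
         = intersection_number (subpath u w e) f"
  using winding_number_subpath_combine[OF assms(1) assms(2) assms(4-6)]
        winding_number_subpath_combine[OF assms(1) assms(3) assms(4-6)]
  by (simp add: intersection_number_def) (simp add: algebra_simps)

text \<open>By additivity along subpaths, end pieces that miss \<open>f\<close> contribute 0. Used
  on both arcs in turn, this shrinks a crossing to the inside of a chart.\<close>

lemma intersection_number_localize_left:
  assumes e: "path e" and f: "path f"
    and s: "0 \<le> s" "s \<le> s'" "s' \<le> 1"
    and ends: "pathstart f \<notin> path_image e" "pathfinish f \<notin> path_image e"
    and dis: "e ` {0..s} \<inter> path_image f = {}" "e ` {s'..1} \<inter> path_image f = {}"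
  shows "intersection_number e f = intersection_number (subpath s s' e) f"
proof -
  have 1: "intersection_number (subpath 0 s e) f = 0" "intersection_number (subpath s' 1 e) f = 0"
    using dis s by (intro intersection_number_disjoint e f path_subpath; simp add: path_image_subpath)+
  have "intersection_number (subpath 0 s e) f + intersection_number (subpath s 1 e) f
      = intersection_number (subpath 0 1 e) f"
     "intersection_number (subpath s s' e) f + intersection_number (subpath s' 1 e) f
      = intersection_number (subpath s 1 e) f"
    using s by (intro intersection_number_subpath_combine e ends; simp)+
  then show ?thesis using 1 by simp
qed

text \<open>The direction \<open>d\<close> will be 1 or \<open>\<i>\<close>, so both arcs of a
  straightened crossing are covered. The segment is compact and connected and the arc is a
  homeomorphism onto its image, so the parameters of the segment form an interval. Its end
  parameters go to the ends of the segment, because an inner point of the segment has a whole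
  parameter neighbourhood in the interval.\<close>

lemma chart_segment:
  fixes e :: "real \<Rightarrow> complex"
  assumes e: "arc e" and U: "open U" and h: "homeomorphism U (ball 0 1) h h'"
    and d: "cmod d = 1"
    and im: "h ` (path_image e \<inter> U) = {z \<in> ball 0 1. \<exists>t::real. z = of_real t * d}"
    and r: "0 < r" "r < 1"
    and ends: "pathstart e \<notin> h' ` cball 0 r" "pathfinish e \<notin> h' ` cball 0 r"
  obtains s s' where "0 \<le> s" "s < s'" "s' \<le> 1" "e ` {s..s'} = h' ` (\<lambda>t. of_real t * d) ` {-r..r}"
    "e s = h' (of_real r * d) \<and> e s' = h' (- of_real r * d) \<or> e s = h' (- of_real r * d) \<and> e s' = h' (of_real r * d)"
proof -
  let ?L = "\<lambda>t. of_real t * d"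
  let ?K = "h' ` ?L ` {-r..r}"
  have Lball: "?L t \<in> ball 0 1" if "\<bar>t\<bar> < 1" for t using that d by (simp add: norm_mult)
  have hh': "h (h' z) = z" "h' z \<in> U" if "z \<in> ball 0 1" for z
    using h that by (auto simp: homeomorphism_def)
  have h'h: "h' (h z) = z" if "z \<in> U" for z
    using h that by (auto simp: homeomorphism_def)
  have Kim: "h' (?L t) \<in> path_image e" if "\<bar>t\<bar> < 1" for t
  proof -
    have "?L t \<in> h ` (path_image e \<inter> U)" unfolding im using Lball[OF that] by auto
    then show ?thesis using h'h by auto
  qed
  have KU: "?K \<subseteq> path_image e" using Kim r by force
  obtain e' where e': "homeomorphism {0..1} (path_image e) e e'"
    using homeomorphism_arc[OF e] by blast
  define S where "S = e' ` ?K"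
  have Siff: "s \<in> S \<longleftrightarrow> s \<in> {0..1} \<and> e s \<in> ?K" for s
  proof
    assume "s \<in> S"
    then obtain z where z: "z \<in> ?K" "s = e' z" unfolding S_def by blast
    then have "z \<in> path_image e" using KU by blast
    then have "e s = z" "s \<in> {0..1}" using e' z(2) unfolding homeomorphism_def by auto
    then show "s \<in> {0..1} \<and> e s \<in> ?K" using z(1) by simp
  next
    assume s: "s \<in> {0..1} \<and> e s \<in> ?K"
    then have "e' (e s) = s" using e' unfolding homeomorphism_def by auto
    with s show "s \<in> S" unfolding S_def by (metis imageI)
  qed
  have "continuous_on ?K e'"
    using e' KU by (meson continuous_on_subset homeomorphism_def)
  have "continuous_on (ball 0 1) h'" using h by (simp add: homeomorphism_def)
  have contK: "continuous_on (?L ` {-r..r}) h'"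
    by (rule continuous_on_subset[OF \<open>continuous_on (ball 0 1) h'\<close>]) (use Lball r in force)
  have cL: "continuous_on {-r..r} ?L" by (intro continuous_intros)
  have "compact S" "connected S"
    unfolding S_def
    by (intro compact_continuous_image connected_continuous_image \<open>continuous_on ?K e'\<close> contK cL; simp)+
  then obtain s s' where S: "S = {s..s'}"
    by (metis connected_compact_interval_1)
  have e's: "e' z \<in> {0..1}" "e (e' z) = z" if "z \<in> path_image e" for z
    using e' that by (auto simp: homeomorphism_def)
  have hr: "h' (?L r) \<in> ?K" "h' (?L (-r)) \<in> ?K" using r by (intro imageI; simp)+
  have hrne: "h' (?L r) \<noteq> h' (?L (-r))"
  proof
    assume "h' (?L r) = h' (?L (-r))"
    then have "?L r = ?L (-r)" using hh'(1)[OF Lball[of r]] hh'(1)[OF Lball[of "-r"]] r by auto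
    then show False using r d by auto
  qed
  have inS: "e' (h' (?L r)) \<in> S" "e' (h' (?L (-r))) \<in> S" using hr by (auto simp: S_def)
  have ne: "e' (h' (?L r)) \<noteq> e' (h' (?L (-r)))"
    using hrne e's(2) KU hr by (metis subsetD)
  have ss': "s < s'" using inS ne unfolding S by (metis atLeastAtMost_iff nle_le order.trans order_less_le)
  have s01: "0 \<le> s" "s' \<le> 1" using Siff[of s] Siff[of s'] ss' unfolding S by auto
  \<comment> \<open>Near an inner point of the segment the arc stays in the chart, where it is a
    straight line, so nearby parameters belong to \<open>S\<close> as well.\<close>
  have inter: "\<exists>\<epsilon>>0. \<forall>v\<in>{0..1}. \<bar>v - w\<bar> < \<epsilon> \<longrightarrow> v \<in> S" if w: "w \<in> {0..1}" "e w = h' (?L t)" "\<bar>t\<bar> < r" for w t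
  proof -
    define O' where "O' = {z \<in> U. \<bar>Re (h z / d)\<bar> < r}"
    have "continuous_on U h" using h by (simp add: homeomorphism_def)
    then have "continuous_on U (\<lambda>z. \<bar>Re (h z / d)\<bar>)" using d by (intro continuous_intros) auto
    then have "open (U \<inter> (\<lambda>z. \<bar>Re (h z / d)\<bar>) -` {..<r})"
      by (rule continuous_open_preimage[OF _ U]) simp
    moreover have "U \<inter> (\<lambda>z. \<bar>Re (h z / d)\<bar>) -` {..<r} = O'" unfolding O'_def by auto
    ultimately have "open O'" by simp
    moreover have "e w \<in> O'"
      using w hh'[of "?L t"] Lball[of t] r d unfolding O'_def by auto
    ultimately obtain \<delta> where \<delta>: "\<delta> > 0" "ball (e w) \<delta> \<subseteq> O'" by (meson open_contains_ball)
    have "continuous_on {0..1} e" using e by (simp add: arc_def path_def)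
    then obtain \<epsilon> where \<epsilon>: "\<epsilon> > 0" "\<And>v. v \<in> {0..1} \<Longrightarrow> dist v w < \<epsilon> \<Longrightarrow> dist (e v) (e w) < \<delta>"
      using w(1) \<delta>(1) unfolding continuous_on_iff by blast
    show ?thesis
    proof (intro exI[of _ \<epsilon>] conjI ballI impI \<epsilon>(1))
      fix v assume v: "v \<in> {0..1}" "\<bar>v - w\<bar> < \<epsilon>"
      then have "e v \<in> O'" using \<epsilon>(2)[of v] \<delta>(2) by (auto simp: dist_real_def dist_commute)
      then have v2: "e v \<in> U" "\<bar>Re (h (e v) / d)\<bar> < r" by (auto simp: O'_def)
      have "h (e v) \<in> h ` (path_image e \<inter> U)" using v v2 by (auto simp: path_image_def)
      then obtain t' :: real where t': "h (e v) = ?L t'" unfolding im by auto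
      have "\<bar>t'\<bar> < r" using v2(2) d unfolding t' by (auto simp: divide_simps split: if_splits)
      then have "e v \<in> ?K" using t' h'h[OF v2(1)] by (auto simp: image_iff intro!: bexI[of _ t'])
      then show "v \<in> S" using Siff v by auto
    qed
  qed
  \<comment> \<open>Keeps 0 and 1 out of \<open>S\<close>: at these parameters a neighbourhood in
    \<open>{0..1}\<close> would be one-sided, and an inner point of the segment could end the
    interval.\<close>
  have ends0: "e 0 \<notin> ?K" "e 1 \<notin> ?K"
  proof -
    have "?K \<subseteq> h' ` cball 0 r" using d by (intro image_mono) (auto simp: norm_mult)
    then show "e 0 \<notin> ?K" "e 1 \<notin> ?K" using ends by (auto simp: pathstart_def pathfinish_def)
  qed
  have key: "e w = h' (?L r) \<or> e w = h' (?L (-r))" if w: "w = s \<or> w = s'" for w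
  proof -
    have wS: "w \<in> S" using w ss' S by auto
    then have w01: "w \<in> {0..1}" and "e w \<in> ?K" using Siff by auto
    then obtain t where t: "t \<in> {-r..r}" "e w = h' (?L t)" by auto
    show ?thesis
    proof (cases "\<bar>t\<bar> < r")
      case True
      then obtain \<epsilon> where \<epsilon>: "\<epsilon> > 0" "\<And>v. v \<in> {0..1} \<Longrightarrow> \<bar>v - w\<bar> < \<epsilon> \<Longrightarrow> v \<in> S"
        using inter[OF w01 t(2)] by blast
      have "w \<noteq> 0" "w \<noteq> 1" using \<open>e w \<in> ?K\<close> ends0 by metis+
      then have "0 < w" "w < 1" using w01 by auto
      define \<eta> where "\<eta> = min (\<epsilon>/2) (min w (1-w))"
      have \<eta>: "\<eta> > 0" "\<eta> < \<epsilon>" "\<eta> \<le> w" "\<eta> \<le> 1 - w" using \<epsilon>(1) \<open>0 < w\<close> \<open>w < 1\<close> by (auto simp: \<eta>_def)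
      have "w - \<eta> \<in> S" "w + \<eta> \<in> S" using \<eta> by (auto intro!: \<epsilon>(2))
      then show ?thesis using w \<eta> S by auto
    next
      case False
      then have "t = r \<or> t = -r" using t by auto
      then show ?thesis using t by auto
    qed
  qed
  have "e s \<noteq> e s'"
    using inj_onD[of e "{0..1}" s s'] e ss' s01 by (auto simp: arc_def)
  with key[of s] key[of s'] have "e s = h' (?L r) \<and> e s' = h' (?L (-r)) \<or> e s = h' (?L (-r)) \<and> e s' = h' (?L r)"
    by auto
  moreover have "e ` {s..s'} = ?K"
  proof -
    have "e ` S = id ` ?K" unfolding S_def image_comp[of e e']
      by (rule image_cong[OF refl]) (use e's(2) KU in auto)
    then show ?thesis using S by simp
  qed
  ultimately show ?thesis using that s01 ss' by simp
qed

lemma connected_subset_of_clopen: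
  assumes "connected X" "X \<inter> C = {}" "open D" "closed (D \<union> C)" "X \<inter> D \<noteq> {}"
  shows "X \<subseteq> D"
proof -
  have "open (- (D \<union> C))" using assms(4) by (rule open_Compl)
  with connectedD[OF assms(1,3) this] show ?thesis using assms by blast
qed

text \<open>The image of the open half disc is open by invariance of domain, and together with the
  curve it is compact; so a component of the complement that meets it lies in it. The outside is
  unbounded and cannot. Hence the inside lies in the image of the half disc, and the mirror point is
  outside.\<close>

lemma half_disc_image_sides:
  fixes c :: "real \<Rightarrow> complex"
  assumes U: "open U" and h: "homeomorphism U (ball 0 1) h h'" and r: "0 < r" "r < 1"
    and c: "simple_path c" "pathfinish c = pathstart c"
    and im: "path_image c = h' ` ((\<lambda>t. of_real t) ` {-r..r} \<union> {z. cmod z = r \<and> 0 \<le> Im z})"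
  shows "h' (of_real (r/2) * \<i>) \<in> inside (path_image c)" "h' (- of_real (r/2) * \<i>) \<in> outside (path_image c)"
proof -
  let ?C = "path_image c"
  let ?T = "complex_of_real ` {-r..r} \<union> {z. cmod z = r \<and> 0 \<le> Im z}"
  let ?H = "{z. cmod z < r \<and> 0 < Im z}"
  let ?D = "h' ` ?H"
  have Hb: "?H \<subseteq> ball 0 1" "?T \<subseteq> ball 0 1" using r by auto
  have inj: "inj_on h' (ball 0 1)" using h by (metis homeomorphism_def inj_on_inverseI)
  have ch': "continuous_on (ball 0 1) h'" using h by (simp add: homeomorphism_def)
  have oH: "open ?H"
    by (intro open_Collect_conj open_Collect_less continuous_intros)
  have oD: "open ?D"
    by (rule invariance_of_domain[OF continuous_on_subset[OF ch' Hb(1)] oH inj_on_subset[OF inj Hb(1)]])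
  have HT: "?H \<union> ?T = {z. cmod z \<le> r \<and> 0 \<le> Im z}"
  proof (intro equalityI subsetI)
    fix z assume "z \<in> {z. cmod z \<le> r \<and> 0 \<le> Im z}"
    then have z: "cmod z \<le> r" "0 \<le> Im z" by auto
    show "z \<in> ?H \<union> ?T"
    proof (cases "Im z = 0")
      case True
      then have "z = of_real (Re z)" by (simp add: complex_eq_iff)
      moreover have "\<bar>Re z\<bar> \<le> r" using abs_Re_le_cmod[of z] z by linarith
      ultimately have "z \<in> complex_of_real ` {-r..r}" by (intro image_eqI[of _ _ "Re z"]) auto
      then show ?thesis by auto
    next
      case False then show ?thesis using z by auto
    qed
  qed (use r in auto)
  have "compact (cball (0::complex) r \<inter> {z. 0 \<le> Im z})"
    by (intro compact_Int_closed compact_cball closed_Collect_le continuous_intros)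
  moreover have "cball (0::complex) r \<inter> {z. 0 \<le> Im z} = ?H \<union> ?T" unfolding HT by auto
  ultimately have "compact (?H \<union> ?T)" by simp
  then have comp: "compact (h' ` (?H \<union> ?T))"
    by (intro compact_continuous_image continuous_on_subset[OF ch']) (use Hb in auto)
  have DC: "?D \<union> ?C = h' ` (?H \<union> ?T)" unfolding im by (simp only: image_Un Un_assoc)
  have clDC: "closed (?D \<union> ?C)" using comp unfolding DC by (rule compact_imp_closed)
  have bD: "bounded ?D" using compact_imp_bounded[OF comp] bounded_subset DC by (metis Un_upper1)
  have dis: "?H \<inter> ?T = {}" by auto
  have DCdis: "?D \<inter> ?C = {}"
  proof -
    have "h' ` (?H \<inter> ?T) = h' ` ?H \<inter> h' ` ?T" by (rule inj_on_image_Int[OF inj Hb])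
    then show ?thesis unfolding im dis by simp
  qed
  have J: "connected (inside ?C)" "connected (outside ?C)" "\<not> bounded (outside ?C)"
     "inside ?C \<union> outside ?C = - ?C"
    using Jordan_inside_outside[OF c] by auto
  have yH: "of_real (r/2) * \<i> \<in> ?H" using r by (simp add: norm_mult)
  then have yD: "h' (of_real (r/2) * \<i>) \<in> ?D" by blast
  have "h' (of_real (r/2) * \<i>) \<notin> outside ?C"
  proof
    assume "h' (of_real (r/2) * \<i>) \<in> outside ?C"
    then have "outside ?C \<subseteq> ?D"
      using connected_subset_of_clopen[OF J(2) _ oD clDC] yD outside_no_overlap by fastforce
    then show False using bD J(3) bounded_subset by blast
  qed
  then show y: "h' (of_real (r/2) * \<i>) \<in> inside ?C" using J(4) yD DCdis by blast
  have inD: "inside ?C \<subseteq> ?D"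
    using connected_subset_of_clopen[OF J(1) _ oD clDC] yD y inside_no_overlap by fastforce
  have "h' (- of_real (r/2) * \<i>) \<notin> h' ` (?H \<union> ?T)"
  proof -
    have "- of_real (r/2) * \<i> \<notin> ?H \<union> ?T" unfolding HT using r by auto
    moreover have "- of_real (r/2) * \<i> \<in> ball 0 1" using r by (simp add: norm_mult)
    ultimately show ?thesis using inj Hb by (metis (no_types, lifting) Un_least inj_on_image_mem_iff)
  qed
  then have "h' (- of_real (r/2) * \<i>) \<notin> ?D \<union> ?C" unfolding DC .
  then show "h' (- of_real (r/2) * \<i>) \<in> outside ?C" using inD J(4) by blast
qed

lemma upper_semicircle_arc:
  assumes "0 < r"
  shows "arc (part_circlepath 0 r 0 pi)" "pathstart (part_circlepath 0 r 0 pi) = of_real r"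
    "pathfinish (part_circlepath 0 r 0 pi) = - of_real r"
    "path_image (part_circlepath 0 r 0 pi) = {z. cmod z = r \<and> 0 \<le> Im z}"
proof -
  show "arc (part_circlepath 0 r 0 pi)" using assms by (intro arc_part_circlepath) auto
  show "pathstart (part_circlepath 0 r 0 pi) = of_real r"
    "pathfinish (part_circlepath 0 r 0 pi) = - of_real r"
    by (auto simp: exp_pi_i' exp_pi_i)
  have "z \<in> (\<lambda>x. of_real r * cis x) ` {0..pi}" if z: "cmod z = r" "0 \<le> Im z" for z
  proof (rule image_eqI[of _ _ "Arg z"])
    have "z \<noteq> 0" using z assms by auto
    then show "z = of_real r * cis (Arg z)" using Arg_eq[of z] z by (simp add: cis_conv_exp)
    show "Arg z \<in> {0..pi}" using z Arg_less_0[of z] Arg_bounded[of z] by auto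
  qed
  then show "path_image (part_circlepath 0 r 0 pi) = {z. cmod z = r \<and> 0 \<le> Im z}"
    using assms unfolding path_image_part_circlepath'
    by (auto simp: norm_mult closed_segment_eq_real_ivl sin_ge_zero intro!: mult_nonneg_nonneg)
qed

text \<open>Both arcs are cut down to straight pieces in a chart. Closing the piece of
  \<open>e\<close> by a semicircle that misses the piece of \<open>f\<close> turns the number into
  the difference of the winding numbers of a Jordan curve at a point inside and a point
  outside.\<close>

lemma intersection_number_proper_crossing:
  assumes e: "arc e" and f: "arc f" and ef: "path_image e \<inter> path_image f = {p}"
    and cross: "proper_crossing_at e f p"
    and pe: "p \<notin> {pathstart e, pathfinish e, pathstart f, pathfinish f}"
  shows "intersection_number e f = 1 \<or> intersection_number e f = - 1"
proof -
  obtain U h h' where U: "open U" "p \<in> U" and h: "homeomorphism U (ball 0 1) h h'" and hp: "h p = 0"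
    and ime: "h ` (path_image e \<inter> U) = {z \<in> ball 0 1. Im z = 0}"
    and imf: "h ` (path_image f \<inter> U) = {z \<in> ball 0 1. Re z = 0}"
    using cross unfolding proper_crossing_at_def by auto
  have ime': "h ` (path_image e \<inter> U) = {z \<in> ball 0 1. \<exists>t::real. z = of_real t * 1}"
    unfolding ime by (auto simp: complex_eq_iff)
  have imf': "h ` (path_image f \<inter> U) = {z \<in> ball 0 1. \<exists>t::real. z = of_real t * \<i>}"
    unfolding imf by (auto simp: complex_eq_iff)
  have hh': "h (h' z) = z" "h' z \<in> U" if "z \<in> ball 0 1" for z
    using h that by (auto simp: homeomorphism_def)
  have h'h: "h' (h z) = z" if "z \<in> U" for z
    using h that by (auto simp: homeomorphism_def)
  have h'0: "h' 0 = p" using h'h[OF U(2)] hp by simp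
  have inj: "inj_on h' (ball 0 1)" using hh'(1) by (rule inj_on_inverseI)
  have ch': "continuous_on (ball 0 1) h'" using h by (simp add: homeomorphism_def)
  let ?N = "{pathstart e, pathfinish e, pathstart f, pathfinish f}"
  \<comment> \<open>Distances from the crossing, in chart coordinates, of those ends of the arcs
    that lie in the chart. Half their minimum is the radius of a disc that contains none of the four
    ends; the inserted 1 keeps it inside the chart.\<close>
  define M where "M = insert 1 ((\<lambda>z. cmod (h z)) ` (?N \<inter> U))"
  have M: "finite M" "M \<noteq> {}" unfolding M_def by auto
  have Mpos: "x > 0" if "x \<in> M" for x
  proof -
    have "h z \<noteq> 0" if "z \<in> ?N \<inter> U" for z
    proof
      assume "h z = 0"
      then have "z = p" using h'h[of z] h'0 that by auto
      then show False using that pe by blast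
    qed
    then show ?thesis using that unfolding M_def by auto
  qed
  define r where "r = Min M / 2"
  have MinM: "Min M > 0" "Min M \<le> 1" using Mpos[OF Min_in[OF M]] Min_le[OF M(1), of 1] by (auto simp: M_def)
  have r: "0 < r" "r < 1" using MinM by (auto simp: r_def)
  have Nr: "z \<notin> h' ` cball 0 r" if "z \<in> ?N" for z
  proof
    assume "z \<in> h' ` cball 0 r"
    then obtain w where w: "z = h' w" "cmod w \<le> r" by auto
    then have wb: "w \<in> ball 0 1" using r by auto
    have "z \<in> U" "h z = w" using hh'[OF wb] w by auto
    then have "cmod w \<in> M" using that unfolding M_def by auto
    then have "Min M \<le> cmod w" using M by simp
    then show False using w(2) MinM by (simp add: r_def)
  qed
  have Nr2: "z \<notin> h' ` cball 0 (r/2)" if "z \<in> ?N" for z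
  proof -
    have "h' ` cball 0 (r/2) \<subseteq> h' ` cball 0 r" using r by (intro image_mono) auto
    then show ?thesis using Nr[OF that] by auto
  qed
  obtain s s' where s: "0 \<le> s" "s < s'" "s' \<le> 1" "e ` {s..s'} = h' ` (\<lambda>t. of_real t * 1) ` {-r..r}"
    "e s = h' (of_real r * 1) \<and> e s' = h' (- of_real r * 1) \<or> e s = h' (- of_real r * 1) \<and> e s' = h' (of_real r * 1)"
    by (rule chart_segment[OF e U(1) h _ ime' r]) (use Nr in auto)
  \<comment> \<open>Half the radius for \<open>f\<close>, so that its piece stays clear of the
    semicircle of radius \<open>r\<close>.\<close>
  obtain u u' where u: "0 \<le> u" "u < u'" "u' \<le> 1" "f ` {u..u'} = h' ` (\<lambda>t. of_real t * \<i>) ` {-(r/2)..r/2}"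
    "f u = h' (of_real (r/2) * \<i>) \<and> f u' = h' (- of_real (r/2) * \<i>) \<or> f u = h' (- of_real (r/2) * \<i>) \<and> f u' = h' (of_real (r/2) * \<i>)"
    by (rule chart_segment[OF f U(1) h _ imf', of "r/2"]) (use Nr2 r in auto)
  have pe': "path e" "path f" using e f by (auto simp: arc_imp_path)
  have ne0: "h' w \<noteq> p" if "w \<in> ball 0 1" "w \<noteq> 0" for w
    using that hh'(1)[of w] hp by metis
  have es: "e s \<noteq> p" "e s' \<noteq> p" using s(5) ne0[of "of_real r"] ne0[of "- of_real r"] r by auto
  have fu: "f u \<noteq> p" "f u' \<noteq> p"
    using u(5) ne0[of "of_real (r/2) * \<i>"] ne0[of "- of_real (r/2) * \<i>"] r by (auto simp: norm_mult)
  have "p \<in> e ` {s..s'}" unfolding s(4) using r h'0 by (auto simp: image_iff intro!: bexI[of _ 0])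
  then obtain \<tau> where "\<tau> \<in> {s..s'}" "e \<tau> = p" by auto
  moreover from this have "\<tau> \<noteq> s" "\<tau> \<noteq> s'" using es by auto
  ultimately have \<tau>: "s < \<tau>" "\<tau> < s'" "e \<tau> = p" by auto
  have "p \<in> f ` {u..u'}" unfolding u(4) using r h'0 by (auto simp: image_iff intro!: bexI[of _ 0])
  then obtain \<sigma> where "\<sigma> \<in> {u..u'}" "f \<sigma> = p" by auto
  moreover from this have "\<sigma> \<noteq> u" "\<sigma> \<noteq> u'" using fu by auto
  ultimately have \<sigma>: "u < \<sigma>" "\<sigma> < u'" "f \<sigma> = p" by auto
  have ein: "v = \<tau>" if "e v = p" "v \<in> {0..1}" for v
    using e \<tau> s(1-3) that unfolding arc_def inj_on_def by auto
  have fin: "v = \<sigma>" if "f v = p" "v \<in> {0..1}" for v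
    using f \<sigma> u(1-3) that unfolding arc_def inj_on_def by auto
  have efp: "z = p" if "z \<in> path_image e" "z \<in> path_image f" for z using that ef by blast
  have ef\<tau>: "v = \<tau>" if "v \<in> {0..1}" "e v \<in> path_image f" for v
    using efp[of "e v"] ein that by (simp add: path_image_def)
  have fe\<sigma>: "v = \<sigma>" if "v \<in> {0..1}" "f v \<in> path_image e" for v
    using efp[of "f v"] fin that by (simp add: path_image_def)
  let ?e2 = "subpath s s' e" and ?f2 = "subpath u u' f"
  have e2im: "path_image ?e2 = e ` {s..s'}" using s(1-3) by (simp add: path_image_subpath)
  have f2im: "path_image ?f2 = f ` {u..u'}" using u(1-3) by (simp add: path_image_subpath)
  have e2sub: "path_image ?e2 \<subseteq> path_image e" using s(1-3) by (intro path_image_subpath_subset) auto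
  have f2sub: "path_image ?f2 \<subseteq> path_image f" using u(1-3) by (intro path_image_subpath_subset) auto
  have 1: "intersection_number e f = intersection_number ?e2 f"
  proof (rule intersection_number_localize_left[OF pe'])
    show "pathstart f \<notin> path_image e" "pathfinish f \<notin> path_image e"
      using efp pe pathstart_in_path_image pathfinish_in_path_image by blast+
    show "e ` {0..s} \<inter> path_image f = {}" "e ` {s'..1} \<inter> path_image f = {}"
      using s(1-3) \<tau>(1,2) by (auto dest!: ef\<tau>[rotated])
  qed (use s(1-3) in auto)
  \<comment> \<open>The two paths are exchanged because the localisation cuts its first argument;
    the sign is restored in the next fact.\<close>
  have 2: "intersection_number f ?e2 = intersection_number ?f2 ?e2"
  proof (rule intersection_number_localize_left)
    show "path ?e2" using pe' s(1-3) by (intro path_subpath) auto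
    have "e s \<in> path_image e" "e s' \<in> path_image e" using s(1-3) by (auto simp: path_image_def)
    then show "pathstart ?e2 \<notin> path_image f" "pathfinish ?e2 \<notin> path_image f"
      using efp es by auto
    have "f ` {0..u} \<inter> path_image e = {}" "f ` {u'..1} \<inter> path_image e = {}"
      using u(1-3) \<sigma>(1,2) by (auto dest!: fe\<sigma>[rotated])
    then show "f ` {0..u} \<inter> path_image ?e2 = {}" "f ` {u'..1} \<inter> path_image ?e2 = {}" using e2sub by blast+
  qed (use u(1-3) pe' in auto)
  have 3: "intersection_number e f = intersection_number ?e2 ?f2"
    using 1 2 intersection_number_commute by metis
  define \<kappa>0 where "\<kappa>0 = h' \<circ> part_circlepath 0 r 0 pi"
  \<comment> \<open>The semicircle is oriented from the end of the piece of \<open>e\<close> back to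
    its start, whichever of the two is \<open>h' (of_real r)\<close>.\<close>
  define \<kappa> where "\<kappa> = (if e s = h' (- of_real r) then \<kappa>0 else reversepath \<kappa>0)"
  note sc = upper_semicircle_arc[OF r(1)]
  have scb: "path_image (part_circlepath 0 r 0 pi) \<subseteq> ball 0 1" unfolding sc(4) using r by auto
  have "simple_path \<kappa>0" unfolding \<kappa>0_def
    by (intro simple_path_continuous_image arc_imp_simple_path sc(1) continuous_on_subset[OF ch'] inj_on_subset[OF inj] scb)
  have hrne: "h' (of_real r) \<noteq> h' (- of_real r)"
    using r inj_onD[OF inj, of "of_real r" "- of_real r"] by auto
  have \<kappa>0: "pathstart \<kappa>0 = h' (of_real r)" "pathfinish \<kappa>0 = h' (- of_real r)"
      "path_image \<kappa>0 = h' ` {z. cmod z = r \<and> 0 \<le> Im z}"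
    unfolding \<kappa>0_def using sc by (simp_all only: pathstart_compose pathfinish_compose path_image_compose)
  have "arc \<kappa>0" using \<open>simple_path \<kappa>0\<close> \<kappa>0 hrne by (simp add: arc_simple_path)
  have \<kappa>: "arc \<kappa>" "pathstart \<kappa> = e s'" "pathfinish \<kappa> = e s" "path_image \<kappa> = h' ` {z. cmod z = r \<and> 0 \<le> Im z}"
    unfolding \<kappa>_def using \<open>arc \<kappa>0\<close> \<kappa>0 s(5) hrne by (auto simp: arc_reversepath)
  have arce2: "arc ?e2" using e s(1-3) by (intro arc_subpath_arc) auto
  have e2im': "path_image ?e2 = h' ` complex_of_real ` {-r..r}" unfolding e2im s(4) by simp
  let ?c = "?e2 +++ \<kappa>"
  have segb: "complex_of_real ` {-r..r} \<subseteq> ball 0 1" using r by auto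
  have semib: "{z. cmod z = r \<and> 0 \<le> Im z} \<subseteq> ball 0 1" using r by auto
  have int: "path_image ?e2 \<inter> path_image \<kappa> \<subseteq> {h' (of_real r), h' (- of_real r)}"
  proof -
    have "path_image ?e2 \<inter> path_image \<kappa> = h' ` (complex_of_real ` {-r..r} \<inter> {z. cmod z = r \<and> 0 \<le> Im z})"
      unfolding e2im' \<kappa>(4) by (rule inj_on_image_Int[OF inj segb semib, symmetric])
    also have "\<dots> \<subseteq> h' ` {of_real r, - of_real r}" by (rule image_mono) (auto simp: abs_if split: if_splits)
    finally show ?thesis by simp
  qed
  have c: "simple_path ?c" "pathfinish ?c = pathstart ?c"
  proof -
    show "simple_path ?c"
      by (rule simple_path_join_loop[OF arce2 \<kappa>(1)]) (use int s(5) \<kappa>(2,3) in auto)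
    show "pathfinish ?c = pathstart ?c" using \<kappa> by simp
  qed
  have imc: "path_image ?c = h' ` ((\<lambda>t. of_real t) ` {-r..r} \<union> {z. cmod z = r \<and> 0 \<le> Im z})"
    using \<kappa> e2im' by (simp add: path_image_join image_Un)
  note sides = half_disc_image_sides[OF U(1) h r c imc]
  have wout: "winding_number ?c (h' (- of_real (r/2) * \<i>)) = 0"
    by (rule winding_number_zero_in_outside[OF simple_path_imp_path[OF c(1)] c(2) sides(2)])
  have win: "winding_number ?c (h' (of_real (r/2) * \<i>)) = 1 \<or> winding_number ?c (h' (of_real (r/2) * \<i>)) = -1"
    by (rule simple_closed_path_winding_number_inside[OF c(1)]) (use sides(1) in blast)+
  have "path_image \<kappa> \<inter> path_image ?f2 = {}"
  proof -
    have "(\<lambda>t. complex_of_real t * \<i>) ` {-(r/2)..r/2} \<subseteq> ball 0 1" using r by (auto simp: norm_mult)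
    then have "path_image \<kappa> \<inter> path_image ?f2
       = h' ` ({z. cmod z = r \<and> 0 \<le> Im z} \<inter> (\<lambda>t. complex_of_real t * \<i>) ` {-(r/2)..r/2})"
      unfolding f2im u(4) \<kappa>(4) by (intro inj_on_image_Int[OF inj semib, symmetric])
    also have "{z. cmod z = r \<and> 0 \<le> Im z} \<inter> (\<lambda>t. complex_of_real t * \<i>) ` {-(r/2)..r/2} = {}"
      using r by (auto simp: norm_mult)
    finally show ?thesis by simp
  qed
  then have 4: "intersection_number \<kappa> ?f2 = 0"
    by (intro intersection_number_disjoint) (use \<kappa>(1) pe' u(1-3) in \<open>auto simp: arc_imp_path path_subpath\<close>)
  have nc: "h' (- of_real (r/2) * \<i>) \<notin> path_image ?c" "h' (of_real (r/2) * \<i>) \<notin> path_image ?c"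
    using sides inside_no_overlap outside_no_overlap by blast+
  have ncj: "path_image ?c = path_image ?e2 \<union> path_image \<kappa>" using \<kappa> by (simp add: path_image_join)
  have wj: "winding_number ?c z = winding_number ?e2 z + winding_number \<kappa> z" if "z \<notin> path_image ?c" for z
    using that \<kappa> arce2 unfolding ncj by (intro winding_number_join) (auto simp: arc_imp_path)
  \<comment> \<open>Adding the zero contribution of the semicircle joins fractional winding numbers
    into those of a closed curve; the terms at the ends of the piece of \<open>e\<close> cancel
    between the two.\<close>
  have "intersection_number ?e2 ?f2 = intersection_number ?e2 ?f2 + intersection_number \<kappa> ?f2" using 4 by simp
  also have "\<dots> = winding_number ?c (f u') - winding_number ?c (f u)"
    using wj[of "f u"] wj[of "f u'"] nc u(5) \<kappa> by (auto simp: intersection_number_def)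
  finally have "intersection_number e f = winding_number ?c (f u') - winding_number ?c (f u)" using 3 by simp
  then show ?thesis using u(5) wout win by auto
qed

section \<open>Representations of crossing parity modulo 2\<close>

text \<open>If \<open>t\<close> is a linear order, the four \<open>t\<close> terms are the crossing
  parity of two chords on points in convex position, and the \<open>n\<close> terms record how often
  an edge was pulled over a vertex. The form is kept abstract because it has to survive
  complementation, after which \<open>c\<close> is no longer the crossing relation of a
  drawing.\<close>

definition parity_rep :: "'v set set \<Rightarrow> ('v set \<Rightarrow> 'v set \<Rightarrow> bool) \<Rightarrow> bool" where
  "parity_rep E c \<longleftrightarrow> (\<exists>(t :: 'v \<Rightarrow> 'v \<Rightarrow> bit) (n :: 'v set \<Rightarrow> 'v \<Rightarrow> bit).
     (\<forall>a b. a \<noteq> b \<longrightarrow> t a b + t b a = 1) \<and>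
     (\<forall>u v x y. {u, v} \<in> E \<and> {x, y} \<in> E \<and> u \<noteq> v \<and> x \<noteq> y \<and> {u, v} \<inter> {x, y} = {} \<longrightarrow>
        of_bool (c {u, v} {x, y}) =
          t u x + t u y + t v x + t v y + n {u, v} x + n {u, v} y + n {x, y} u + n {x, y} v))"

lemma bit_diff_eq_add: "x - y = x + (y :: bit)"
  by (cases x; cases y) simp_all

text \<open>The error made by the principal branch is an integer that depends on one path and one
  point; it becomes the \<open>n\<close> term.\<close>

lemma winding_number_Ln:
  assumes "path \<gamma>" "z \<notin> path_image \<gamma>"
  shows "\<exists>N::int. winding_number \<gamma> z =
    (Ln (pathfinish \<gamma> - z) - Ln (pathstart \<gamma> - z)) / (2 * of_real pi * \<i>) + of_int N"
proof -
  let ?v = "pathfinish \<gamma> - z" and ?u = "pathstart \<gamma> - z"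
  have nz: "?u \<noteq> 0" "?v \<noteq> 0"
    using assms(2) pathstart_in_path_image[of \<gamma>] pathfinish_in_path_image[of \<gamma>] by auto
  have "exp (2 * pi * \<i> * winding_number \<gamma> z + Ln ?u) = exp (Ln ?v)"
    using winding_number_exp_2pi[OF assms] nz by (simp add: exp_add)
  then obtain N :: int where N: "2 * pi * \<i> * winding_number \<gamma> z + Ln ?u = Ln ?v + (of_int (2 * N) * pi) * \<i>"
    unfolding exp_eq by blast
  then have "winding_number \<gamma> z = (Ln ?v - Ln ?u) / (2 * of_real pi * \<i>) + of_int N"
    by (simp add: divide_simps) (simp add: algebra_simps)
  then show ?thesis by blast
qed

text \<open>The case distinction of \<open>Ln (- z)\<close>: for nonzero \<open>z\<close> the
  difference \<open>Ln z - Ln (- z)\<close> is \<open>\<i> * pi\<close> where this holds and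
  \<open>- \<i> * pi\<close> elsewhere. Applied to \<open>b - a\<close> it orders points linearly,
  by imaginary part and then by decreasing real part.\<close>

definition upper_half :: "complex \<Rightarrow> bool" where
  "upper_half z \<longleftrightarrow> \<not> (Im z \<le> 0 \<and> \<not> (Re z < 0 \<and> Im z = 0))"

lemma Ln_diff_minus:
  assumes "z \<noteq> 0"
  shows "Ln z - Ln (- z) = 2 * of_real pi * \<i> * (of_bool (upper_half z) - 1 / 2)"
  using Ln_minus[OF assms] by (auto simp: upper_half_def algebra_simps)

lemma upper_half_minus: "z \<noteq> 0 \<Longrightarrow> upper_half (- z) \<longleftrightarrow> \<not> upper_half z"
  by (auto simp: upper_half_def complex_eq_iff)

text \<open>The eight logarithms in the intersection number pair up: an end of \<open>e\<close> and
  an end of \<open>f\<close> contribute two with opposite arguments, whose difference depends only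
  on the order of the two points, up to halves that cancel. In a simple drawing the number is 0, 1
  or -1, so its parity is the crossing relation.\<close>

lemma crossing_parity_rep:
  assumes G: "simple_topological_graph V E dr"
  shows "parity_rep E (edges_cross dr)"
proof -
  have tg: "topological_graph V E dr" using G by (simp add: simple_topological_graph_def)
  have arc: "arc (dr e)" "{pathstart (dr e), pathfinish (dr e)} = e" "path_image (dr e) \<inter> V = e" "e \<subseteq> V"
    if "e \<in> E" for e using tg that unfolding topological_graph_def by auto
  define Q where "Q e z N \<longleftrightarrow> winding_number (dr e) z =
    (Ln (pathfinish (dr e) - z) - Ln (pathstart (dr e) - z)) / (2 * of_real pi * \<i>) + of_int N" for e z and N :: int
  define N where "N e z = (SOME N. Q e z N)" for e z
  have N: "Q e z (N e z)" if "e \<in> E" "z \<in> V" "z \<notin> e" for e z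
  proof -
    have "\<exists>N. Q e z N" unfolding Q_def
      by (rule winding_number_Ln) (use arc[OF that(1)] that in \<open>auto simp: arc_imp_path\<close>)
    then show ?thesis unfolding N_def by (rule someI_ex)
  qed
  define t :: "complex \<Rightarrow> complex \<Rightarrow> bit" where "t a b = of_bool (upper_half (b - a))" for a b
  define n :: "complex set \<Rightarrow> complex \<Rightarrow> bit" where "n e z = of_int (N e z)" for e z
  have t: "t a b + t b a = 1" if "a \<noteq> b" for a b
    using upper_half_minus[of "b - a"] that by (auto simp: t_def)
  have main: "of_bool (edges_cross dr e f) = t u x + t u y + t v x + t v y + n e x + n e y + n f u + n f v"
    if e: "e \<in> E" "u = pathstart (dr e)" "v = pathfinish (dr e)"
    and f: "f \<in> E" "x = pathstart (dr f)" "y = pathfinish (dr f)" and dis: "e \<inter> f = {}" for e f u v x y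
  proof -
    have euv: "e = {u, v}" "f = {x, y}" unfolding e(2,3) f(2,3) using arc(2)[OF e(1)] arc(2)[OF f(1)] by simp_all
    have V: "u \<in> V" "v \<in> V" "x \<in> V" "y \<in> V" using arc(4)[OF e(1)] arc(4)[OF f(1)] euv by auto
    have ne: "u \<noteq> x" "u \<noteq> y" "v \<noteq> x" "v \<noteq> y" using dis euv by auto
    have ends: "u \<notin> f" "v \<notin> f" "x \<notin> e" "y \<notin> e" using dis euv by auto
    have W: "winding_number (dr f) u = (Ln (y - u) - Ln (x - u)) / (2 * of_real pi * \<i>) + of_int (N f u)"
       "winding_number (dr f) v = (Ln (y - v) - Ln (x - v)) / (2 * of_real pi * \<i>) + of_int (N f v)"
       "winding_number (dr e) x = (Ln (v - x) - Ln (u - x)) / (2 * of_real pi * \<i>) + of_int (N e x)"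
       "winding_number (dr e) y = (Ln (v - y) - Ln (u - y)) / (2 * of_real pi * \<i>) + of_int (N e y)"
      using N[OF f(1) V(1) ends(1)] N[OF f(1) V(2) ends(2)] N[OF e(1) V(3) ends(3)] N[OF e(1) V(4) ends(4)]
      unfolding Q_def e(2,3)[symmetric] f(2,3)[symmetric] by simp_all
    have "intersection_number (dr e) (dr f) = winding_number (dr f) u - winding_number (dr f) v
       + winding_number (dr e) y - winding_number (dr e) x"
      unfolding e(2,3) f(2,3) by (simp add: intersection_number_def)
    also have "\<dots> = ((Ln (y - u) - Ln (-(y - u))) - (Ln (x - u) - Ln (-(x - u)))
        - (Ln (y - v) - Ln (-(y - v))) + (Ln (x - v) - Ln (-(x - v)))) / (2 * of_real pi * \<i>)
        + of_int (N f u - N f v + N e y - N e x)"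
      unfolding W by (simp add: add_divide_distrib diff_divide_distrib)
    also have "((Ln (y - u) - Ln (-(y - u))) - (Ln (x - u) - Ln (-(x - u)))
        - (Ln (y - v) - Ln (-(y - v))) + (Ln (x - v) - Ln (-(x - v)))) = 2 * of_real pi * \<i> *
         (of_bool (upper_half (y - u)) - of_bool (upper_half (x - u)) - of_bool (upper_half (y - v)) + of_bool (upper_half (x - v)))"
    proof -
      have "y - u \<noteq> 0" "x - u \<noteq> 0" "y - v \<noteq> 0" "x - v \<noteq> 0" using ne by auto
      then show ?thesis
        unfolding Ln_diff_minus[OF \<open>y - u \<noteq> 0\<close>] Ln_diff_minus[OF \<open>x - u \<noteq> 0\<close>]
          Ln_diff_minus[OF \<open>y - v \<noteq> 0\<close>] Ln_diff_minus[OF \<open>x - v \<noteq> 0\<close>]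
        by (simp only: distrib_left right_diff_distrib) simp
    qed
    finally have I0: "intersection_number (dr e) (dr f) = of_int (of_bool (upper_half (y - u)) - of_bool (upper_half (x - u))
        - of_bool (upper_half (y - v)) + of_bool (upper_half (x - v)) + (N f u - N f v + N e y - N e x))"
      by simp
    define K :: int where "K = of_bool (upper_half (y - u)) - of_bool (upper_half (x - u))
        - of_bool (upper_half (y - v)) + of_bool (upper_half (x - v)) + (N f u - N f v + N e y - N e x)"
    have I: "intersection_number (dr e) (dr f) = of_int K" unfolding K_def by (rule I0)
    \<comment> \<open>Edges without a common end meet in interior points only, by simplicity at most
      once, and then properly.\<close>
    have I2: "of_int K = (of_bool (edges_cross dr e f) :: bit)"
    proof (cases "edges_cross dr e f")
      case True
      then obtain p where p: "p \<in> edge_interior dr e" "p \<in> edge_interior dr f" by (auto simp: edges_cross_def)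
      have ef: "e \<noteq> f" using dis euv by auto
      have "path_image (dr e) \<inter> path_image (dr f) = {p}"
        using G p e(1) f(1) ef unfolding simple_topological_graph_def edge_interior_def by blast
      moreover have "proper_crossing_at (dr e) (dr f) p"
        using tg p e(1) f(1) ef unfolding topological_graph_def by blast
      moreover have "p \<notin> {pathstart (dr e), pathfinish (dr e), pathstart (dr f), pathfinish (dr f)}"
        using p arc(2)[OF e(1)] arc(2)[OF f(1)] by (auto simp: edge_interior_def)
      ultimately have "intersection_number (dr e) (dr f) = 1 \<or> intersection_number (dr e) (dr f) = - 1"
        using arc(1) e(1) f(1) by (intro intersection_number_proper_crossing) auto
      then have "K = 1 \<or> K = -1" unfolding I by (metis of_int_1 of_int_eq_iff of_int_minus)
      then show ?thesis using True by auto
    next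
      case False
      have "path_image (dr e) \<inter> path_image (dr f) = {}"
      proof (rule ccontr)
        assume "path_image (dr e) \<inter> path_image (dr f) \<noteq> {}"
        then obtain q where q: "q \<in> path_image (dr e)" "q \<in> path_image (dr f)" by auto
        have "q \<notin> V" using q arc(3)[OF e(1)] arc(3)[OF f(1)] dis by blast
        then have "q \<notin> e" "q \<notin> f" using arc(4) e(1) f(1) by auto
        then show False using False q by (auto simp: edges_cross_def edge_interior_def)
      qed
      then have "intersection_number (dr e) (dr f) = 0"
        using arc(1) e(1) f(1) by (intro intersection_number_disjoint) (auto simp: arc_imp_path)
      then have "K = 0" unfolding I by (metis of_int_eq_0_iff)
      then show ?thesis using False by simp
    qed
    have "(of_bool (edges_cross dr e f) :: bit) = of_int K" by (rule I2[symmetric])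
    also have "\<dots> = t u y + t u x + t v y + t v x + (n f u + n f v + n e y + n e x)"
      by (simp only: K_def of_int_add of_int_diff of_int_of_bool bit_diff_eq_add t_def n_def)
    finally show ?thesis by (simp only: ac_simps)
  qed
  show ?thesis unfolding parity_rep_def
  proof (intro exI[of _ t] exI[of _ n] conjI allI impI)
    fix u v x y assume A: "{u, v} \<in> E \<and> {x, y} \<in> E \<and> u \<noteq> v \<and> x \<noteq> y \<and> {u, v} \<inter> {x, y} = {}"
    \<comment> \<open>An edge is an unordered pair while its arc has a direction. The formula is
      symmetric in the two ends of each edge, so all four combinations reduce to
      \<open>main\<close>.\<close>
    have 1: "u = pathstart (dr {u,v}) \<and> v = pathfinish (dr {u,v}) \<or> v = pathstart (dr {u,v}) \<and> u = pathfinish (dr {u,v})"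
      using arc(2)[of "{u,v}"] A by (auto simp: doubleton_eq_iff)
    have 2: "x = pathstart (dr {x,y}) \<and> y = pathfinish (dr {x,y}) \<or> y = pathstart (dr {x,y}) \<and> x = pathfinish (dr {x,y})"
      using arc(2)[of "{x,y}"] A by (auto simp: doubleton_eq_iff)
    show "of_bool (edges_cross dr {u, v} {x, y}) =
          t u x + t u y + t v x + t v y + n {u, v} x + n {u, v} y + n {x, y} u + n {x, y} v"
    proof -
      define e f where ef: "e = {u, v}" "f = {x, y}"
      have E: "e \<in> E" "f \<in> E" "e \<inter> f = {}" using A ef by auto
      have "of_bool (edges_cross dr e f) = t u x + t u y + t v x + t v y + n e x + n e y + n f u + n f v"
        using 1 2 unfolding ef[symmetric]
      proof (elim disjE conjE)
        assume a: "u = pathstart (dr e)" "v = pathfinish (dr e)" "x = pathstart (dr f)" "y = pathfinish (dr f)"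
        show ?thesis by (rule main[OF E(1) a(1,2) E(2) a(3,4) E(3)])
      next
        assume a: "v = pathstart (dr e)" "u = pathfinish (dr e)" "x = pathstart (dr f)" "y = pathfinish (dr f)"
        show ?thesis using main[OF E(1) a(1,2) E(2) a(3,4) E(3)] by (simp only: ac_simps)
      next
        assume a: "u = pathstart (dr e)" "v = pathfinish (dr e)" "y = pathstart (dr f)" "x = pathfinish (dr f)"
        show ?thesis using main[OF E(1) a(1,2) E(2) a(3,4) E(3)] by (simp only: ac_simps)
      next
        assume a: "v = pathstart (dr e)" "u = pathfinish (dr e)" "y = pathstart (dr f)" "x = pathfinish (dr f)"
        show ?thesis using main[OF E(1) a(1,2) E(2) a(3,4) E(3)] by (simp only: ac_simps)
      qed
      then show ?thesis unfolding ef .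
    qed
  qed (rule t)
qed

text \<open>Each edge has exactly one end in \<open>A\<close>. For the \<open>A\<close>-ends
  \<open>a\<close>, \<open>b\<close> of two disjoint edges exactly one of \<open>t a b\<close> and
  \<open>t b a\<close> is 1, so the indicator \<open>m\<close> supplies the constant 1 while
  depending on one edge and one vertex.\<close>

lemma parity_rep_complement:
  fixes E :: "'v set set"
  assumes rep: "parity_rep E c" and AB: "A \<inter> B = {}"
    and bip: "\<And>e. e \<in> E \<Longrightarrow> e \<subseteq> A \<union> B \<and> e \<inter> A \<noteq> {} \<and> e \<inter> B \<noteq> {}"
  shows "parity_rep E (\<lambda>e f. \<not> c e f)"
proof -
  obtain t :: "'v \<Rightarrow> 'v \<Rightarrow> bit" and n :: "'v set \<Rightarrow> 'v \<Rightarrow> bit" where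
    t: "\<And>a b. a \<noteq> b \<Longrightarrow> t a b + t b a = 1" and
    n: "\<And>u v x y. {u, v} \<in> E \<Longrightarrow> {x, y} \<in> E \<Longrightarrow> u \<noteq> v \<Longrightarrow> x \<noteq> y \<Longrightarrow> {u, v} \<inter> {x, y} = {} \<Longrightarrow>
        of_bool (c {u, v} {x, y}) =
          t u x + t u y + t v x + t v y + n {u, v} x + n {u, v} y + n {x, y} u + n {x, y} v"
    using rep unfolding parity_rep_def by (elim exE conjE) metis
  define m :: "'v set \<Rightarrow> 'v \<Rightarrow> bit" where "m e a = of_bool (a \<in> A \<and> (\<exists>b\<in>e\<inter>A. t b a = 1))" for e a
  have m: "m {u, v} x + m {u, v} y + m {x, y} u + m {x, y} v = 1"
    if "{u, v} \<in> E" "{x, y} \<in> E" "{u, v} \<inter> {x, y} = {}" for u v x y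
  proof -
    have "u \<in> A \<and> v \<notin> A \<or> u \<notin> A \<and> v \<in> A" "x \<in> A \<and> y \<notin> A \<or> x \<notin> A \<and> y \<in> A"
      using bip[OF that(1)] bip[OF that(2)] AB by auto
    moreover have "of_bool (t a b = 1) + of_bool (t b a = 1) = (1::bit)" if "a \<noteq> b" for a b
      using t[OF that] by (cases "t a b"; cases "t b a") auto
    ultimately show ?thesis using that(3) by (elim disjE conjE; auto simp: m_def)
  qed
  show ?thesis unfolding parity_rep_def
  proof (intro exI[of _ t] exI[of _ "\<lambda>e a. n e a + m e a"] conjI allI impI)
    fix u v x y assume A: "{u, v} \<in> E \<and> {x, y} \<in> E \<and> u \<noteq> v \<and> x \<noteq> y \<and> {u, v} \<inter> {x, y} = {}"
    have "of_bool (\<not> c {u, v} {x, y}) = of_bool (c {u, v} {x, y}) + (1::bit)" by simp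
    also have "\<dots> = t u x + t u y + t v x + t v y + n {u, v} x + n {u, v} y + n {x, y} u + n {x, y} v +
        (m {u, v} x + m {u, v} y + m {x, y} u + m {x, y} v)"
      using A m[of u v x y] n[of u v x y] by simp
    finally show "of_bool (\<not> c {u, v} {x, y}) = t u x + t u y + t v x + t v y + (n {u, v} x + m {u, v} x) +
      (n {u, v} y + m {u, v} y) + (n {x, y} u + m {x, y} u) + (n {x, y} v + m {x, y} v)"
      by (simp only: ac_simps)
  qed (rule t)
qed

section \<open>Odd pairs from walks in a complete graph\<close>

fun walk_sum :: "('v \<Rightarrow> 'v \<Rightarrow> bit) \<Rightarrow> 'v list \<Rightarrow> bit" where
  "walk_sum F (a # b # w) = F a b + walk_sum F (b # w)"
| "walk_sum F w = 0"

lemma bit_add_self: "x + x = (0::bit)" "x + (x + y) = (y::bit)"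
  by (cases x; simp)+

lemma walk_sum_add: "walk_sum (\<lambda>a b. F a b + G a b) w = walk_sum F w + walk_sum G w"
  by (induction F w rule: walk_sum.induct) (simp_all only: walk_sum.simps ac_simps add_0)

lemma walk_sum_telescope: "w \<noteq> [] \<Longrightarrow> walk_sum (\<lambda>a b. g a + g b) w = g (hd w) + g (last w)"
proof (induction "\<lambda>a b :: 'a. g a + g b" w rule: walk_sum.induct)
  case (1 a b w)
  have "walk_sum (\<lambda>a b. g a + g b) (a # b # w) = (g a + g b) + (g b + g (last (b # w)))"
    using 1 by (simp only: walk_sum.simps list.sel) simp
  also have "\<dots> = g a + g (last (b # w))" by (simp only: ac_simps bit_add_self)
  finally show ?case by simp
qed (simp_all add: bit_add_self)

lemma walk_sum_cong:
  "(\<And>a b. (a, b) \<in> set (zip w (tl w)) \<Longrightarrow> F a b = G a b) \<Longrightarrow> walk_sum F w = walk_sum G w"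
  by (induction F w rule: walk_sum.induct) (auto simp del: add_bit_eq_xor)

lemma walk_sum_zero:
  "(\<And>a b. (a, b) \<in> set (zip w (tl w)) \<Longrightarrow> F a b = 0) \<Longrightarrow> walk_sum F w = 0"
  by (induction F w rule: walk_sum.induct) (auto simp del: add_bit_eq_xor)

definition is_walk :: "'v set set \<Rightarrow> 'v list \<Rightarrow> bool" where
  "is_walk E w \<longleftrightarrow> w \<noteq> [] \<and> (\<forall>(a, b) \<in> set (zip w (tl w)). a = b \<or> {a, b} \<in> E)"

lemma zip_tl_mem: "(a, b) \<in> set (zip w (tl w)) \<Longrightarrow> a \<in> set w \<and> b \<in> set w"
  by (cases w) (auto dest: set_zip_leftD set_zip_rightD)

text \<open>Each inner vertex of a walk contributes its terms twice, so the sum of \<open>c\<close>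
  over all pairs of steps has the same shape as the formula for a single pair of edges, with walk
  sums in place of \<open>n\<close>. Walks can thus play the part of edges.\<close>

lemma walks_parity:
  fixes t :: "'v \<Rightarrow> 'v \<Rightarrow> bit"
  assumes n: "\<And>u v x y. {u, v} \<in> E \<Longrightarrow> {x, y} \<in> E \<Longrightarrow> u \<noteq> v \<Longrightarrow> x \<noteq> y \<Longrightarrow> {u, v} \<inter> {x, y} = {} \<Longrightarrow>
        of_bool (c {u, v} {x, y}) =
          t u x + t u y + t v x + t v y + n {u, v} x + n {u, v} y + n {x, y} u + n {x, y} v"
    and w: "is_walk E w" "is_walk E w'" "set w \<inter> set w' = {}"
    and zero: "\<And>a b x y. (a, b) \<in> set (zip w (tl w)) \<Longrightarrow> (x, y) \<in> set (zip w' (tl w')) \<Longrightarrow>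
       a \<noteq> b \<Longrightarrow> x \<noteq> y \<Longrightarrow> \<not> c {a, b} {x, y}"
    and nn: "\<And>a b x. nn a b x = (if a = b then 0 else n {a, b} x)"
  shows "t (hd w) (hd w') + t (hd w) (last w') + t (last w) (hd w') + t (last w) (last w')
     + walk_sum (\<lambda>a b. nn a b (hd w')) w + walk_sum (\<lambda>a b. nn a b (last w')) w
     + walk_sum (\<lambda>a b. nn a b (hd w)) w' + walk_sum (\<lambda>a b. nn a b (last w)) w' = 0"
proof -
  \<comment> \<open>Steps that repeat a vertex are edges of value 0, and \<open>nn\<close> vanishes
    on them. The edge formula persists for them because all its remaining terms cancel in
    pairs.\<close>
  define cc :: "'v \<Rightarrow> 'v \<Rightarrow> 'v \<Rightarrow> 'v \<Rightarrow> bit"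
    where "cc a b x y = (if a = b \<or> x = y then 0 else of_bool (c {a, b} {x, y}))" for a b x y
  have cc: "cc a b x y = ((t a x + t a y + nn x y a) + (t b x + t b y + nn x y b)) + (nn a b x + nn a b y)"
    if "(a, b) \<in> set (zip w (tl w))" "(x, y) \<in> set (zip w' (tl w'))" for a b x y
  proof -
    have m: "a \<in> set w" "b \<in> set w" "x \<in> set w'" "y \<in> set w'" using zip_tl_mem that by fast+
    have "a = b \<or> {a, b} \<in> E" "x = y \<or> {x, y} \<in> E" using w(1,2) that unfolding is_walk_def by auto
    then consider "a = b" | "x = y" | "a \<noteq> b" "x \<noteq> y" "{a, b} \<in> E" "{x, y} \<in> E" by blast
    then show ?thesis
    proof cases
      case 1 show ?thesis unfolding 1 cc_def nn by (simp only: ac_simps bit_add_self add_0 simp_thms if_True)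
    next
      case 2 show ?thesis unfolding 2 cc_def nn by (simp only: ac_simps bit_add_self add_0 simp_thms if_True)
    next
      case 3
      have "{a, b} \<inter> {x, y} = {}" using m w(3) by auto
      from n[OF 3(3,4,1,2) this] show ?thesis
        unfolding cc_def nn using 3(1,2) by (simp only: ac_simps simp_thms if_False)
    qed
  qed
  have ne: "w \<noteq> []" "w' \<noteq> []" using w by (auto simp: is_walk_def)
  define N where "N x = walk_sum (\<lambda>a b. nn a b x) w" for x
  define g where "g x = t (hd w) x + t (last w) x + N x" for x
  have inner: "walk_sum (\<lambda>a b. cc a b x y) w = (g x + g y) + (nn x y (hd w) + nn x y (last w))"
    if xy: "(x, y) \<in> set (zip w' (tl w'))" for x y
  proof -
    have "walk_sum (\<lambda>a b. cc a b x y) w =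
       walk_sum (\<lambda>a b. ((t a x + t a y + nn x y a) + (t b x + t b y + nn x y b)) + (nn a b x + nn a b y)) w"
      by (rule walk_sum_cong) (rule cc[OF _ xy])
    also have "\<dots> = ((t (hd w) x + t (hd w) y + nn x y (hd w)) + (t (last w) x + t (last w) y + nn x y (last w))) + (N x + N y)"
      unfolding walk_sum_add N_def using walk_sum_telescope[OF ne(1), of "\<lambda>a. t a x + t a y + nn x y a"]
      by (simp only: walk_sum_add)
    finally show ?thesis unfolding g_def by (simp only: ac_simps)
  qed
  have "walk_sum (\<lambda>x y. walk_sum (\<lambda>a b. cc a b x y) w) w' =
      walk_sum (\<lambda>x y. (g x + g y) + (nn x y (hd w) + nn x y (last w))) w'"
    by (rule walk_sum_cong) (rule inner)
  also have "\<dots> = (g (hd w') + g (last w')) + (walk_sum (\<lambda>x y. nn x y (hd w)) w' + walk_sum (\<lambda>x y. nn x y (last w)) w')"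
    using walk_sum_telescope[OF ne(2), of g] by (simp only: walk_sum_add)
  finally have "walk_sum (\<lambda>x y. walk_sum (\<lambda>a b. cc a b x y) w) w' = \<dots>" .
  moreover have "walk_sum (\<lambda>x y. walk_sum (\<lambda>a b. cc a b x y) w) w' = 0"
    by (intro walk_sum_zero) (use zero in \<open>auto simp: cc_def\<close>)
  ultimately show ?thesis unfolding g_def N_def by (simp only: ac_simps)
qed

text \<open>The relations for the 15 disjoint pairs of edges are added. An edge and a vertex off it
  occur together in two pairs, so the \<open>N\<close> terms cancel. Two vertices occur in six
  pairs, so the \<open>t\<close> terms cancel too, up to a 1 for every term in inverted order. Among
  four vertices the interleaved pairing has one such term and the nested one has two; five
  quadruples give 15, which is odd.\<close>

lemma K5_parity_contradiction:
  fixes t :: "nat \<Rightarrow> nat \<Rightarrow> bit" and N :: "nat \<Rightarrow> nat \<Rightarrow> nat \<Rightarrow> bit"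
  assumes t: "\<And>a b. a < b \<Longrightarrow> b < 5 \<Longrightarrow> t b a = 1 + t a b"
    and z: "\<And>i j k l. i < j \<Longrightarrow> k < l \<Longrightarrow> i < k \<Longrightarrow> j < 5 \<Longrightarrow> l < 5 \<Longrightarrow> j \<noteq> k \<Longrightarrow> j \<noteq> l \<Longrightarrow>
      t i k + t i l + t j k + t j l + N i j k + N i j l + N k l i + N k l j = 0"
  shows False
proof -
  define F where "F i j k l = t i k + t i l + t j k + t j l + N i j k + N i j l + N k l i + N k l j" for i j k l
  have "0 = F 0 1 2 3 + F 0 2 1 3 + F 0 3 1 2 + F 0 1 2 4 + F 0 2 1 4 + F 0 4 1 2
     + F 0 1 3 4 + F 0 3 1 4 + F 0 4 1 3 + F 0 2 3 4 + F 0 3 2 4 + F 0 4 2 3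
     + F 1 2 3 4 + F 1 3 2 4 + F 1 4 2 3"
    unfolding F_def by (simp only: z arith_simps rel_simps simp_thms add_0 refl zero_less_numeral one_less_numeral_iff zero_less_one)
  also have "\<dots> = 1"
    unfolding F_def
    using t[of 1 2] t[of 1 3] t[of 1 4] t[of 2 3] t[of 2 4] t[of 3 4]
    by (simp only: arith_simps rel_simps simp_thms one_less_numeral_iff ac_simps bit_add_self add_0 add_0_right numeral_One)
  finally show False by simp
qed

text \<open>Otherwise the walks, taken as edges of the complete graph on five vertices, would
  satisfy the impossible relations of \<open>K5_parity_contradiction\<close>.\<close>

lemma K5_walks_odd_pair:
  fixes v :: "nat \<Rightarrow> 'v" and P :: "nat \<Rightarrow> nat \<Rightarrow> 'v list"
  assumes rep: "parity_rep E c"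
    and P: "\<And>i j. i < j \<Longrightarrow> j < 5 \<Longrightarrow> is_walk E (P i j) \<and> hd (P i j) = v i \<and> last (P i j) = v j"
    and dis: "\<And>i j k l. i < j \<Longrightarrow> k < l \<Longrightarrow> i < k \<Longrightarrow> j < 5 \<Longrightarrow> l < 5 \<Longrightarrow> j \<noteq> k \<Longrightarrow> j \<noteq> l \<Longrightarrow>
      set (P i j) \<inter> set (P k l) = {}"
  obtains i j k l a b x y where "i < j" "k < l" "i < k" "j < 5" "l < 5" "j \<noteq> k" "j \<noteq> l"
    "(a, b) \<in> set (zip (P i j) (tl (P i j)))" "(x, y) \<in> set (zip (P k l) (tl (P k l)))"
    "a \<noteq> b" "x \<noteq> y" "c {a, b} {x, y}"
proof (rule ccontr)
  assume "\<not> thesis"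
  then have no: "\<And>i j k l a b x y. i < j \<Longrightarrow> k < l \<Longrightarrow> i < k \<Longrightarrow> j < 5 \<Longrightarrow> l < 5 \<Longrightarrow> j \<noteq> k \<Longrightarrow> j \<noteq> l \<Longrightarrow>
    (a, b) \<in> set (zip (P i j) (tl (P i j))) \<Longrightarrow> (x, y) \<in> set (zip (P k l) (tl (P k l))) \<Longrightarrow>
    a \<noteq> b \<Longrightarrow> x \<noteq> y \<Longrightarrow> \<not> c {a, b} {x, y}"
    using that by meson
  obtain t :: "'v \<Rightarrow> 'v \<Rightarrow> bit" and n :: "'v set \<Rightarrow> 'v \<Rightarrow> bit" where
    t: "\<And>a b. a \<noteq> b \<Longrightarrow> t a b + t b a = 1" and
    n: "\<And>u v x y. {u, v} \<in> E \<Longrightarrow> {x, y} \<in> E \<Longrightarrow> u \<noteq> v \<Longrightarrow> x \<noteq> y \<Longrightarrow> {u, v} \<inter> {x, y} = {} \<Longrightarrow>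
        of_bool (c {u, v} {x, y}) =
          t u x + t u y + t v x + t v y + n {u, v} x + n {u, v} y + n {x, y} u + n {x, y} v"
    using rep unfolding parity_rep_def by (elim exE conjE) metis
  define nn where "nn a b x = (if a = b then 0 else n {a, b} x)" for a b x
  \<comment> \<open>Two further indices make \<open>a\<close> and \<open>b\<close> ends of two index
    pairs without a common member; the walks for these are disjoint, so the vertices differ.\<close>
  have vne: "v a \<noteq> v b" if ab: "a < b" "b < 5" for a b
  proof -
    obtain a' b' where "a' < 5" "b' < 5" "a' \<noteq> b'" "a' \<noteq> a" "a' \<noteq> b" "b' \<noteq> a" "b' \<noteq> b"
    proof -
      have "card ({..<5} - {a, b}) = 3" using ab by (subst card_Diff_subset) auto
      then obtain x y z where "{..<5} - {a, b} = {x, y, z}" "x \<noteq> y" by (auto simp: card_3_iff)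
      then have "x \<in> {..<5} - {a,b}" "y \<in> {..<5} - {a,b}" by auto
      then show thesis using that[of x y] \<open>x \<noteq> y\<close> by auto
    qed
    note q = this
    define i j where "i = min a a'" and "j = max a a'"
    define k l where "k = min b b'" and "l = max b b'"
    have kl: "i < j" "j < 5" "k < l" "l < 5" "i \<noteq> k" "j \<noteq> k" "j \<noteq> l" "i \<noteq> l" using ab q by (auto simp: i_def j_def k_def l_def min_def max_def)
    have "set (P i j) \<inter> set (P k l) = {}"
      using dis[of i j k l] dis[of k l i j] kl by (cases "i < k") (auto simp: Int_commute)
    moreover have "v i \<in> set (P i j)" "v j \<in> set (P i j)" "v k \<in> set (P k l)" "v l \<in> set (P k l)"
      using P[of i j] P[of k l] kl by (metis hd_in_set last_in_set is_walk_def)+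
    moreover have "a = i \<or> a = j" "b = k \<or> b = l" by (auto simp: i_def j_def k_def l_def min_def max_def)
    ultimately show ?thesis by auto
  qed
  show False
  proof (rule K5_parity_contradiction[of "\<lambda>i j. t (v i) (v j)" "\<lambda>i j k. walk_sum (\<lambda>a b. nn a b (v k)) (P i j)"])
    fix a b :: nat assume "a < b" "b < 5"
    then have "t (v a) (v b) + t (v b) (v a) = 1" by (intro t vne)
    then have "t (v a) (v b) + (t (v a) (v b) + t (v b) (v a)) = t (v a) (v b) + 1" by (simp only:)
    then show "t (v b) (v a) = 1 + t (v a) (v b)" by (simp only: bit_add_self add.commute)
  next
    fix i j k l :: nat assume A: "i < j" "k < l" "i < k" "j < 5" "l < 5" "j \<noteq> k" "j \<noteq> l"
    have p: "is_walk E (P i j)" "is_walk E (P k l)" "hd (P i j) = v i" "last (P i j) = v j"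
        "hd (P k l) = v k" "last (P k l) = v l" using P A by auto
    show "t (v i) (v k) + t (v i) (v l) + t (v j) (v k) + t (v j) (v l)
      + walk_sum (\<lambda>a b. nn a b (v k)) (P i j) + walk_sum (\<lambda>a b. nn a b (v l)) (P i j)
      + walk_sum (\<lambda>a b. nn a b (v i)) (P k l) + walk_sum (\<lambda>a b. nn a b (v j)) (P k l) = 0"
      using walks_parity[OF n p(1,2) dis[OF A] no[OF A] nn_def] unfolding p .
  qed
qed

section \<open>Complete minors of dense graphs\<close>

definition adj_pairs :: "('b \<Rightarrow> 'b \<Rightarrow> bool) \<Rightarrow> 'b set \<Rightarrow> 'b set set" where
  "adj_pairs R S = {{B, C} | B C. B \<in> S \<and> C \<in> S \<and> B \<noteq> C \<and> R B C}"

lemma adj_pairs_subset: "adj_pairs R S \<subseteq> Pow S"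
  by (auto simp: adj_pairs_def)

lemma card_adj_pairs_insert:
  assumes "finite S" "B \<notin> S" and sym: "\<And>B C. R B C \<Longrightarrow> R C B"
  shows "card (adj_pairs R (insert B S)) = card (adj_pairs R S) + card {C \<in> S. R B C}"
proof -
  have eq: "adj_pairs R (insert B S) = adj_pairs R S \<union> (\<lambda>C. {B, C}) ` {C \<in> S. R B C}"
  proof (intro equalityI subsetI)
    fix p assume "p \<in> adj_pairs R (insert B S)"
    then obtain X Y where "p = {X, Y}" "X \<in> insert B S" "Y \<in> insert B S" "X \<noteq> Y" "R X Y" unfolding adj_pairs_def by blast
    moreover from this sym have "R Y X" by blast
    ultimately show "p \<in> adj_pairs R S \<union> (\<lambda>C. {B, C}) ` {C \<in> S. R B C}"
      unfolding adj_pairs_def by (cases "X = B"; cases "Y = B") (auto simp: insert_commute)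
  qed (use assms(2) in \<open>auto simp: adj_pairs_def\<close>)
  have "finite (adj_pairs R S)" using assms(1) adj_pairs_subset finite_subset by (metis finite_Pow_iff)
  moreover have "adj_pairs R S \<inter> (\<lambda>C. {B, C}) ` {C \<in> S. R B C} = {}"
    using adj_pairs_subset[of R S] assms(2) by blast
  moreover have "inj_on (\<lambda>C. {B, C}) {C \<in> S. R B C}" by (auto simp: inj_on_def doubleton_eq_iff)
  ultimately show ?thesis unfolding eq using assms(1) by (subst card_Un_disjoint) (auto simp: card_image)
qed

lemma sum_degrees_adj_pairs:
  assumes "finite S" and sym: "\<And>B C. R B C \<Longrightarrow> R C B"
  shows "(\<Sum>B\<in>S. card {C \<in> S. C \<noteq> B \<and> R B C}) = 2 * card (adj_pairs R S)"
  using assms(1)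
proof (induction S)
  case empty then show ?case by (simp add: adj_pairs_def)
next
  case (insert B S)
  have 1: "{C \<in> insert B S. C \<noteq> B \<and> R B C} = {C \<in> S. R B C}" using insert.hyps by auto
  have 2: "card {C \<in> insert B S. C \<noteq> D \<and> R D C} = card {C \<in> S. C \<noteq> D \<and> R D C} + of_bool (R B D)" if "D \<in> S" for D
  proof (cases "R B D")
    case True
    then have "{C \<in> insert B S. C \<noteq> D \<and> R D C} = insert B {C \<in> S. C \<noteq> D \<and> R D C}" using that insert.hyps sym by auto
    then show ?thesis using True insert.hyps by simp
  next
    case False
    then have "{C \<in> insert B S. C \<noteq> D \<and> R D C} = {C \<in> S. C \<noteq> D \<and> R D C}" using sym by auto
    then show ?thesis using False by simp
  qed
  have "(\<Sum>D\<in>S. of_bool (R B D)) = card {C \<in> S. R B C}"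
    using insert.hyps by (simp add: Int_def)
  then show ?case using insert 1 2 by (simp add: card_adj_pairs_insert[OF _ _ sym] sum.distrib)
qed

definition conn_set :: "'v set set \<Rightarrow> 'v set \<Rightarrow> bool" where
  "conn_set E B \<longleftrightarrow> B \<noteq> {} \<and> (\<forall>x\<in>B. \<forall>y\<in>B. \<exists>w. is_walk E w \<and> hd w = x \<and> last w = y \<and> set w \<subseteq> B)"

definition adj_sets :: "'v set set \<Rightarrow> 'v set \<Rightarrow> 'v set \<Rightarrow> bool" where
  "adj_sets E B C \<longleftrightarrow> (\<exists>x\<in>B. \<exists>y\<in>C. {x, y} \<in> E)"

lemma adj_sets_sym: "adj_sets E B C \<Longrightarrow> adj_sets E C B"
  unfolding adj_sets_def by (metis insert_commute)

lemma is_walk_append: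
  assumes "is_walk E w" "is_walk E w'" "last w = hd w' \<or> {last w, hd w'} \<in> E"
  shows "is_walk E (w @ w')"
  using assms
proof (induction w)
  case (Cons a w)
  show ?case
  proof (cases w)
    case Nil
    then show ?thesis using Cons.prems by (cases w') (auto simp: is_walk_def)
  next
    case (Cons b w2)
    have "is_walk E w" using Cons.prems(1) Cons by (auto simp: is_walk_def)
    then have "is_walk E (w @ w')" using Cons.IH Cons.prems Cons by auto
    then show ?thesis using Cons.prems(1) Cons by (auto simp: is_walk_def)
  qed
qed (simp add: is_walk_def)

lemma walk_between_adjacent_sets:
  assumes "conn_set E B" "conn_set E C" "adj_sets E B C" "x \<in> B" "y \<in> C"
  obtains w where "is_walk E w" "hd w = x" "last w = y" "set w \<subseteq> B \<union> C"
proof -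
  obtain p q where pq: "p \<in> B" "q \<in> C" "{p, q} \<in> E" using assms(3) by (auto simp: adj_sets_def)
  obtain w1 where w1: "is_walk E w1" "hd w1 = x" "last w1 = p" "set w1 \<subseteq> B"
    using assms pq unfolding conn_set_def by blast
  obtain w2 where w2: "is_walk E w2" "hd w2 = q" "last w2 = y" "set w2 \<subseteq> C"
    using assms pq unfolding conn_set_def by blast
  have "w1 \<noteq> []" "w2 \<noteq> []" using w1 w2 by (auto simp: is_walk_def)
  then show ?thesis using that[of "w1 @ w2"] is_walk_append[OF w1(1) w2(1)] w1 w2 pq by auto
qed

lemma conn_set_Un:
  assumes B: "conn_set E B" and C: "conn_set E C" and a: "adj_sets E B C"
  shows "conn_set E (B \<union> C)"
  unfolding conn_set_def
proof (intro conjI ballI)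
  fix x y assume "x \<in> B \<union> C" "y \<in> B \<union> C"
  then consider "x \<in> B" "y \<in> B" | "x \<in> B" "y \<in> C" | "x \<in> C" "y \<in> B" | "x \<in> C" "y \<in> C" by blast
  then show "\<exists>w. is_walk E w \<and> hd w = x \<and> last w = y \<and> set w \<subseteq> B \<union> C"
  proof cases
    case 1 then show ?thesis using B unfolding conn_set_def by (meson le_supI1)
  next
    case 2 then show ?thesis using walk_between_adjacent_sets[OF B C a] by metis
  next
    case 3 then show ?thesis using walk_between_adjacent_sets[OF C B adj_sets_sym[OF a]] by (metis Un_commute)
  next
    case 4 then show ?thesis using C unfolding conn_set_def by (meson le_supI2)
  qed
qed (use B in \<open>auto simp: conn_set_def\<close>)

text \<open>Mader's argument. Merging two adjacent sets with fewer than \<open>2 ^ Suc t\<close>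
  common neighbours loses one set and at most \<open>2 ^ Suc t\<close> adjacencies, so the density
  survives. If no such pair is left, the neighbours of one set span minimum degree
  \<open>2 ^ Suc t\<close>, hence density \<open>2 ^ t\<close>, and the minor found among them is
  extended by that set. As each branch set contains a member of the family, it remains adjacent to
  the added set.\<close>

lemma complete_minor:
  fixes E :: "'v set set" and S :: "'v set set"
  assumes "finite S" "S \<noteq> {}" "pairwise disjnt S" "\<And>B. B \<in> S \<Longrightarrow> conn_set E B"
    and "2 ^ t * card S \<le> card (adj_pairs (adj_sets E) S)"
  shows "\<exists>T. card T = Suc t \<and> pairwise disjnt T \<and> pairwise (adj_sets E) T \<and>
     (\<forall>D\<in>T. conn_set E D \<and> D \<subseteq> \<Union>S \<and> (\<exists>C\<in>S. C \<subseteq> D))"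
  using assms
proof (induction t arbitrary: S)
  case 0
  then obtain B where "B \<in> S" by auto
  then show ?case using 0 by (intro exI[of _ "{B}"]) auto
next
  case (Suc t)
  note outer = Suc.IH
  from Suc.prems show ?case
  proof (induction "card S" arbitrary: S rule: less_induct)
    case less
    note S = less.prems
    let ?R = "adj_sets E"
    show ?case
    proof (cases "\<exists>B\<in>S. \<exists>C\<in>S. B \<noteq> C \<and> ?R B C \<and> card {D \<in> S - {B, C}. ?R B D \<and> ?R C D} < 2 ^ Suc t")
      case True
      then obtain B C where BC: "B \<in> S" "C \<in> S" "B \<noteq> C" "?R B C"
        and few: "card {D \<in> S - {B, C}. ?R B D \<and> ?R C D} < 2 ^ Suc t" by blast
      define A where "A = S - {B, C}"
      have fA: "finite A" using S(1) by (simp add: A_def)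
      have SA: "S = insert B (insert C A)" "C \<notin> A" "B \<notin> insert C A" using BC by (auto simp: A_def)
      have dBC: "disjnt (B \<union> C) D" if "D \<in> A" for D
        using S(3) that BC unfolding A_def pairwise_def by (auto simp: disjnt_Un1)
      have neBC: "B \<noteq> {}" using S(4)[OF BC(1)] by (simp add: conn_set_def)
      have BCA: "B \<union> C \<notin> A" using dBC neBC by (auto simp: disjnt_def)
      define S' where "S' = insert (B \<union> C) A"
      have cS: "card S = Suc (Suc (card A))" using SA fA by simp
      have cS': "card S' = Suc (card A)" using BCA fA by (simp add: S'_def)
      have "card (adj_pairs ?R S) = card (adj_pairs ?R A) + card {D \<in> A. ?R C D} + card {D \<in> insert C A. ?R B D}"
        unfolding SA(1) using SA fA by (simp add: card_adj_pairs_insert[OF _ _ adj_sets_sym])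
      also have "{D \<in> insert C A. ?R B D} = insert C {D \<in> A. ?R B D}" using BC by auto
      also have "card \<dots> = Suc (card {D \<in> A. ?R B D})" using SA fA by simp
      finally have e1: "card (adj_pairs ?R S) = card (adj_pairs ?R A) + card {D \<in> A. ?R C D} + Suc (card {D \<in> A. ?R B D})" .
      have "card (adj_pairs ?R S') = card (adj_pairs ?R A) + card {D \<in> A. ?R (B \<union> C) D}"
        unfolding S'_def using BCA fA by (simp add: card_adj_pairs_insert[OF _ _ adj_sets_sym])
      also have "{D \<in> A. ?R (B \<union> C) D} = {D \<in> A. ?R B D} \<union> {D \<in> A. ?R C D}" by (auto simp: adj_sets_def)
      finally have e2: "card (adj_pairs ?R S') = card (adj_pairs ?R A) + card ({D \<in> A. ?R B D} \<union> {D \<in> A. ?R C D})" .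
      have "card {D \<in> A. ?R B D} + card {D \<in> A. ?R C D} =
         card ({D \<in> A. ?R B D} \<union> {D \<in> A. ?R C D}) + card ({D \<in> A. ?R B D} \<inter> {D \<in> A. ?R C D})"
        using fA by (intro card_Un_Int) auto
      moreover have "{D \<in> A. ?R B D} \<inter> {D \<in> A. ?R C D} = {D \<in> S - {B, C}. ?R B D \<and> ?R C D}" by (auto simp: A_def)
      ultimately have "card (adj_pairs ?R S) \<le> card (adj_pairs ?R S') + 2 ^ Suc t" using e1 e2 few by simp
      then have many: "2 ^ Suc t * card S' \<le> card (adj_pairs ?R S')" using S(5) cS cS' by simp
      have pd: "pairwise disjnt S'"
        unfolding S'_def pairwise_insert using S(3) dBC
        by (auto simp: A_def disjnt_sym pairwise_def)
      have cn: "conn_set E D" if "D \<in> S'" for D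
        using that S(4) BC unfolding S'_def A_def by (auto intro: conn_set_Un)
      obtain T where T: "card T = Suc (Suc t)" "pairwise disjnt T" "pairwise ?R T"
          "\<And>D. D \<in> T \<Longrightarrow> conn_set E D \<and> D \<subseteq> \<Union>S' \<and> (\<exists>C\<in>S'. C \<subseteq> D)"
        using less.hyps[of S'] cS cS' fA pd cn many by (auto simp: S'_def)
      have "\<Union>S' = \<Union>S" unfolding S'_def SA(1) by auto
      moreover have "\<exists>X\<in>S. X \<subseteq> D" if "X \<in> S'" "X \<subseteq> D" for X D
        using that SA(1) unfolding S'_def by auto
      ultimately show ?thesis using T by metis
    next
      case False
      have "card (adj_pairs ?R S) > 0"
      proof -
        have "0 < 2 ^ Suc t * card S" using S(1,2) by (simp add: card_gt_0_iff)
        then show ?thesis using S(5) by linarith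
      qed
      then have "adj_pairs ?R S \<noteq> {}" by auto
      then obtain B C where BC: "B \<in> S" "C \<in> S" "B \<noteq> C" "?R B C" by (auto simp: adj_pairs_def)
      define N where "N = {D \<in> S. D \<noteq> B \<and> ?R B D}"
      have N: "finite N" "N \<noteq> {}" "N \<subseteq> S" "B \<notin> N" using S(1) BC by (auto simp: N_def)
      have deg: "2 ^ Suc t \<le> card {D \<in> N. D \<noteq> C \<and> ?R C D}" if "C \<in> N" for C
      proof -
        have "\<not> card {D \<in> S - {B, C}. ?R B D \<and> ?R C D} < 2 ^ Suc t"
          using False BC(1) that by (auto simp: N_def)
        moreover have "{D \<in> S - {B, C}. ?R B D \<and> ?R C D} = {D \<in> N. D \<noteq> C \<and> ?R C D}"
          by (auto simp: N_def)
        ultimately show ?thesis by simp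
      qed
      have "2 ^ Suc t * card N = (\<Sum>C\<in>N. 2 ^ Suc t)" by simp
      also have "\<dots> \<le> (\<Sum>C\<in>N. card {D \<in> N. D \<noteq> C \<and> ?R C D})" by (rule sum_mono) (rule deg)
      also have "\<dots> = 2 * card (adj_pairs ?R N)" by (rule sum_degrees_adj_pairs[OF N(1) adj_sets_sym])
      finally have "2 ^ t * card N \<le> card (adj_pairs ?R N)" by simp
      then obtain T where T: "card T = Suc t" "pairwise disjnt T" "pairwise ?R T"
          "\<And>D. D \<in> T \<Longrightarrow> conn_set E D \<and> D \<subseteq> \<Union>N \<and> (\<exists>C\<in>N. C \<subseteq> D)"
        using outer[of N] N S(3,4) pairwise_subset[OF S(3) N(3)] by (metis subsetD)
      have Bd: "disjnt B D" if "D \<in> T" for D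
      proof -
        have "disjnt B X" if "X \<in> N" for X using S(3) BC(1) that unfolding N_def pairwise_def by auto
        then show ?thesis using T(4)[OF that] by (fastforce simp: disjnt_def)
      qed
      have Br: "?R B D" if "D \<in> T" for D
        using T(4)[OF that] unfolding N_def adj_sets_def by blast
      have "B \<notin> T" using Bd[of B] S(4)[OF BC(1)] by (auto simp: conn_set_def)
      moreover have "finite T" using T(1) by (metis card.infinite nat.distinct(1))
      ultimately have "card (insert B T) = Suc (Suc t)" using T(1) by simp
      moreover have "pairwise disjnt (insert B T)" using T(2) Bd by (auto simp: pairwise_insert disjnt_sym)
      moreover have "pairwise ?R (insert B T)" using T(3) Br by (auto simp: pairwise_insert adj_sets_sym)
      moreover have "\<forall>D\<in>insert B T. conn_set E D \<and> D \<subseteq> \<Union>S \<and> (\<exists>C\<in>S. C \<subseteq> D)"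
      proof
        fix D assume "D \<in> insert B T"
        then consider "D = B" | "D \<in> T" by blast
        then show "conn_set E D \<and> D \<subseteq> \<Union>S \<and> (\<exists>C\<in>S. C \<subseteq> D)"
        proof cases
          case 1
          then show ?thesis using S(4)[OF BC(1)] BC(1) by blast
        next
          case 2
          have "\<Union>N \<subseteq> \<Union>S" using N(3) by (rule Union_mono)
          then show ?thesis using T(4)[OF 2] N(3) by (meson order_trans subsetD)
        qed
      qed
      ultimately show ?thesis by (intro exI[of _ "insert B T"] conjI)
    qed
  qed
qed

text \<open>16 is \<open>2 ^ 4\<close>, which yields five branch sets. The walk joining two of them
  stays in their union, so walks without a common end are disjoint.\<close>

lemma odd_pair_of_many_edges:
  assumes fin: "finite V" "V \<noteq> {}" and E: "\<And>e. e \<in> E \<Longrightarrow> e \<subseteq> V \<and> card e = 2"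
    and many: "16 * card V \<le> card E" and rep: "parity_rep E c"
  obtains e f where "e \<in> E" "f \<in> E" "e \<inter> f = {}" "c e f"
proof -
  define S where "S = (\<lambda>v. {v}) ` V"
  have S: "finite S" "S \<noteq> {}" "pairwise disjnt S" "card S = card V"
    using fin by (auto simp: S_def pairwise_def card_image)
  have cn: "conn_set E B" if BS: "B \<in> S" for B
  proof -
    obtain x where "B = {x}" using BS by (auto simp: S_def)
    moreover have "is_walk E [x]" by (simp add: is_walk_def)
    ultimately show ?thesis unfolding conn_set_def by (auto intro!: exI[of _ "[x]"])
  qed
  have "card E \<le> card (adj_pairs (adj_sets E) S)"
  proof (rule card_inj_on_le[of "\<lambda>e. (\<lambda>v. {v}) ` e"])
    show "inj_on (\<lambda>e. (\<lambda>v. {v}) ` e) E" by (auto simp: inj_on_def inj_image_eq_iff)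
    show "finite (adj_pairs (adj_sets E) S)" using S(1) adj_pairs_subset finite_subset by (metis finite_Pow_iff)
    show "(\<lambda>e. (\<lambda>v. {v}) ` e) ` E \<subseteq> adj_pairs (adj_sets E) S"
    proof clarify
      fix e assume e: "e \<in> E"
      then obtain x y where "e = {x, y}" "x \<noteq> y" "x \<in> V" "y \<in> V" using E[OF e] by (auto simp: card_2_iff)
      then show "(\<lambda>v. {v}) ` e \<in> adj_pairs (adj_sets E) S"
        using e unfolding adj_pairs_def S_def adj_sets_def by (intro CollectI exI[of _ "{x}"] exI[of _ "{y}"]) auto
    qed
  qed
  then have "2 ^ 4 * card S \<le> card (adj_pairs (adj_sets E) S)" using many S by simp
  from complete_minor[OF S(1-3) cn this] obtain T where T: "card T = 5" "pairwise disjnt T" "pairwise (adj_sets E) T"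
    "\<And>D. D \<in> T \<Longrightarrow> conn_set E D" by auto
  then obtain B where B: "bij_betw B {..<5::nat} T" using ex_bij_betw_nat_finite[of T] 
    by (metis atLeast0LessThan card.infinite zero_neq_numeral)
  have BT: "B i \<in> T" if "i < 5" for i using B that by (auto simp: bij_betw_def)
  have Bne: "B i \<noteq> B j" if "i < 5" "j < 5" "i \<noteq> j" for i j
    using B that by (auto simp: bij_betw_def inj_on_def)
  have Bd: "B i \<inter> B j = {}" if "i < 5" "j < 5" "i \<noteq> j" for i j
    using T(2) BT Bne[OF that] that unfolding pairwise_def disjnt_def by auto
  have Ba: "adj_sets E (B i) (B j)" if "i < 5" "j < 5" "i \<noteq> j" for i j
    using T(3) BT Bne[OF that] that unfolding pairwise_def by auto
  define v where "v i = (SOME x. x \<in> B i)" for i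
  have v: "v i \<in> B i" if "i < 5" for i
    using T(4)[OF BT[OF that]] unfolding v_def conn_set_def by (simp add: some_in_eq)
  have "\<forall>i j. \<exists>w. i < j \<longrightarrow> j < 5 \<longrightarrow> is_walk E w \<and> hd w = v i \<and> last w = v j \<and> set w \<subseteq> B i \<union> B j"
  proof (intro allI)
    fix i j :: nat
    show "\<exists>w. i < j \<longrightarrow> j < 5 \<longrightarrow> is_walk E w \<and> hd w = v i \<and> last w = v j \<and> set w \<subseteq> B i \<union> B j"
    proof (cases "i < j \<and> j < 5")
      case True
      then show ?thesis
        using walk_between_adjacent_sets[of E "B i" "B j" "v i" "v j"] T(4) BT Ba v
        by (metis less_imp_neq less_trans)
    qed auto
  qed
  then obtain P where P: "\<And>i j. i < j \<Longrightarrow> j < 5 \<Longrightarrow>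
      is_walk E (P i j) \<and> hd (P i j) = v i \<and> last (P i j) = v j \<and> set (P i j) \<subseteq> B i \<union> B j" by metis
  have Pdis: "set (P i j) \<inter> set (P k l) = {}"
    if "i < j" "k < l" "i < k" "j < 5" "l < 5" "j \<noteq> k" "j \<noteq> l" for i j k l
  proof -
    have "set (P i j) \<subseteq> B i \<union> B j" "set (P k l) \<subseteq> B k \<union> B l" using P that by auto
    moreover have "B i \<inter> B k = {}" "B i \<inter> B l = {}" "B j \<inter> B k = {}" "B j \<inter> B l = {}"
      using that by (intro Bd; simp)+
    ultimately show ?thesis by blast
  qed
  show thesis
  proof (rule K5_walks_odd_pair[of E c P v])
    fix i j k l a b x y
    assume A: "i < j" "k < l" "i < k" "j < (5::nat)" "l < 5" "j \<noteq> k" "j \<noteq> l"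
      "(a, b) \<in> set (zip (P i j) (tl (P i j)))" "(x, y) \<in> set (zip (P k l) (tl (P k l)))"
      "a \<noteq> b" "x \<noteq> y" "c {a, b} {x, y}"
    have "{a, b} \<in> E" using P[of i j] A unfolding is_walk_def by auto
    moreover have "{x, y} \<in> E" using P[of k l] A unfolding is_walk_def by auto
    moreover have "{a, b} \<inter> {x, y} = {}"
      using zip_tl_mem[OF A(8)] zip_tl_mem[OF A(9)] Pdis[OF A(1-7)] by auto
    ultimately show thesis using that A(12) by blast
  qed (use rep P Pdis in blast)+
qed

section \<open>Quadrilaterals of pseudo-segments\<close>

text \<open>The three arcs form a theta curve: \<open>c\<close> splits the inside of the closed
  curve into two parts, one bounded by \<open>c1\<close> and \<open>c\<close>, the other by
  \<open>c2\<close> and \<open>c\<close>. A connected set that avoids \<open>c\<close> stays in one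
  part, and its closure cannot reach both \<open>c1\<close> and \<open>c2\<close> away from
  \<open>a\<close> and \<open>b\<close>.\<close>

lemma chords_inside_meet:
  fixes c1 c2 c :: "real \<Rightarrow> complex"
  assumes c1: "arc c1" "pathstart c1 = a" "pathfinish c1 = b"
    and c2: "arc c2" "pathstart c2 = a" "pathfinish c2 = b"
    and c: "arc c" "pathstart c = a" "pathfinish c = b"
    and c1c2: "path_image c1 \<inter> path_image c2 = {a, b}"
    and cin: "path_image c - {a, b} \<subseteq> inside (path_image c1 \<union> path_image c2)"
    and X: "connected X" "X \<subseteq> inside (path_image c1 \<union> path_image c2)"
    and r: "r \<in> closure X" "r \<in> path_image c1 - {a, b}"
    and s: "s \<in> closure X" "s \<in> path_image c2 - {a, b}"
  shows "X \<inter> path_image c \<noteq> {}"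
proof
  assume dis: "X \<inter> path_image c = {}"
  have ab: "a \<noteq> b" using c1 by (metis arc_distinct_ends)
  have disin: "path_image c1 \<inter> inside (path_image c1 \<union> path_image c2) = {}"
     "path_image c2 \<inter> inside (path_image c1 \<union> path_image c2) = {}"
    using inside_no_overlap[of "path_image c1 \<union> path_image c2"] by blast+
  have ends: "a \<in> path_image c" "b \<in> path_image c" "a \<in> path_image c1" "b \<in> path_image c1" "a \<in> path_image c2" "b \<in> path_image c2"
    using c c1 c2 pathstart_in_path_image pathfinish_in_path_image by metis+
  have c1c: "path_image c1 \<inter> path_image c = {a, b}" using cin disin ends by blast
  have c2c: "path_image c2 \<inter> path_image c = {a, b}" using cin disin ends by blast
  have "\<exists>z. z \<in> path_image c \<and> z \<noteq> a \<and> z \<noteq> b"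
  proof (rule ccontr)
    assume "\<not> ?thesis"
    then have "path_image c \<subseteq> {a, b}" by auto
    then have "finite (path_image c)" by (simp add: finite_subset)
    moreover have "infinite (path_image c)"
      using connected_finite_iff_sing[OF connected_arc_image[OF c(1)]] ends ab by auto
    ultimately show False by simp
  qed
  then have ne: "path_image c \<inter> inside (path_image c1 \<union> path_image c2) \<noteq> {}" using cin by blast
  have split: "inside (path_image c1 \<union> path_image c) \<inter> inside (path_image c2 \<union> path_image c) = {} \<and>
      inside (path_image c1 \<union> path_image c) \<union> inside (path_image c2 \<union> path_image c) \<union> (path_image c - {a, b})
        = inside (path_image c1 \<union> path_image c2)"
    by (rule split_inside_simple_closed_curve[OF arc_imp_simple_path[OF c1(1)] c1(2,3)
        arc_imp_simple_path[OF c2(1)] c2(2,3) arc_imp_simple_path[OF c(1)] c(2,3) ab c1c2 c1c c2c ne]) blast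
  let ?I1 = "inside (path_image c1 \<union> path_image c)" and ?I2 = "inside (path_image c2 \<union> path_image c)"
  have cl: "closed (path_image c1 \<union> path_image c)" "closed (path_image c2 \<union> path_image c)"
    using c c1 c2 by (auto intro!: closed_Un closed_path_image arc_imp_path)
  have op: "open ?I1" "open ?I2" using cl open_inside by blast+
  have XI: "X \<subseteq> ?I1 \<union> ?I2" using split X(2) dis by blast
  have "X \<subseteq> ?I1 \<or> X \<subseteq> ?I2"
    using connectedD[OF X(1) op _ XI] split XI by blast
  then show False
  proof
    assume "X \<subseteq> ?I1"
    then have "closure X \<subseteq> ?I1 \<union> (path_image c1 \<union> path_image c)"
      using closure_mono closure_inside_subset[OF cl(1)] by blast
    then have "s \<in> ?I1" using s c1c2 c2c by blast
    then have "s \<in> inside (path_image c1 \<union> path_image c2)" using split by blast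
    then show False using s disin by blast
  next
    assume "X \<subseteq> ?I2"
    then have "closure X \<subseteq> ?I2 \<union> (path_image c2 \<union> path_image c)"
      using closure_mono closure_inside_subset[OF cl(2)] by blast
    then have "r \<in> ?I2" using r c1c2 c1c by blast
    then have "r \<in> inside (path_image c1 \<union> path_image c2)" using split by blast
    then show False using r disin by blast
  qed
qed

text \<open>Reduces chords outside a curve to chords inside one. The image of the outside, with 0
  added as the image of infinity, is bounded and open, and its union with the image of the curve is
  closed; so the unbounded component cannot meet it.\<close>

lemma inversion_outside_to_inside:
  fixes c :: "real \<Rightarrow> complex"
  assumes c: "simple_path c" "pathfinish c = pathstart c" and z0: "z0 \<in> inside (path_image c)"
  defines "\<phi> \<equiv> \<lambda>z. inverse (z - z0)"
  shows "\<phi> ` outside (path_image c) \<subseteq> inside (\<phi> ` path_image c)"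
proof -
  let ?C = "path_image c"
  have J: "open (inside ?C)" "connected (inside ?C)" "connected (outside ?C)" "\<not> bounded (outside ?C)"
     "inside ?C \<inter> outside ?C = {}" "inside ?C \<union> outside ?C = - ?C" "bounded (inside ?C)"
    using Jordan_inside_outside[OF c] by auto
  have z0C: "z0 \<notin> ?C" using z0 inside_no_overlap by blast
  have inj: "inj \<phi>" unfolding \<phi>_def by (rule injI) simp
  have cont: "continuous_on S \<phi>" if "z0 \<notin> S" for S
    unfolding \<phi>_def using that by (intro continuous_intros) auto
  have "simple_path (\<phi> \<circ> c)"
    by (intro simple_path_continuous_image c cont z0C inj_on_subset[OF inj subset_UNIV])
  moreover have "pathfinish (\<phi> \<circ> c) = pathstart (\<phi> \<circ> c)" using c by (simp add: pathfinish_compose pathstart_compose)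
  ultimately have K: "connected (outside (path_image (\<phi> \<circ> c)))" "\<not> bounded (outside (path_image (\<phi> \<circ> c)))"
     "inside (path_image (\<phi> \<circ> c)) \<union> outside (path_image (\<phi> \<circ> c)) = - path_image (\<phi> \<circ> c)"
    using Jordan_inside_outside by blast+
  note K = K[unfolded path_image_compose]
  obtain \<delta> where \<delta>: "\<delta> > 0" "ball z0 \<delta> \<subseteq> inside ?C" using J(1) z0 open_contains_ball by blast
  have bd: "cmod (\<phi> z) \<le> 1 / \<delta>" if "z \<in> outside ?C" for z
  proof -
    have "z \<notin> ball z0 \<delta>" using that \<delta>(2) J(5) by blast
    then have "\<delta> \<le> cmod (z - z0)" by (simp add: dist_norm norm_minus_commute)
    then have "inverse (cmod (z - z0)) \<le> inverse \<delta>" using \<delta>(1) by (rule le_imp_inverse_le)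
    then show ?thesis unfolding \<phi>_def norm_inverse by (simp add: inverse_eq_divide)
  qed
  \<comment> \<open>The unbounded component meets the image of a punctured neighbourhood of \<open>z0\<close>, so it lies in the image of the inside.\<close>
  have "outside (\<phi> ` ?C) \<inter> \<phi> ` outside ?C = {}"
  proof (rule ccontr)
    assume ne: "outside (\<phi> ` ?C) \<inter> \<phi> ` outside ?C \<noteq> {}"
    have o0: "open (outside (\<phi> ` ?C))"
      using \<open>simple_path (\<phi> \<circ> c)\<close> by (intro open_outside closed_path_image[of "\<phi> \<circ> c", unfolded path_image_compose] simple_path_imp_path)
    have z0o: "z0 \<notin> outside ?C" using z0 J(5) by blast
    define D where "D = insert 0 (\<phi> ` outside ?C)"
    have oD: "open D"
    proof -
      obtain R where R: "R > 0" "\<And>z. z \<in> inside ?C \<union> ?C \<Longrightarrow> cmod (z - z0) \<le> R"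
      proof -
        have "bounded (inside ?C \<union> ?C)" using J(7) c by (simp add: bounded_simple_path_image)
        then have "bounded ((\<lambda>z. z - z0) ` (inside ?C \<union> ?C))" by (rule bounded_translation_minus)
        then show ?thesis using that by (metis bounded_pos image_eqI)
      qed
      \<comment> \<open>Points close to 0 are images of points far away, and those are outside the
        curve.\<close>
      have sub: "ball 0 (1 / R) \<subseteq> D"
      proof
        fix w :: complex assume w: "w \<in> ball 0 (1 / R)"
        show "w \<in> D"
        proof (cases "w = 0")
          case False
          define z where "z = z0 + inverse w"
          have "\<phi> z = w" by (simp add: \<phi>_def z_def)
          moreover have "cmod (z - z0) > R" proof -
            have "cmod w * R < 1" "cmod w > 0" using w False R(1) by (simp_all add: field_simps)
            then have "R < inverse (cmod w)" by (simp add: field_simps)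
            then show ?thesis by (simp add: z_def norm_inverse)
          qed
          then have "z \<notin> inside ?C \<union> ?C" using R(2)[of z] by auto
          then have "z \<in> outside ?C" using J(6) by blast
          ultimately show ?thesis unfolding D_def by blast
        qed (simp add: D_def)
      qed
      have "open (\<phi> ` outside ?C)"
        by (rule invariance_of_domain[OF cont[OF z0o]])
           (use c in \<open>auto intro!: open_outside closed_path_image simple_path_imp_path inj_on_subset[OF inj]\<close>)
      then have "open (\<phi> ` outside ?C \<union> ball 0 (1 / R))" by auto
      moreover have "\<phi> ` outside ?C \<union> ball 0 (1 / R) = D" using sub R(1) by (auto simp: D_def)
      ultimately show ?thesis by simp
    qed
    have clD: "closed (D \<union> \<phi> ` ?C)"
    proof -
      have "- (D \<union> \<phi> ` ?C) = \<phi> ` (inside ?C - {z0})"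
      proof (intro equalityI subsetI)
        fix w assume w: "w \<in> - (D \<union> \<phi> ` ?C)"
        then have "w \<noteq> 0" by (auto simp: D_def)
        define z where "z = z0 + inverse w"
        have zw: "\<phi> z = w" "z \<noteq> z0" using \<open>w \<noteq> 0\<close> by (auto simp: \<phi>_def z_def)
        have "z \<notin> outside ?C" "z \<notin> ?C" using w zw(1) by (auto simp: D_def)
        then have "z \<in> inside ?C" using J(6) by blast
        then show "w \<in> \<phi> ` (inside ?C - {z0})" using zw by blast
      next
        fix w assume "w \<in> \<phi> ` (inside ?C - {z0})"
        then obtain z where z: "z \<in> inside ?C" "z \<noteq> z0" "w = \<phi> z" by blast
        have "w \<noteq> 0" using z by (simp add: \<phi>_def)
        moreover have "w \<notin> \<phi> ` outside ?C" "w \<notin> \<phi> ` ?C"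
          using z J(5) inside_no_overlap[of ?C] injD[OF inj] by blast+
        ultimately show "w \<in> - (D \<union> \<phi> ` ?C)" by (auto simp: D_def)
      qed
      moreover have "open (\<phi> ` (inside ?C - {z0}))"
        by (rule invariance_of_domain[OF cont]) (use J(1) in \<open>auto intro!: inj_on_subset[OF inj] open_delete\<close>)
      ultimately show ?thesis by (simp add: closed_def)
    qed
    have "outside (\<phi> ` ?C) \<subseteq> D"
      by (rule connected_subset_of_clopen[OF K(1) _ oD clD]) (use ne outside_no_overlap D_def in blast)+
    moreover have "bounded D" unfolding D_def bounded_insert
      using bd by (intro boundedI) auto
    ultimately show False using K(2) bounded_subset by blast
  qed
  moreover have "\<phi> ` outside ?C \<inter> \<phi> ` ?C = {}" using inj outside_no_overlap[of ?C] by (metis image_Int image_empty Int_commute)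
  ultimately show ?thesis using K(3) by blast
qed

text \<open>For the outside an inversion is applied. Its centre is inside the curve, hence away from
  \<open>c\<close> and from the closure of \<open>X\<close>, so arcs, connectedness and closure
  points are carried over.\<close>

lemma chords_on_same_side_meet:
  fixes c1 c2 c :: "real \<Rightarrow> complex"
  assumes c1: "arc c1" "pathstart c1 = a" "pathfinish c1 = b"
    and c2: "arc c2" "pathstart c2 = a" "pathfinish c2 = b"
    and c: "arc c" "pathstart c = a" "pathfinish c = b"
    and c1c2: "path_image c1 \<inter> path_image c2 = {a, b}"
    and side: "S = inside (path_image c1 \<union> path_image c2) \<or> S = outside (path_image c1 \<union> path_image c2)"
    and cin: "path_image c - {a, b} \<subseteq> S"
    and X: "connected X" "X \<subseteq> S"
    and r: "r \<in> closure X" "r \<in> path_image c1 - {a, b}"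
    and s: "s \<in> closure X" "s \<in> path_image c2 - {a, b}"
  shows "X \<inter> path_image c \<noteq> {}"
  using side
proof
  assume "S = inside (path_image c1 \<union> path_image c2)"
  then show ?thesis using chords_inside_meet[OF c1 c2 c c1c2 _ X(1) _ r s] cin X by blast
next
  assume S: "S = outside (path_image c1 \<union> path_image c2)"
  define q where "q = c1 +++ reversepath c2"
  have q: "simple_path q" "pathfinish q = pathstart q" "path_image q = path_image c1 \<union> path_image c2"
    unfolding q_def using c1 c2 c1c2
    by (auto intro!: simple_path_join_loop arc_reversepath simp: path_image_join)
  have J: "inside (path_image q) \<noteq> {}" "open (inside (path_image q))" "inside (path_image q) \<inter> outside (path_image q) = {}"
    using Jordan_inside_outside[OF q(1,2)] by auto
  obtain z0 where z0: "z0 \<in> inside (path_image q)" using J(1) by auto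
  define \<phi> where "\<phi> = (\<lambda>z. inverse (z - z0))"
  have sub: "\<phi> ` outside (path_image q) \<subseteq> inside (\<phi> ` path_image q)"
    unfolding \<phi>_def by (rule inversion_outside_to_inside[OF q(1,2) z0])
  have inj: "inj \<phi>" unfolding \<phi>_def by (rule injI) simp
  have cont: "continuous_on Y \<phi>" if "z0 \<notin> Y" for Y
    unfolding \<phi>_def using that by (intro continuous_intros) auto
  have z0q: "z0 \<notin> path_image q" using z0 inside_no_overlap by blast
  have z0X: "z0 \<notin> closure X"
  proof
    assume "z0 \<in> closure X"
    then have "inside (path_image q) \<inter> X \<noteq> {}" using J(2) z0 by (meson disjoint_iff open_Int_closure_eq_empty IntI)
    moreover have "X \<subseteq> outside (path_image q)" using X(2) S q(3) by simp
    ultimately show False using J(3) by blast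
  qed
  have ab: "{a, b} \<subseteq> path_image c1"
    using c1 pathstart_in_path_image[of c1] pathfinish_in_path_image[of c1] by auto
  have z0c: "z0 \<notin> path_image c"
  proof
    assume z: "z0 \<in> path_image c"
    then have "z0 \<notin> {a, b}" using z0q q(3) ab by blast
    then have "z0 \<in> outside (path_image q)" using z cin S q(3) by auto
    then show False using J(3) z0 by blast
  qed
  have arcs: "arc (\<phi> \<circ> p)" if "arc p" "z0 \<notin> path_image p" for p
  proof -
    have "simple_path (\<phi> \<circ> p)"
      by (intro simple_path_continuous_image arc_imp_simple_path that cont inj_on_subset[OF inj subset_UNIV])
    moreover have "pathfinish (\<phi> \<circ> p) \<noteq> pathstart (\<phi> \<circ> p)"
      using arc_distinct_ends[OF that(1)] injD[OF inj] by (metis pathfinish_compose pathstart_compose)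
    ultimately show ?thesis by (simp add: arc_simple_path)
  qed
  have im: "path_image (\<phi> \<circ> c1) \<union> path_image (\<phi> \<circ> c2) = \<phi> ` path_image q"
    unfolding q(3) by (simp add: path_image_compose image_Un)
  have clos: "\<phi> z \<in> closure (\<phi> ` X)" if "z \<in> closure X" for z
  proof -
    have "\<phi> ` closure X \<subseteq> closure (\<phi> ` X)"
      by (rule image_closure_subset[OF cont[OF z0X] closed_closure closure_subset])
    then show ?thesis using that by blast
  qed
  have mem: "\<phi> z \<in> path_image (\<phi> \<circ> p) - {\<phi> a, \<phi> b}" if "z \<in> path_image p - {a, b}" for z p
    using that by (auto simp: path_image_compose inj_eq[OF inj])
  have "\<phi> ` X \<inter> path_image (\<phi> \<circ> c) \<noteq> {}"
  proof (rule chords_inside_meet[where ?c1.0 = "\<phi> \<circ> c1" and ?c2.0 = "\<phi> \<circ> c2" and a = "\<phi> a" and b = "\<phi> b"])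
    show "arc (\<phi> \<circ> c1)" "arc (\<phi> \<circ> c2)" "arc (\<phi> \<circ> c)" using z0q z0c q(3) by (auto intro!: arcs c1(1) c2(1) c(1))
    show "path_image (\<phi> \<circ> c1) \<inter> path_image (\<phi> \<circ> c2) = {\<phi> a, \<phi> b}"
      using image_Int[OF inj, of "path_image c1" "path_image c2"] c1c2 by (simp add: path_image_compose)
    show "path_image (\<phi> \<circ> c) - {\<phi> a, \<phi> b} \<subseteq> inside (path_image (\<phi> \<circ> c1) \<union> path_image (\<phi> \<circ> c2))"
      using sub cin S unfolding im q(3)[symmetric] by (auto simp: path_image_compose)
    show "connected (\<phi> ` X)"
      using X(1) z0X closure_subset by (intro connected_continuous_image cont) auto
    show "\<phi> ` X \<subseteq> inside (path_image (\<phi> \<circ> c1) \<union> path_image (\<phi> \<circ> c2))"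
      using sub X(2) S unfolding im q(3)[symmetric] by auto
    show "\<phi> r \<in> closure (\<phi> ` X)" "\<phi> s \<in> closure (\<phi> ` X)" using clos r s by auto
    show "\<phi> r \<in> path_image (\<phi> \<circ> c1) - {\<phi> a, \<phi> b}" by (rule mem[OF r(2)])
    show "\<phi> s \<in> path_image (\<phi> \<circ> c2) - {\<phi> a, \<phi> b}" by (rule mem[OF s(2)])
  qed (simp_all only: pathstart_compose pathfinish_compose c1 c2 c)
  then show ?thesis by (auto simp: path_image_compose inj_eq[OF inj])
qed

text \<open>The ends \<open>p\<close> and \<open>q\<close> of the chord \<open>c\<close> lie on
  opposite sides and cut the quadrilateral into two arcs, one containing the side \<open>U\<close>,
  the other the side \<open>V\<close>. A set that reaches from \<open>U\<close> to \<open>V\<close>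
  on the same side of the curve as \<open>c\<close> thus has ends interleaved with those of
  \<open>c\<close>.\<close>

lemma quadrilateral_chords_meet:
  fixes g1 g2 U V h1 h2 c :: "real \<Rightarrow> complex"
  assumes g1: "arc g1" "pathstart g1 = p" "pathfinish g1 = A" and g2: "arc g2" "pathstart g2 = p" "pathfinish g2 = B"
    and U: "arc U" "pathstart U = A" "pathfinish U = C" and V: "arc V" "pathstart V = B" "pathfinish V = D"
    and h1: "arc h1" "pathstart h1 = C" "pathfinish h1 = q" and h2: "arc h2" "pathstart h2 = D" "pathfinish h2 = q"
    and c: "arc c" "pathstart c = p" "pathfinish c = q"
    and gg: "path_image g1 \<inter> path_image g2 \<subseteq> {p}" and hh: "path_image h1 \<inter> path_image h2 \<subseteq> {q}"
    and gh: "(path_image g1 \<union> path_image g2) \<inter> (path_image h1 \<union> path_image h2) = {}"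
    and UV: "path_image U \<inter> path_image V = {}"
    and gU: "path_image g1 \<inter> path_image U \<subseteq> {A}" "path_image g2 \<inter> path_image V \<subseteq> {B}"
       "path_image g1 \<inter> path_image V = {}" "path_image g2 \<inter> path_image U = {}"
    and hU: "path_image U \<inter> path_image h1 \<subseteq> {C}" "path_image V \<inter> path_image h2 \<subseteq> {D}"
       "path_image h1 \<inter> path_image V = {}" "path_image h2 \<inter> path_image U = {}"
    and Q: "Q = path_image g1 \<union> path_image g2 \<union> path_image U \<union> path_image V \<union> path_image h1 \<union> path_image h2"
    and side: "S = inside Q \<or> S = outside Q"
    and cin: "path_image c - {p, q} \<subseteq> S"
    and X: "connected X" "X \<subseteq> S" "r \<in> closure X" "r \<in> path_image U" "s \<in> closure X" "s \<in> path_image V"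
  shows "X \<inter> path_image c \<noteq> {}"
proof -
  define c1 where "c1 = g1 +++ (U +++ h1)"
  define c2 where "c2 = g2 +++ (V +++ h2)"
  have ends: "p \<in> path_image g1" "A \<in> path_image g1" "p \<in> path_image g2" "B \<in> path_image g2"
    "A \<in> path_image U" "C \<in> path_image U" "B \<in> path_image V" "D \<in> path_image V"
    "C \<in> path_image h1" "q \<in> path_image h1" "D \<in> path_image h2" "q \<in> path_image h2"
    using g1 g2 U V h1 h2 by (metis pathstart_in_path_image pathfinish_in_path_image)+
  have im1: "path_image c1 = path_image g1 \<union> path_image U \<union> path_image h1"
    unfolding c1_def using g1 U h1 by (simp add: path_image_join Un_assoc)
  have im2: "path_image c2 = path_image g2 \<union> path_image V \<union> path_image h2"
    unfolding c2_def using g2 V h2 by (simp add: path_image_join Un_assoc)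
  have a1: "arc (U +++ h1)" using U h1 hU by (intro arc_join) auto
  have arc1: "arc c1" unfolding c1_def
  proof (rule arc_join[OF g1(1) a1])
    show "path_image g1 \<inter> path_image (U +++ h1) \<subseteq> {pathstart (U +++ h1)}"
      using U h1 gU gh by (simp add: path_image_join) blast
  qed (use g1 U in simp)
  have a2: "arc (V +++ h2)" using V h2 hU by (intro arc_join) auto
  have arc2: "arc c2" unfolding c2_def
  proof (rule arc_join[OF g2(1) a2])
    show "path_image g2 \<inter> path_image (V +++ h2) \<subseteq> {pathstart (V +++ h2)}"
      using V h2 gU gh by (simp add: path_image_join) blast
  qed (use g2 V in simp)
  have e: "pathstart c1 = p" "pathfinish c1 = q" "pathstart c2 = p" "pathfinish c2 = q"
    using g1 g2 h1 h2 U V by (auto simp: c1_def c2_def)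
  have int: "path_image c1 \<inter> path_image c2 = {p, q}"
  proof
    show "{p, q} \<subseteq> path_image c1 \<inter> path_image c2" unfolding im1 im2 using ends by simp
    have "path_image U \<inter> path_image h2 = {}" "path_image h1 \<inter> path_image g2 = {}" "path_image g1 \<inter> path_image h2 = {}"
      "path_image U \<inter> path_image g2 = {}"
      using hU(4) gU(4) gh by auto
    then show "path_image c1 \<inter> path_image c2 \<subseteq> {p, q}"
      unfolding im1 im2 Int_Un_distrib Int_Un_distrib2 using gg hh UV gU(3) hU(3) by auto
  qed
  have QQ: "Q = path_image c1 \<union> path_image c2" unfolding Q im1 im2 by blast
  have pA: "p \<noteq> A" "p \<noteq> B" "C \<noteq> q" "D \<noteq> q"
    using g1 g2 h1 h2 by (metis arc_distinct_ends)+
  have rr: "r \<in> path_image c1 - {p, q}"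
  proof -
    have "p \<notin> path_image U" "q \<notin> path_image U" using gU(1) hU(1) ends(1,10) pA by auto
    then show ?thesis using X(4) im1 by auto
  qed
  have ss: "s \<in> path_image c2 - {p, q}"
  proof -
    have "p \<notin> path_image V" "q \<notin> path_image V" using gU(2) hU(2) ends(3,12) pA by auto
    then show ?thesis using X(6) im2 by auto
  qed
  show ?thesis
    by (rule chords_on_same_side_meet[OF arc1 e(1,2) arc2 e(3,4) c int _ cin X(1,2) X(3) rr X(5) ss])
       (use side QQ in auto)
qed

section \<open>Pseudo-segments and chords of quadrilaterals\<close>

definition btw :: "real \<Rightarrow> real \<Rightarrow> real \<Rightarrow> bool" where
  "btw x y z \<longleftrightarrow> x < y \<and> y < z \<or> z < y \<and> y < x"

lemma btw_open_segment: "btw x y z \<longleftrightarrow> y \<in> open_segment x z"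
  by (auto simp: btw_def open_segment_eq_real_ivl)

locale pseudo_segments =
  fixes X :: "'e set" and \<gamma> :: "'e \<Rightarrow> real \<Rightarrow> complex"
  assumes finite_X: "finite X"
    and arc_\<gamma>: "\<And>e. e \<in> X \<Longrightarrow> arc (\<gamma> e)"
    and meet_once: "\<And>e f p q. e \<in> X \<Longrightarrow> f \<in> X \<Longrightarrow> e \<noteq> f \<Longrightarrow> p \<in> path_image (\<gamma> e) \<inter> path_image (\<gamma> f) \<Longrightarrow>
        q \<in> path_image (\<gamma> e) \<inter> path_image (\<gamma> f) \<Longrightarrow> p = q"
begin

definition cr :: "'e \<Rightarrow> 'e \<Rightarrow> bool" where
  "cr e f \<longleftrightarrow> e \<in> X \<and> f \<in> X \<and> e \<noteq> f \<and> (\<exists>s\<in>{0<..<1}. \<exists>s'\<in>{0<..<1}. \<gamma> e s = \<gamma> f s')"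

text \<open>The parameter of the crossing along \<open>e\<close>, meaningful only if
  \<open>cr e f\<close>. It turns the order of crossings along an arc into an order of real
  numbers.\<close>

definition tm :: "'e \<Rightarrow> 'e \<Rightarrow> real" where
  "tm e f = (SOME s. s \<in> {0<..<1} \<and> (\<exists>s'\<in>{0<..<1}. \<gamma> e s = \<gamma> f s'))"

lemma cr_sym: "cr e f \<Longrightarrow> cr f e"
  unfolding cr_def by metis

lemma crD: "cr e f \<Longrightarrow> e \<in> X \<and> f \<in> X \<and> e \<noteq> f"
  unfolding cr_def by auto

lemma tm: assumes "cr e f" shows "0 < tm e f" "tm e f < 1" "\<gamma> e (tm e f) \<in> path_image (\<gamma> f)" "\<gamma> e (tm e f) \<in> path_image (\<gamma> e)"
proof -
  have "\<exists>s. s \<in> {0<..<1} \<and> (\<exists>s'\<in>{0<..<1}. \<gamma> e s = \<gamma> f s')" using assms unfolding cr_def by blast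
  then have t: "tm e f \<in> {0<..<1} \<and> (\<exists>s'\<in>{0<..<1}. \<gamma> e (tm e f) = \<gamma> f s')" unfolding tm_def by (rule someI_ex)
  then show "0 < tm e f" "tm e f < 1" "\<gamma> e (tm e f) \<in> path_image (\<gamma> e)" by (auto simp: path_image_def)
  from t obtain s' where "s' \<in> {0<..<1}" "\<gamma> e (tm e f) = \<gamma> f s'" by blast
  then show "\<gamma> e (tm e f) \<in> path_image (\<gamma> f)" by (auto simp: path_image_def)
qed

lemma tm_unique:
  assumes "cr e f" "z \<in> path_image (\<gamma> e)" "z \<in> path_image (\<gamma> f)"
  shows "z = \<gamma> e (tm e f)"
  using meet_once[of e f z "\<gamma> e (tm e f)"] crD[OF assms(1)] tm[OF assms(1)] assms(2,3) by blast

lemma tm_sym: assumes "cr e f" shows "\<gamma> e (tm e f) = \<gamma> f (tm f e)"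
  using tm_unique[OF cr_sym[OF assms]] tm[OF assms] by blast

lemma inj_\<gamma>: "e \<in> X \<Longrightarrow> s \<in> {0..1} \<Longrightarrow> s' \<in> {0..1} \<Longrightarrow> \<gamma> e s = \<gamma> e s' \<longleftrightarrow> s = s'"
  using arc_\<gamma>[of e] by (auto simp: arc_def inj_on_def)

definition pc :: "'e \<Rightarrow> 'e \<Rightarrow> 'e \<Rightarrow> complex set" where
  "pc e f g = \<gamma> e ` closed_segment (tm e f) (tm e g)"

lemma seg01: "cr e f \<Longrightarrow> cr e g \<Longrightarrow> closed_segment (tm e f) (tm e g) \<subseteq> {0<..<1}"
  using tm[of e f] tm[of e g] by (auto simp: closed_segment_eq_real_ivl)

lemma pc_subset: "cr e f \<Longrightarrow> cr e g \<Longrightarrow> pc e f g \<subseteq> path_image (\<gamma> e)"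
  unfolding pc_def path_image_def using seg01[of e f g] by (intro image_mono) force

lemma pc_commute: "pc e f g = pc e g f"
  by (simp add: pc_def closed_segment_commute)

lemma pc_imageD: "cr e f \<Longrightarrow> cr e g \<Longrightarrow> cr e k \<Longrightarrow> \<gamma> e (tm e k) \<in> pc e f g \<longleftrightarrow> tm e k \<in> closed_segment (tm e f) (tm e g)"
proof -
  assume A: "cr e f" "cr e g" "cr e k"
  have eX: "e \<in> X" using crD A by blast
  have k01: "tm e k \<in> {0..1}" using tm[OF A(3)] by auto
  have "tm e k = s" if "\<gamma> e (tm e k) = \<gamma> e s" "s \<in> closed_segment (tm e f) (tm e g)" for s
  proof -
    have "s \<in> {0..1}" using that(2) seg01[OF A(1,2)] by force
    then show ?thesis using inj_\<gamma>[OF eX k01] that(1) by auto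
  qed
  then show ?thesis unfolding pc_def by auto
qed

text \<open>The opposite sides are \<open>g\<close>, \<open>h\<close> and \<open>u\<close>,
  \<open>v\<close>. Only their pieces between the corners have to be disjoint; the full arcs may
  cross elsewhere.\<close>

definition quad :: "'e \<Rightarrow> 'e \<Rightarrow> 'e \<Rightarrow> 'e \<Rightarrow> bool" where
  "quad g h u v \<longleftrightarrow> cr g u \<and> cr g v \<and> cr h u \<and> cr h v \<and> pc g u v \<inter> pc h u v = {} \<and> pc u g h \<inter> pc v g h = {}"

text \<open>The piece of \<open>a\<close> from side \<open>g\<close> to side \<open>h\<close> avoids
  the other two sides, but it may run inside or outside the quadrilateral.\<close>

definition chord :: "'e \<Rightarrow> 'e \<Rightarrow> 'e \<Rightarrow> 'e \<Rightarrow> 'e \<Rightarrow> bool" where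
  "chord g h u v a \<longleftrightarrow> cr a g \<and> cr a h \<and> btw (tm g u) (tm g a) (tm g v) \<and> btw (tm h u) (tm h a) (tm h v) \<and>
     pc a g h \<inter> pc u g h = {} \<and> pc a g h \<inter> pc v g h = {}"

definition frame :: "'e \<Rightarrow> 'e \<Rightarrow> 'e \<Rightarrow> 'e \<Rightarrow> complex set" where
  "frame g h u v = pc g u v \<union> pc h u v \<union> pc u g h \<union> pc v g h"

definition open_pc :: "'e \<Rightarrow> 'e \<Rightarrow> 'e \<Rightarrow> complex set" where
  "open_pc a g h = \<gamma> a ` open_segment (tm a g) (tm a h)"

lemma quad_swap: "quad g h u v \<Longrightarrow> quad u v g h"
  unfolding quad_def using cr_sym by blast

lemma frame_swap: "frame u v g h = frame g h u v"
  unfolding frame_def by blast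

lemma chord_distinct: assumes "quad g h u v" "chord g h u v a" shows "tm a g \<noteq> tm a h" "\<gamma> a (tm a g) \<noteq> \<gamma> a (tm a h)"
proof -
  have cr: "cr a g" "cr a h" "cr g u" "cr g v" "cr h u" "cr h v" using assms by (auto simp: quad_def chord_def)
  have "\<gamma> g (tm g a) \<in> pc g u v" "\<gamma> h (tm h a) \<in> pc h u v"
    using assms(2) by (auto simp: chord_def pc_def btw_open_segment open_segment_def)
  then have "\<gamma> a (tm a g) \<in> pc g u v" "\<gamma> a (tm a h) \<in> pc h u v" using tm_sym cr by metis+
  then show "\<gamma> a (tm a g) \<noteq> \<gamma> a (tm a h)" using assms(1) by (auto simp: quad_def)
  then show "tm a g \<noteq> tm a h" by auto
qed

lemma open_pc_eq:
  assumes "quad g h u v" "chord g h u v a"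
  shows "open_pc a g h = pc a g h - {\<gamma> a (tm a g), \<gamma> a (tm a h)}"
proof -
  have cr: "cr a g" "cr a h" using assms(2) by (auto simp: chord_def)
  then have aX: "a \<in> X" using crD by blast
  have sub: "closed_segment (tm a g) (tm a h) \<subseteq> {0..1}" using seg01[OF cr] by force
  have "inj_on (\<gamma> a) {0..1}" using arc_\<gamma>[OF aX] by (simp add: arc_def)
  then have "inj_on (\<gamma> a) (closed_segment (tm a g) (tm a h))" using sub inj_on_subset by blast
  then have "\<gamma> a ` (closed_segment (tm a g) (tm a h) - {tm a g, tm a h}) =
     \<gamma> a ` closed_segment (tm a g) (tm a h) - \<gamma> a ` {tm a g, tm a h}"
    by (rule inj_on_image_set_diff) auto
  then show ?thesis by (simp add: open_pc_def pc_def open_segment_def)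
qed

text \<open>The arc \<open>a\<close> meets \<open>g\<close> and \<open>h\<close> once each, namely
  at the ends of the piece, and the definition of \<open>chord\<close> keeps the piece off the other
  two sides.\<close>

lemma open_pc_disjoint_frame:
  assumes q: "quad g h u v" and c: "chord g h u v a"
  shows "open_pc a g h \<inter> frame g h u v = {}"
proof -
  have cr: "cr a g" "cr a h" "cr g u" "cr g v" "cr h u" "cr h v"
    using q c by (auto simp: quad_def chord_def)
  have "pc a g h \<inter> pc g u v \<subseteq> {\<gamma> a (tm a g)}"
    using pc_subset[OF cr(1,2)] pc_subset[OF cr(3,4)] tm_unique[OF cr(1)] by blast
  moreover have "pc a g h \<inter> pc h u v \<subseteq> {\<gamma> a (tm a h)}"
    using pc_subset[OF cr(1,2)] pc_subset[OF cr(5,6)] tm_unique[OF cr(2)] by blast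
  ultimately show ?thesis unfolding open_pc_eq[OF q c] frame_def using c unfolding chord_def by blast
qed

lemma connected_open_pc: "cr a g \<Longrightarrow> cr a h \<Longrightarrow> connected (open_pc a g h)"
proof -
  assume cr: "cr a g" "cr a h"
  have "continuous_on {0..1} (\<gamma> a)" using arc_\<gamma> crD[OF cr(1)] by (auto simp: arc_def path_def)
  then have "continuous_on (open_segment (tm a g) (tm a h)) (\<gamma> a)"
    by (rule continuous_on_subset) (use seg01[OF cr] in \<open>force simp: open_segment_def\<close>)
  then show ?thesis unfolding open_pc_def by (intro connected_continuous_image convex_connected convex_open_segment)
qed

lemma open_pc_sides:
  assumes q: "quad g h u v" and c: "chord g h u v a"
  shows "open_pc a g h \<subseteq> inside (frame g h u v) \<or> open_pc a g h \<subseteq> outside (frame g h u v)"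
proof -
  have cr: "cr a g" "cr a h" "cr g u" "cr g v" "cr h u" "cr h v" "cr u g" "cr u h" "cr v g" "cr v h"
    using q c cr_sym by (auto simp: quad_def chord_def)
  have cl: "closed (pc e f k)" if "cr e f" "cr e k" for e f k
  proof -
    have "continuous_on {0..1} (\<gamma> e)" using arc_\<gamma> crD[OF that(1)] by (auto simp: arc_def path_def)
    then have "continuous_on (closed_segment (tm e f) (tm e k)) (\<gamma> e)"
      by (rule continuous_on_subset) (use seg01[OF that] in force)
    then show ?thesis unfolding pc_def by (intro compact_imp_closed compact_continuous_image) auto
  qed
  have "closed (frame g h u v)" unfolding frame_def using cl cr by (intro closed_Un) auto
  then have op: "open (inside (frame g h u v))" "open (outside (frame g h u v))"
    by (auto intro: open_inside open_outside)
  have "open_pc a g h \<subseteq> inside (frame g h u v) \<union> outside (frame g h u v)"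
    using open_pc_disjoint_frame[OF q c] inside_Un_outside by blast
  then show ?thesis
    using connectedD[OF connected_open_pc[OF cr(1,2)] op] inside_Int_outside by blast
qed

text \<open>The ends of a chord from \<open>g\<close> to \<open>h\<close> and of a chord from
  \<open>u\<close> to \<open>v\<close> alternate along the frame, so two such chords on the same
  side of it must meet.\<close>

lemma chords_cross:
  assumes q: "quad g h u v" and a: "chord g h u v a" and b: "chord u v g h b"
    and side: "S = inside (frame g h u v) \<or> S = outside (frame g h u v)"
    and aS: "open_pc a g h \<subseteq> S" and bS: "open_pc b u v \<subseteq> S"
  shows "cr a b"
proof -
  have q': "quad u v g h" using q by (rule quad_swap)
  have cr: "cr a g" "cr a h" "cr g u" "cr g v" "cr h u" "cr h v" "cr u g" "cr u h" "cr v g" "cr v h" "cr b u" "cr b v"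
     "cr g a" "cr h a" "cr u b" "cr v b"
    using q a b cr_sym by (auto simp: quad_def chord_def)
  have X: "a \<in> X" "b \<in> X" "g \<in> X" "h \<in> X" "u \<in> X" "v \<in> X" using cr crD by blast+
  have t01: "tm e f \<in> {0..1}" if "cr e f" for e f using tm[OF that] by auto
  have bt: "btw (tm g u) (tm g a) (tm g v)" "btw (tm h u) (tm h a) (tm h v)"
      "btw (tm u g) (tm u b) (tm u h)" "btw (tm v g) (tm v b) (tm v h)"
    using a b by (auto simp: chord_def)
  have dis: "pc g u v \<inter> pc h u v = {}" "pc u g h \<inter> pc v g h = {}"
    using q by (auto simp: quad_def)
  define s where "s e x y = subpath (tm e x) (tm e y) (\<gamma> e)" for e x y
  have s_im: "path_image (s e x y) = pc e x y" for e x y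
    by (simp add: s_def pc_def path_image_subpath_gen)
  have s_arc: "arc (s e x y)" if "e \<in> X" "cr e x" "cr e y" "tm e x \<noteq> tm e y" for e x y
    unfolding s_def using that t01 by (intro arc_subpath_arc arc_\<gamma>) auto
  have s_ends: "pathstart (s e x y) = \<gamma> e (tm e x)" "pathfinish (s e x y) = \<gamma> e (tm e y)" for e x y
    by (auto simp: s_def)
  have ne: "tm g a \<noteq> tm g u" "tm g a \<noteq> tm g v" "tm h u \<noteq> tm h a" "tm h v \<noteq> tm h a" "tm u g \<noteq> tm u h" "tm v g \<noteq> tm v h"
    using bt by (auto simp: btw_def)
  have sub: "pc g a u \<subseteq> pc g u v" "pc g a v \<subseteq> pc g u v" "pc h u a \<subseteq> pc h u v" "pc h v a \<subseteq> pc h u v"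
    using bt unfolding pc_def by (auto intro!: image_mono simp: btw_def closed_segment_eq_real_ivl split: if_splits)
  have un: "pc g a u \<union> pc g a v = pc g u v" "pc h u a \<union> pc h v a = pc h u v"
    using bt unfolding pc_def image_Un[symmetric]
    by (auto intro!: arg_cong[where f = "image _"] simp: btw_def closed_segment_eq_real_ivl split: if_splits)
  have one: "pc e x y \<inter> pc f x' y' \<subseteq> {\<gamma> e (tm e f)}" if "cr e x" "cr e y" "cr f x'" "cr f y'" "cr e f" for e f x y x' y'
    using pc_subset[OF that(1,2)] pc_subset[OF that(3,4)] tm_unique[OF that(5)] by blast
  have none: "pc e x y \<inter> pc f x' y' = {}"
    if "cr e x" "cr e y" "cr f x'" "cr f y'" "cr e f" "tm e f \<notin> closed_segment (tm e x) (tm e y)" for e f x y x' y'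
  proof -
    have "\<gamma> e (tm e f) \<notin> pc e x y" using pc_imageD[OF that(1,2,5)] that(6) by simp
    then show ?thesis using one[OF that(1-5)] by blast
  qed
  have nb: "tm g v \<notin> closed_segment (tm g a) (tm g u)" "tm g u \<notin> closed_segment (tm g a) (tm g v)"
      "tm h v \<notin> closed_segment (tm h u) (tm h a)" "tm h u \<notin> closed_segment (tm h v) (tm h a)"
    using bt(1,2) by (auto simp: btw_def closed_segment_eq_real_ivl split: if_splits)
  have "open_pc b u v \<inter> path_image (s a g h) \<noteq> {}"
  \<comment> \<open>The frame is cut where \<open>a\<close> meets \<open>g\<close> and
    \<open>h\<close>; the two halves run through \<open>u\<close> and \<open>v\<close>, which the
    piece of \<open>b\<close> connects.\<close>
  proof (rule quadrilateral_chords_meet[of "s g a u" "\<gamma> g (tm g a)" "\<gamma> g (tm g u)" "s g a v" "\<gamma> g (tm g v)"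
        "s u g h" "\<gamma> h (tm h u)" "s v g h" "\<gamma> h (tm h v)" "s h u a" "\<gamma> h (tm h a)" "s h v a" "s a g h" "frame g h u v" S
        "open_pc b u v" "\<gamma> u (tm u b)" "\<gamma> v (tm v b)"])
    show "arc (s g a u)" "arc (s g a v)" "arc (s u g h)" "arc (s v g h)" "arc (s h u a)" "arc (s h v a)" "arc (s a g h)"
      using cr X ne chord_distinct(1)[OF q a] by (intro s_arc; simp)+
    show "pathstart (s g a u) = \<gamma> g (tm g a)" "pathfinish (s g a u) = \<gamma> g (tm g u)"
      "pathstart (s g a v) = \<gamma> g (tm g a)" "pathfinish (s g a v) = \<gamma> g (tm g v)"
      "pathstart (s h u a) = \<gamma> h (tm h u)" "pathfinish (s h u a) = \<gamma> h (tm h a)"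
      "pathstart (s h v a) = \<gamma> h (tm h v)" "pathfinish (s h v a) = \<gamma> h (tm h a)"
      unfolding s_ends by (rule refl)+
    show "pathstart (s u g h) = \<gamma> g (tm g u)" "pathfinish (s u g h) = \<gamma> h (tm h u)"
      "pathstart (s v g h) = \<gamma> g (tm g v)" "pathfinish (s v g h) = \<gamma> h (tm h v)"
      "pathstart (s a g h) = \<gamma> g (tm g a)" "pathfinish (s a g h) = \<gamma> h (tm h a)"
      unfolding s_ends by (rule tm_sym, rule cr)+
    have inj2: "pc e x y \<inter> pc e x z \<subseteq> {\<gamma> e (tm e x)}" if "cr e x" "cr e y" "cr e z" "btw (tm e y) (tm e x) (tm e z)" for e x y z
    proof
      fix w assume "w \<in> pc e x y \<inter> pc e x z"
      then obtain s1 s2 where s12: "s1 \<in> closed_segment (tm e x) (tm e y)" "w = \<gamma> e s1" "s2 \<in> closed_segment (tm e x) (tm e z)" "w = \<gamma> e s2"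
        unfolding pc_def by blast
      have "s1 \<in> {0..1}" "s2 \<in> {0..1}" using seg01[OF that(1,2)] seg01[OF that(1,3)] s12 by force+
      then have "s1 = s2" using inj_\<gamma> s12 crD[OF that(1)] by metis
      then have "s1 = tm e x" using s12 that(4) by (auto simp: btw_def closed_segment_eq_real_ivl split: if_splits)
      then show "w \<in> {\<gamma> e (tm e x)}" using s12 by simp
    qed
    show "path_image (s g a u) \<inter> path_image (s g a v) \<subseteq> {\<gamma> g (tm g a)}"
      unfolding s_im by (rule inj2) (use cr bt in auto)
    show "path_image (s h u a) \<inter> path_image (s h v a) \<subseteq> {\<gamma> h (tm h a)}"
      unfolding s_im pc_commute[of h u a] pc_commute[of h v a] by (rule inj2) (use cr bt in auto)
    show "(path_image (s g a u) \<union> path_image (s g a v)) \<inter> (path_image (s h u a) \<union> path_image (s h v a)) = {}"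
      unfolding s_im un by (rule dis)
    show "path_image (s u g h) \<inter> path_image (s v g h) = {}" unfolding s_im by (rule dis)
    show "path_image (s g a u) \<inter> path_image (s u g h) \<subseteq> {\<gamma> g (tm g u)}"
      "path_image (s g a v) \<inter> path_image (s v g h) \<subseteq> {\<gamma> g (tm g v)}"
      unfolding s_im by (rule one, (rule cr)+)+
    show "path_image (s g a u) \<inter> path_image (s v g h) = {}" "path_image (s g a v) \<inter> path_image (s u g h) = {}"
      unfolding s_im by (rule none, (rule cr)+, rule nb)+
    show "path_image (s u g h) \<inter> path_image (s h u a) \<subseteq> {\<gamma> h (tm h u)}"
      "path_image (s v g h) \<inter> path_image (s h v a) \<subseteq> {\<gamma> h (tm h v)}"
      unfolding s_im Int_commute[of "pc u g h"] Int_commute[of "pc v g h"] by (rule one, (rule cr)+)+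
    show "path_image (s h u a) \<inter> path_image (s v g h) = {}" "path_image (s h v a) \<inter> path_image (s u g h) = {}"
      unfolding s_im by (rule none, (rule cr)+, rule nb)+
    show "frame g h u v = path_image (s g a u) \<union> path_image (s g a v) \<union> path_image (s u g h) \<union> path_image (s v g h)
        \<union> path_image (s h u a) \<union> path_image (s h v a)"
      unfolding s_im frame_def un[symmetric] by blast
    show "S = inside (frame g h u v) \<or> S = outside (frame g h u v)" by (rule side)
    show "path_image (s a g h) - {\<gamma> g (tm g a), \<gamma> h (tm h a)} \<subseteq> S"
      using aS unfolding s_im open_pc_eq[OF q a] tm_sym[OF cr(1)] tm_sym[OF cr(2)] .
    show "connected (open_pc b u v)" "open_pc b u v \<subseteq> S" using connected_open_pc cr bS by auto
    have clo: "\<gamma> b z \<in> closure (open_pc b u v)" if "z \<in> {tm b u, tm b v}" for z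
    proof -
      have c1: "continuous_on {0..1} (\<gamma> b)" using arc_\<gamma>[OF X(2)] by (auto simp: arc_def path_def)
      have cs: "closure (open_segment (tm b u) (tm b v)) = closed_segment (tm b u) (tm b v)"
        using chord_distinct(1)[OF q' b] by (simp add: closure_open_segment)
      have c2: "continuous_on (closure (open_segment (tm b u) (tm b v))) (\<gamma> b)" unfolding cs
        by (rule continuous_on_subset[OF c1]) (use seg01[OF cr(11,12)] in force)
      have "\<gamma> b ` closure (open_segment (tm b u) (tm b v)) \<subseteq> closure (open_pc b u v)"
        unfolding open_pc_def by (rule image_closure_subset[OF c2 closed_closure closure_subset])
      then show ?thesis unfolding cs using that by auto
    qed
    show "\<gamma> u (tm u b) \<in> closure (open_pc b u v)" "\<gamma> v (tm v b) \<in> closure (open_pc b u v)"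
      using clo tm_sym cr by (metis insertI1 insertI2)+
    show "\<gamma> u (tm u b) \<in> path_image (s u g h)" "\<gamma> v (tm v b) \<in> path_image (s v g h)"
      unfolding s_im pc_def using bt by (auto simp: btw_open_segment open_segment_def)
  qed
  then obtain z where "z \<in> open_pc b u v" "z \<in> pc a g h" unfolding s_im by blast
  then obtain x y where xy: "x \<in> open_segment (tm b u) (tm b v)" "y \<in> closed_segment (tm a g) (tm a h)" "\<gamma> b x = \<gamma> a y"
    unfolding open_pc_def pc_def by blast
  have x01: "x \<in> {0<..<1}" "y \<in> {0<..<1}" using xy seg01[OF cr(11,12)] seg01[OF cr(1,2)] by (auto simp: open_segment_def)
  \<comment> \<open>If \<open>a = b\<close>, two parameter intervals on one arc would have a common
    point although neither contains an end of the other.\<close>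
  have "a \<noteq> b"
  proof
    assume ab: "a = b"
    have xyeq: "x = y" using xy(3) x01 inj_\<gamma>[OF X(1), of x y] unfolding ab by auto
    have c: "cr a u" "cr a v" using cr ab by auto
    have "\<gamma> u (tm u b) \<in> pc u g h" "\<gamma> v (tm v b) \<in> pc v g h" "\<gamma> g (tm g a) \<in> pc g u v" "\<gamma> h (tm h a) \<in> pc h u v"
      using bt by (auto simp: pc_def btw_open_segment open_segment_def)
    then have m: "\<gamma> a (tm a u) \<in> pc u g h" "\<gamma> a (tm a v) \<in> pc v g h" "\<gamma> a (tm a g) \<in> pc g u v" "\<gamma> a (tm a h) \<in> pc h u v"
      using tm_sym c cr ab by metis+
    have "\<gamma> a (tm a u) \<notin> pc a g h" "\<gamma> a (tm a v) \<notin> pc a g h" using m a by (auto simp: chord_def)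
    then have "tm a u \<notin> closed_segment (tm a g) (tm a h)" "tm a v \<notin> closed_segment (tm a g) (tm a h)"
      using pc_imageD c cr by auto
    moreover have "\<gamma> a (tm a g) \<notin> pc a u v" "\<gamma> a (tm a h) \<notin> pc a u v" using m b unfolding ab by (auto simp: chord_def)
    then have "tm a g \<notin> closed_segment (tm a u) (tm a v)" "tm a h \<notin> closed_segment (tm a u) (tm a v)"
      using pc_imageD c cr by auto
    ultimately show False using xy(1,2) unfolding xyeq ab[symmetric]
      by (auto simp: open_segment_def closed_segment_eq_real_ivl split: if_splits)
  qed
  then show ?thesis unfolding cr_def using X x01 xy(3) by metis
qed

text \<open>The crossing of \<open>a\<close> and \<open>b\<close> lies on both pieces and so puts
  them on the same side of the frame. The pairs are therefore covered by two products, one for each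
  side, which are bicliques by \<open>chords_cross\<close>; the larger product accounts for at least
  half of the pairs.\<close>

lemma biclique_of_quad:
  assumes q: "quad g h u v"
    and P: "\<And>a b. (a, b) \<in> P \<Longrightarrow> chord g h u v a \<and> chord u v g h b \<and> cr a b \<and>
       btw (tm a g) (tm a b) (tm a h) \<and> btw (tm b u) (tm b a) (tm b v)"
  obtains A B where "A \<subseteq> X" "B \<subseteq> X" "\<And>a b. a \<in> A \<Longrightarrow> b \<in> B \<Longrightarrow> cr a b" "card P \<le> 2 * (card A * card B)"
proof -
  define AA where "AA S = {a \<in> X. chord g h u v a \<and> open_pc a g h \<subseteq> S}" for S
  define BB where "BB S = {b \<in> X. chord u v g h b \<and> open_pc b u v \<subseteq> S}" for S
  let ?I = "inside (frame g h u v)" and ?O = "outside (frame g h u v)"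
  have q': "quad u v g h" using q by (rule quad_swap)
  have sub: "P \<subseteq> AA ?I \<times> BB ?I \<union> AA ?O \<times> BB ?O"
  proof clarify
    fix a b assume ab: "(a, b) \<in> P" and nO: "\<not> (a \<in> AA ?O \<and> b \<in> BB ?O)"
    have p: "chord g h u v a" "chord u v g h b" "cr a b" "btw (tm a g) (tm a b) (tm a h)" "btw (tm b u) (tm b a) (tm b v)"
      using P[OF ab] by auto
    have X: "a \<in> X" "b \<in> X" using crD[OF p(3)] by auto
    have "\<gamma> a (tm a b) \<in> open_pc a g h" "\<gamma> b (tm b a) \<in> open_pc b u v"
      using p(4,5) by (auto simp: open_pc_def btw_open_segment)
    then have z: "\<gamma> a (tm a b) \<in> open_pc a g h" "\<gamma> a (tm a b) \<in> open_pc b u v" using tm_sym[OF p(3)] by auto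
    have sa: "open_pc a g h \<subseteq> ?I \<or> open_pc a g h \<subseteq> ?O" by (rule open_pc_sides[OF q p(1)])
    have sb: "open_pc b u v \<subseteq> ?I \<or> open_pc b u v \<subseteq> ?O"
      using open_pc_sides[OF q' p(2)] unfolding frame_swap[of u v g h] .
    have "?I \<inter> ?O = {}" by (rule inside_Int_outside)
    then have "open_pc a g h \<subseteq> ?I \<and> open_pc b u v \<subseteq> ?I \<or> open_pc a g h \<subseteq> ?O \<and> open_pc b u v \<subseteq> ?O"
      using z sa sb by blast
    then show "a \<in> AA ?I \<and> b \<in> BB ?I" using nO p X by (auto simp: AA_def BB_def)
  qed
  have fin: "finite (AA S)" "finite (BB S)" for S using finite_X by (auto simp: AA_def BB_def)
  have "card P \<le> card (AA ?I \<times> BB ?I \<union> AA ?O \<times> BB ?O)" using sub fin by (intro card_mono) auto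
  also have "\<dots> \<le> card (AA ?I \<times> BB ?I) + card (AA ?O \<times> BB ?O)" by (rule card_Un_le)
  finally have le: "card P \<le> card (AA ?I) * card (BB ?I) + card (AA ?O) * card (BB ?O)" by (simp add: card_cartesian_product)
  have crI: "cr a b" if "S = ?I \<or> S = ?O" "a \<in> AA S" "b \<in> BB S" for S a b
    using chords_cross[OF q, of a b S] that by (auto simp: AA_def BB_def)
  have s: "AA S \<subseteq> X" "BB S \<subseteq> X" for S by (auto simp: AA_def BB_def)
  show thesis
  proof (cases "card (AA ?I) * card (BB ?I) \<le> card (AA ?O) * card (BB ?O)")
    case True
    then show thesis using that[OF s, of ?O ?O] crI[of ?O] le by auto
  next
    case False
    then show thesis using that[OF s, of ?I ?I] crI[of ?I] le by auto
  qed
qed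

end

section \<open>Expansion, lazy random walks and odd pairs\<close>

text \<open>\<open>D\<close> contains every edge in both directions. Hence \<open>cut\<close> counts
  an edge leaving a set once, \<open>energy\<close> counts every edge twice, and
  \<open>vol V\<close> is \<open>card D\<close>.\<close>

locale weighted_graph =
  fixes V :: "'v set" and D :: "('v \<times> 'v) set"
  assumes finite_V: "finite V" and D_sub: "D \<subseteq> V \<times> V" and D_sym: "(x, y) \<in> D \<Longrightarrow> (y, x) \<in> D"
begin

definition nb :: "'v \<Rightarrow> 'v set" where "nb x = {y. (x, y) \<in> D}"
definition dg :: "'v \<Rightarrow> real" where "dg x = real (card (nb x))"
definition vol :: "'v set \<Rightarrow> real" where "vol S = sum dg S"
definition cut :: "'v set \<Rightarrow> real" where "cut S = real (card {(x, y) \<in> D. x \<in> S \<and> y \<notin> S})"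
definition energy :: "('v \<Rightarrow> real) \<Rightarrow> real" where "energy f = (\<Sum>(x, y)\<in>D. (f x - f y)\<^sup>2)"
definition nrm :: "('v \<Rightarrow> real) \<Rightarrow> real" where "nrm f = (\<Sum>x\<in>V. dg x * (f x)\<^sup>2)"

lemma finite_D: "finite D"
  using finite_V D_sub by (meson finite_SigmaI finite_subset)

lemma nb_sub: "nb x \<subseteq> V" using D_sub by (auto simp: nb_def)

lemma finite_nb: "finite (nb x)" using nb_sub finite_V finite_subset by blast

lemma D_Sigma: "D = Sigma V nb"
  using D_sub by (auto simp: nb_def)

lemma sum_D: "(\<Sum>(x, y)\<in>D. F x y) = (\<Sum>x\<in>V. \<Sum>y\<in>nb x. F x y)" for F :: "'v \<Rightarrow> 'v \<Rightarrow> real"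
proof -
  have "(\<Sum>(x, y)\<in>D. F x y) = (\<Sum>(x, y)\<in>Sigma V nb. F x y)" by (rule arg_cong[OF D_Sigma])
  also have "\<dots> = (\<Sum>x\<in>V. \<Sum>y\<in>nb x. F x y)" by (rule sum.Sigma[symmetric]) (auto simp: finite_V finite_nb)
  finally show ?thesis .
qed

lemma sum_D_fst: "(\<Sum>(x, y)\<in>D. F x) = (\<Sum>x\<in>V. dg x * F x)" for F :: "'v \<Rightarrow> real"
  unfolding sum_D by (simp add: dg_def)

lemma sum_D_swap: "(\<Sum>(x, y)\<in>D. F x y) = (\<Sum>(x, y)\<in>D. F y x)" for F :: "'v \<Rightarrow> 'v \<Rightarrow> real"
  by (rule sum.reindex_bij_witness[of _ prod.swap prod.swap]) (auto simp: D_sym)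

lemma sum_D_snd: "(\<Sum>(x, y)\<in>D. F y) = (\<Sum>x\<in>V. dg x * F x)" for F :: "'v \<Rightarrow> real"
  using sum_D_fst[of F] sum_D_swap[of "\<lambda>x y. F x"] by simp

lemma dg_nonneg: "dg x \<ge> 0" by (simp add: dg_def)

lemma vol_mono: "S \<subseteq> T \<Longrightarrow> T \<subseteq> V \<Longrightarrow> vol S \<le> vol T"
  unfolding vol_def using finite_V finite_subset by (intro sum_mono2) (auto simp: dg_nonneg)

text \<open>Induction over the levels of \<open>F\<close>. Lowering \<open>F\<close> by its least
  positive value \<open>\<mu>\<close> on its support \<open>S\<close> changes the two sides by
  \<open>2 * \<phi> * \<mu> * vol S\<close> and \<open>2 * \<mu> * cut S\<close>, the latter because
  an edge leaving \<open>S\<close> occurs in both directions. The support shrinks, so the condition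
  on its volume persists.\<close>

lemma coarea:
  assumes cond: "\<And>S. S \<subseteq> V \<Longrightarrow> vol S \<le> vol V / 2 \<Longrightarrow> \<phi> * vol S \<le> cut S"
    and F: "\<And>x. x \<in> V \<Longrightarrow> F x \<ge> 0" and supp: "vol {x \<in> V. F x > 0} \<le> vol V / 2"
  shows "2 * \<phi> * (\<Sum>x\<in>V. dg x * F x) \<le> (\<Sum>(x, y)\<in>D. \<bar>F x - F y\<bar>)"
  using F supp
proof (induction "card {x \<in> V. F x > 0}" arbitrary: F rule: less_induct)
  case less
  define S where "S = {x \<in> V. F x > 0}"
  have fS: "finite S" "S \<subseteq> V" using finite_V by (auto simp: S_def)
  have F0: "F x = 0" if "x \<in> V" "x \<notin> S" for x using that less.prems(1)[of x] by (auto simp: S_def)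
  show ?case
  proof (cases "S = {}")
    case True
    then have "(\<Sum>x\<in>V. dg x * F x) = 0" using F0 by (intro sum.neutral) auto
    then show ?thesis by (auto intro!: sum_nonneg)
  next
    case False
    define \<mu> where "\<mu> = Min (F ` S)"
    have \<mu>: "\<mu> \<in> F ` S" "\<And>x. x \<in> S \<Longrightarrow> \<mu> \<le> F x" using False fS by (auto simp: \<mu>_def)
    have \<mu>0: "\<mu> > 0" using \<mu>(1) by (auto simp: S_def)
    define G where "G x = F x - \<mu> * of_bool (x \<in> S)" for x
    have G0: "G x \<ge> 0" if "x \<in> V" for x using \<mu>(2)[of x] F0[OF that] by (cases "x \<in> S") (auto simp: G_def)
    have sub: "{x \<in> V. G x > 0} \<subseteq> S" by (auto simp: G_def S_def)
    obtain x0 where x0: "x0 \<in> S" "F x0 = \<mu>" using \<mu>(1) by auto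
    then have "x0 \<notin> {x \<in> V. G x > 0}" by (simp add: G_def)
    then have "{x \<in> V. G x > 0} \<subset> S" using sub x0 by auto
    then have card: "card {x \<in> V. G x > 0} < card {x \<in> V. F x > 0}" using fS psubset_card_mono unfolding S_def by blast
    have "vol {x \<in> V. G x > 0} \<le> vol V / 2"
      using vol_mono[OF sub fS(2)] less.prems(2) unfolding S_def by linarith
    then have IH: "2 * \<phi> * (\<Sum>x\<in>V. dg x * G x) \<le> (\<Sum>(x, y)\<in>D. \<bar>G x - G y\<bar>)"
      using less.hyps[OF card] G0 by blast
    have e1: "(\<Sum>x\<in>V. dg x * F x) = (\<Sum>x\<in>V. dg x * G x) + \<mu> * vol S"
    proof -
      have "(\<Sum>x\<in>V. dg x * F x) = (\<Sum>x\<in>V. dg x * G x + \<mu> * (dg x * of_bool (x \<in> S)))"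
        by (rule sum.cong) (auto simp: G_def algebra_simps)
      also have "\<dots> = (\<Sum>x\<in>V. dg x * G x) + \<mu> * (\<Sum>x\<in>V. dg x * of_bool (x \<in> S))"
        by (simp add: sum.distrib sum_distrib_left)
      also have "(\<Sum>x\<in>V. dg x * of_bool (x \<in> S)) = vol S"
        unfolding vol_def using finite_V fS by (simp add: Int_absorb1)
      finally show ?thesis .
    qed
    have e2: "(\<Sum>(x, y)\<in>D. \<bar>F x - F y\<bar>) = (\<Sum>(x, y)\<in>D. \<bar>G x - G y\<bar>) + \<mu> * (2 * cut S)"
    proof -
      have "(\<Sum>(x, y)\<in>D. \<bar>F x - F y\<bar>) = (\<Sum>(x, y)\<in>D. \<bar>G x - G y\<bar> + \<mu> * (of_bool (x \<in> S \<and> y \<notin> S) + of_bool (y \<in> S \<and> x \<notin> S)))"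
      proof (rule sum.cong[OF refl], clarify)
        fix x y assume "(x, y) \<in> D"
        then have "x \<in> V" "y \<in> V" using D_sub by auto
        then show "\<bar>F x - F y\<bar> = \<bar>G x - G y\<bar> + \<mu> * (of_bool (x \<in> S \<and> y \<notin> S) + of_bool (y \<in> S \<and> x \<notin> S))"
          using F0[of x] F0[of y] \<mu>(2)[of x] \<mu>(2)[of y] \<mu>0 by (cases "x \<in> S"; cases "y \<in> S") (auto simp: G_def)
      qed
      also have "\<dots> = (\<Sum>(x, y)\<in>D. \<bar>G x - G y\<bar>) + \<mu> * ((\<Sum>(x, y)\<in>D. of_bool (x \<in> S \<and> y \<notin> S)) + (\<Sum>(x, y)\<in>D. of_bool (y \<in> S \<and> x \<notin> S)))"
        by (simp add: sum.distrib sum_distrib_left case_prod_beta distrib_left)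
      also have "(\<Sum>(x, y)\<in>D. of_bool (y \<in> S \<and> x \<notin> S) :: real) = (\<Sum>(x, y)\<in>D. of_bool (x \<in> S \<and> y \<notin> S))"
        by (rule sum_D_swap)
      also have "(\<Sum>(x, y)\<in>D. of_bool (x \<in> S \<and> y \<notin> S) :: real) = cut S"
      proof -
        have "(\<Sum>(x, y)\<in>D. of_bool (x \<in> S \<and> y \<notin> S) :: real) = (\<Sum>p\<in>D. of_bool (fst p \<in> S \<and> snd p \<notin> S))"
          by (rule sum.cong) auto
        also have "\<dots> = real (card (D \<inter> {p. fst p \<in> S \<and> snd p \<notin> S}))" by (rule sum_of_bool_eq) (auto simp: finite_D)
        also have "D \<inter> {p. fst p \<in> S \<and> snd p \<notin> S} = {(x, y) \<in> D. x \<in> S \<and> y \<notin> S}" by auto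
        finally show ?thesis unfolding cut_def .
      qed
      finally show ?thesis by simp
    qed
    have "\<phi> * vol S \<le> cut S" using cond[OF fS(2)] less.prems(2) by (simp add: S_def)
    then have "\<mu> * (\<phi> * vol S) \<le> \<mu> * cut S" using \<mu>0 by simp
    then show ?thesis unfolding e1 e2 using IH by (simp add: algebra_simps)
  qed
qed

text \<open>Cheeger's argument: the coarea bound for the square of \<open>g\<close>, then
  Cauchy-Schwarz after factoring a difference of squares.\<close>

lemma cheeger_nonneg:
  assumes cond: "\<And>S. S \<subseteq> V \<Longrightarrow> vol S \<le> vol V / 2 \<Longrightarrow> \<phi> * vol S \<le> cut S" and \<phi>: "\<phi> \<ge> 0"
    and g: "\<And>x. x \<in> V \<Longrightarrow> g x \<ge> 0" and supp: "vol {x \<in> V. g x > 0} \<le> vol V / 2"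
  shows "\<phi>\<^sup>2 * nrm g \<le> energy g"
proof -
  have "{x \<in> V. (g x)\<^sup>2 > 0} = {x \<in> V. g x > 0}" using g by (auto simp: less_le)
  then have 1: "2 * \<phi> * nrm g \<le> (\<Sum>(x, y)\<in>D. \<bar>(g x)\<^sup>2 - (g y)\<^sup>2\<bar>)"
    unfolding nrm_def using coarea[OF cond, of "\<lambda>x. (g x)\<^sup>2"] supp by simp
  have nn: "nrm g \<ge> 0" unfolding nrm_def by (intro sum_nonneg mult_nonneg_nonneg dg_nonneg) auto
  have "(\<Sum>(x, y)\<in>D. \<bar>(g x)\<^sup>2 - (g y)\<^sup>2\<bar>) = (\<Sum>p\<in>D. \<bar>g (fst p) - g (snd p)\<bar> * (g (fst p) + g (snd p)))"
  proof (rule sum.cong[OF refl], clarify)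
    fix x y assume "(x, y) \<in> D"
    then have "g x \<ge> 0" "g y \<ge> 0" using g D_sub by auto
    then have "g x + g y \<ge> 0" by simp
    moreover have "(g x)\<^sup>2 - (g y)\<^sup>2 = (g x - g y) * (g x + g y)" by (simp add: algebra_simps power2_eq_square)
    ultimately show "\<bar>(g x)\<^sup>2 - (g y)\<^sup>2\<bar> = \<bar>g (fst (x, y)) - g (snd (x, y))\<bar> * (g (fst (x, y)) + g (snd (x, y)))"
      by (simp add: abs_mult)
  qed
  also have "(\<dots>)\<^sup>2 \<le> (\<Sum>p\<in>D. \<bar>g (fst p) - g (snd p)\<bar>\<^sup>2) * (\<Sum>p\<in>D. (g (fst p) + g (snd p))\<^sup>2)"
    by (rule Cauchy_Schwarz_ineq_sum)
  also have "(\<Sum>p\<in>D. \<bar>g (fst p) - g (snd p)\<bar>\<^sup>2) = energy g" by (simp add: energy_def case_prod_beta)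
  also have "(\<Sum>p\<in>D. (g (fst p) + g (snd p))\<^sup>2) \<le> (\<Sum>(x, y)\<in>D. 2 * (g x)\<^sup>2 + 2 * (g y)\<^sup>2)"
  proof (rule sum_mono, clarify)
    fix x y
    have "0 \<le> (g x - g y)\<^sup>2" by simp
    then show "(g (fst (x, y)) + g (snd (x, y)))\<^sup>2 \<le> 2 * (g x)\<^sup>2 + 2 * (g y)\<^sup>2"
      by (simp add: power2_eq_square algebra_simps)
  qed
  also have "\<dots> = 4 * nrm g"
    using sum_D_fst[of "\<lambda>x. (g x)\<^sup>2"] sum_D_snd[of "\<lambda>x. (g x)\<^sup>2"]
    by (simp add: sum.distrib case_prod_beta sum_distrib_left[symmetric] nrm_def)
  finally have 2: "(\<Sum>(x, y)\<in>D. \<bar>(g x)\<^sup>2 - (g y)\<^sup>2\<bar>)\<^sup>2 \<le> energy g * (4 * nrm g)"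
    by (simp add: energy_def sum_nonneg case_prod_beta mult_left_mono)
  have "(2 * \<phi> * nrm g)\<^sup>2 \<le> (\<Sum>(x, y)\<in>D. \<bar>(g x)\<^sup>2 - (g y)\<^sup>2\<bar>)\<^sup>2"
    using 1 nn \<phi> by (intro power_mono) auto
  then have 3: "(\<phi>\<^sup>2 * nrm g) * nrm g \<le> energy g * nrm g" using 2 by (simp add: power2_eq_square algebra_simps)
  show ?thesis
  proof (cases "nrm g = 0")
    case True then show ?thesis by (simp add: energy_def sum_nonneg case_prod_beta)
  next
    case False then show ?thesis using 3 nn by simp
  qed
qed

text \<open>The median is the least value of \<open>f\<close> with at most half the volume above it;
  with more than half below it, the next lower value would qualify too.\<close>

lemma median_exists:
  fixes f :: "'v \<Rightarrow> real"
  assumes "V \<noteq> {}"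
  obtains c where "vol {x \<in> V. f x > c} \<le> vol V / 2" "vol {x \<in> V. f x < c} \<le> vol V / 2"
proof -
  define C where "C = {c \<in> f ` V. vol {x \<in> V. f x > c} \<le> vol V / 2}"
  have V0: "vol V \<ge> 0" by (simp add: vol_def sum_nonneg dg_nonneg)
  have "Max (f ` V) \<in> C"
  proof -
    have "{x \<in> V. f x > Max (f ` V)} = {}" using finite_V by (auto simp: not_less)
    then have "vol {x \<in> V. f x > Max (f ` V)} = 0" by (simp only: vol_def sum.empty)
    moreover have "Max (f ` V) \<in> f ` V" using assms finite_V by (intro Max_in) auto
    ultimately show ?thesis unfolding C_def using V0 by simp
  qed
  then have C: "finite C" "C \<noteq> {}" using finite_V by (auto simp: C_def)
  define c where "c = Min C"
  have c: "c \<in> C" using C by (simp add: c_def)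
  have "vol {x \<in> V. f x < c} \<le> vol V / 2"
  proof (rule ccontr)
    assume big: "\<not> ?thesis"
    let ?L = "{x \<in> V. f x < c}"
    have ne: "?L \<noteq> {}"
    proof
      assume "?L = {}"
      then have "vol ?L = 0" by (simp only: vol_def sum.empty)
      then show False using big V0 by linarith
    qed
    define c' where "c' = Max (f ` ?L)"
    have c'in: "c' \<in> f ` ?L" unfolding c'_def using ne finite_V by (intro Max_in) auto
    have c'max: "f x \<le> c'" if "x \<in> ?L" for x unfolding c'_def using finite_V that by (intro Max_ge) auto
    have "{x \<in> V. f x > c'} \<subseteq> V - ?L" using c'max by force
    then have "vol {x \<in> V. f x > c'} \<le> vol (V - ?L)" by (intro vol_mono) auto
    also have "\<dots> = vol V - vol ?L" unfolding vol_def using finite_V by (intro sum_diff) auto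
    finally have "vol {x \<in> V. f x > c'} \<le> vol V / 2" using big by linarith
    then have "c' \<in> C" using c'in by (auto simp: C_def)
    then have "c \<le> c'" unfolding c_def using C by simp
    then show False using c'in by auto
  qed
  then show ?thesis using that c by (auto simp: C_def)
qed

text \<open>Expansion is assumed only up to half the volume, so \<open>f\<close> is shifted by a
  median and split into positive and negative part. As \<open>f\<close> has mean 0, the shift does
  not lower the norm.\<close>

lemma poincare:
  assumes cond: "\<And>S. S \<subseteq> V \<Longrightarrow> vol S \<le> vol V / 2 \<Longrightarrow> \<phi> * vol S \<le> cut S" and \<phi>: "\<phi> \<ge> 0"
    and mean: "(\<Sum>x\<in>V. dg x * f x) = 0"
  shows "\<phi>\<^sup>2 * nrm f \<le> energy f"
proof (cases "V = {}")
  case True then show ?thesis unfolding nrm_def energy_def using D_sub by simp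
next
  case False
  then obtain c where c: "vol {x \<in> V. f x > c} \<le> vol V / 2" "vol {x \<in> V. f x < c} \<le> vol V / 2"
    using median_exists by blast
  define p where "p x = max (f x - c) 0" for x
  define q where "q x = max (c - f x) 0" for x
  have "{x \<in> V. p x > 0} = {x \<in> V. f x > c}" "{x \<in> V. q x > 0} = {x \<in> V. f x < c}" by (auto simp: p_def q_def)
  then have pq: "\<phi>\<^sup>2 * nrm p \<le> energy p" "\<phi>\<^sup>2 * nrm q \<le> energy q"
    using cheeger_nonneg[OF cond \<phi>, of p] cheeger_nonneg[OF cond \<phi>, of q] c by (auto simp: p_def q_def)
  have "energy p + energy q \<le> energy f"
    unfolding energy_def sum.distrib[symmetric]
  proof (rule sum_mono, clarify)
    fix x y
    have eq: "f x - f y = (p x - p y) - (q x - q y)" by (auto simp: p_def q_def max_def)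
    \<comment> \<open>As functions of the value of \<open>f\<close>, the positive part increases and
      the negative part decreases.\<close>
    have "(p x - p y) * (q x - q y) \<le> 0"
      by (auto simp: p_def q_def max_def mult_le_0_iff)
    then show "(p x - p y)\<^sup>2 + (q x - q y)\<^sup>2 \<le> (f x - f y)\<^sup>2" unfolding eq by (simp add: power2_eq_square algebra_simps)
  qed
  then have 1: "\<phi>\<^sup>2 * (nrm p + nrm q) \<le> energy f" using pq by (simp add: algebra_simps)
  have "nrm f \<le> nrm f + vol V * c\<^sup>2" by (simp add: vol_def sum_nonneg dg_nonneg)
  also have "\<dots> = (\<Sum>x\<in>V. dg x * (f x)\<^sup>2) - 2 * c * (\<Sum>x\<in>V. dg x * f x) + c\<^sup>2 * (\<Sum>x\<in>V. dg x)"
    using mean by (simp add: nrm_def vol_def)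
  also have "\<dots> = (\<Sum>x\<in>V. dg x * (f x - c)\<^sup>2)"
    unfolding sum_distrib_left sum_subtractf[symmetric] sum.distrib[symmetric]
    by (rule sum.cong) (auto simp: power2_eq_square algebra_simps)
  also have "\<dots> = nrm p + nrm q"
    unfolding nrm_def sum.distrib[symmetric]
    by (rule sum.cong) (auto simp: p_def q_def max_def power2_eq_square algebra_simps)
  finally have "\<phi>\<^sup>2 * nrm f \<le> \<phi>\<^sup>2 * (nrm p + nrm q)" by (intro mult_left_mono) auto
  then show ?thesis using 1 by linarith
qed

section \<open>Contraction and mixing of the lazy walk\<close>

definition lazy :: "('v \<Rightarrow> real) \<Rightarrow> 'v \<Rightarrow> real" where
  "lazy f x = (f x + (\<Sum>y\<in>nb x. f y) / dg x) / 2"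

lemma lazy_mean:
  assumes pos: "\<And>x. x \<in> V \<Longrightarrow> dg x > 0"
  shows "(\<Sum>x\<in>V. dg x * lazy f x) = (\<Sum>x\<in>V. dg x * f x)"
proof -
  have "(\<Sum>x\<in>V. dg x * lazy f x) = (\<Sum>x\<in>V. dg x * f x / 2 + (\<Sum>y\<in>nb x. f y) / 2)"
  proof (rule sum.cong[OF refl])
    fix x assume "x \<in> V"
    then have "dg x > 0" by (rule pos)
    then show "dg x * lazy f x = dg x * f x / 2 + (\<Sum>y\<in>nb x. f y) / 2" by (simp add: lazy_def field_simps)
  qed
  also have "\<dots> = (\<Sum>x\<in>V. dg x * f x) / 2 + (\<Sum>(x, y)\<in>D. f y) / 2"
    unfolding sum_D by (simp add: sum.distrib sum_divide_distrib)
  finally show ?thesis unfolding sum_D_snd by simp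
qed

text \<open>With \<open>P\<close> the averaging operator, \<open>lazy\<close> is
  \<open>(1 + P) / 2\<close>. Cauchy-Schwarz bounds \<open>P\<close> by 1 in norm, so the square of
  \<open>lazy\<close> is at most \<open>lazy\<close> as a quadratic form, and this form is
  \<open>nrm f - energy f / 4\<close>. Without laziness the function with values 1 and -1 on the
  classes of a bipartite graph would not contract.\<close>

lemma lazy_contract:
  assumes pos: "\<And>x. x \<in> V \<Longrightarrow> dg x > 0"
  shows "nrm (lazy f) \<le> nrm f - energy f / 4"
proof -
  define K where "K x = (\<Sum>y\<in>nb x. f y)" for x
  have K2: "(\<Sum>x\<in>V. (K x)\<^sup>2 / dg x) \<le> nrm f"
  proof -
    have "(K x)\<^sup>2 / dg x \<le> (\<Sum>y\<in>nb x. (f y)\<^sup>2)" if x: "x \<in> V" for x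
    proof -
      have "(\<Sum>y\<in>nb x. 1 * f y)\<^sup>2 \<le> (\<Sum>y\<in>nb x. 1\<^sup>2) * (\<Sum>y\<in>nb x. (f y)\<^sup>2)" by (rule Cauchy_Schwarz_ineq_sum)
      then have "(K x)\<^sup>2 \<le> dg x * (\<Sum>y\<in>nb x. (f y)\<^sup>2)" by (simp add: K_def dg_def)
      then show ?thesis using pos[OF x] by (simp add: field_simps)
    qed
    then have "(\<Sum>x\<in>V. (K x)\<^sup>2 / dg x) \<le> (\<Sum>x\<in>V. \<Sum>y\<in>nb x. (f y)\<^sup>2)" by (rule sum_mono)
    also have "\<dots> = nrm f" unfolding nrm_def sum_D_snd[symmetric] sum_D by simp
    finally show ?thesis .
  qed
  have fK: "energy f = 2 * nrm f - 2 * (\<Sum>x\<in>V. f x * K x)"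
  proof -
    have "energy f = (\<Sum>(x, y)\<in>D. (f x)\<^sup>2) + (\<Sum>(x, y)\<in>D. (f y)\<^sup>2) - 2 * (\<Sum>(x, y)\<in>D. f x * f y)"
      unfolding energy_def sum_distrib_left sum_subtractf[symmetric] sum.distrib[symmetric]
      by (rule sum.cong) (auto simp: power2_eq_square algebra_simps)
    also have "(\<Sum>(x, y)\<in>D. f x * f y) = (\<Sum>x\<in>V. f x * K x)" unfolding sum_D K_def by (simp add: sum_distrib_left)
    finally show ?thesis
      using sum_D_fst[of "\<lambda>x. (f x)\<^sup>2"] sum_D_snd[of "\<lambda>x. (f x)\<^sup>2"] by (simp add: nrm_def)
  qed
  have "nrm (lazy f) = (\<Sum>x\<in>V. dg x * (f x)\<^sup>2 / 4 + f x * K x / 2 + (K x)\<^sup>2 / dg x / 4)"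
    unfolding nrm_def
  proof (rule sum.cong[OF refl])
    fix x assume "x \<in> V"
    then have "dg x > 0" by (rule pos)
    then show "dg x * (lazy f x)\<^sup>2 = dg x * (f x)\<^sup>2 / 4 + f x * K x / 2 + (K x)\<^sup>2 / dg x / 4"
      by (simp add: lazy_def K_def[symmetric] power2_eq_square field_simps)
  qed
  also have "\<dots> = nrm f / 4 + (\<Sum>x\<in>V. f x * K x) / 2 + (\<Sum>x\<in>V. (K x)\<^sup>2 / dg x) / 4"
    unfolding nrm_def by (simp add: sum.distrib sum_divide_distrib)
  also have "\<dots> \<le> nrm f / 4 + (\<Sum>x\<in>V. f x * K x) / 2 + nrm f / 4" using K2 by simp
  finally show ?thesis unfolding fK by (simp add: field_simps)
qed

text \<open>\<open>f n x\<close> is the probability of being at \<open>y\<close> after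
  \<open>n\<close> steps from \<open>x\<close>; its limit is \<open>c\<close>, that is
  \<open>dg y / vol V\<close>. The weighted square norm of the deviation starts at no more than
  \<open>dg y\<close> and shrinks by \<open>1 - \<phi>^2 / 4\<close> in every step. The choice of
  \<open>n\<close> brings it to \<open>(c / 2)^2\<close>, and as all degrees are at least 1, each
  single deviation is then at most half the limit.\<close>

lemma lazy_power_mixing:
  assumes cond: "\<And>S. S \<subseteq> V \<Longrightarrow> vol S \<le> vol V / 2 \<Longrightarrow> \<phi> * vol S \<le> cut S" and \<phi>: "0 \<le> \<phi>" "\<phi> \<le> 1"
    and pos: "\<And>x. x \<in> V \<Longrightarrow> dg x \<ge> 1"
    and f0: "\<And>x. x \<in> V \<Longrightarrow> f 0 x = of_bool (x = y)"
    and f: "\<And>n x. x \<in> V \<Longrightarrow> f (Suc n) x = lazy (f n) x"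
    and x: "x \<in> V" and y: "y \<in> V"
    and n: "(1 - \<phi>\<^sup>2 / 4) ^ n \<le> 1 / (4 * (vol V)\<^sup>2)"
  shows "f n x \<ge> dg y / (2 * vol V)"
proof -
  define M where "M = vol V"
  have pos': "dg x > 0" if "x \<in> V" for x using pos[OF that] by simp
  have My: "M \<ge> dg y" unfolding M_def vol_def using y finite_V by (intro member_le_sum) (auto simp: dg_nonneg)
  then have M: "M > 0" using pos[OF y] by simp
  define c where "c = dg y / M"
  define g where "g n x = f n x - c" for n x
  have mf: "(\<Sum>x\<in>V. dg x * f n x) = dg y" for n
  proof (induction n)
    case 0
    have "(\<Sum>x\<in>V. dg x * f 0 x) = (\<Sum>x\<in>V. if x = y then dg x else 0)" by (rule sum.cong) (auto simp: f0)
    then show ?case using y finite_V by simp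
  next
    case (Suc n)
    have "(\<Sum>x\<in>V. dg x * f (Suc n) x) = (\<Sum>x\<in>V. dg x * lazy (f n) x)" by (rule sum.cong) (auto simp: f)
    then show ?case using lazy_mean[OF pos', of "f n"] Suc by simp
  qed
  have mg: "(\<Sum>x\<in>V. dg x * g n x) = 0" for n
  proof -
    have "(\<Sum>x\<in>V. dg x * g n x) = (\<Sum>x\<in>V. dg x * f n x) - c * M"
      by (simp add: g_def right_diff_distrib sum_subtractf M_def vol_def sum_distrib_left mult.commute)
    then show ?thesis using mf[of n] M by (simp add: c_def)
  qed
  have gS: "g (Suc n) x = lazy (g n) x" if "x \<in> V" for n x
    using pos'[OF that] by (simp add: g_def f[OF that] lazy_def sum_subtractf) (simp add: dg_def field_simps)
  have decay: "nrm (g n) \<le> (1 - \<phi>\<^sup>2 / 4) ^ n * nrm (g 0)" for n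
  proof (induction n)
    case (Suc n)
    have "nrm (g (Suc n)) = nrm (lazy (g n))" unfolding nrm_def by (rule sum.cong) (auto simp: gS)
    also have "\<dots> \<le> nrm (g n) - energy (g n) / 4" by (rule lazy_contract[OF pos'])
    also have "\<dots> \<le> (1 - \<phi>\<^sup>2 / 4) * nrm (g n)" using poincare[OF cond \<phi>(1) mg[of n]] by (simp add: algebra_simps)
    also have "\<dots> \<le> (1 - \<phi>\<^sup>2 / 4) * ((1 - \<phi>\<^sup>2 / 4) ^ n * nrm (g 0))"
      using Suc \<phi> power_le_one[of \<phi> 2] by (intro mult_left_mono) auto
    finally show ?case by (simp add: mult.assoc)
  qed simp
  have "nrm (g 0) \<le> dg y"
  proof -
    have "nrm (g 0) = (\<Sum>x\<in>V. dg x * (f 0 x)\<^sup>2) - 2 * c * (\<Sum>x\<in>V. dg x * f 0 x) + c\<^sup>2 * (\<Sum>x\<in>V. dg x)"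
      unfolding nrm_def sum_distrib_left sum_subtractf[symmetric] sum.distrib[symmetric]
      by (rule sum.cong) (auto simp: g_def power2_eq_square algebra_simps)
    also have "(\<Sum>x\<in>V. dg x * (f 0 x)\<^sup>2) = (\<Sum>x\<in>V. dg x * f 0 x)" by (rule sum.cong) (auto simp: f0)
    also have "(\<Sum>x\<in>V. dg x * f 0 x) - 2 * c * (\<Sum>x\<in>V. dg x * f 0 x) + c\<^sup>2 * (\<Sum>x\<in>V. dg x) = dg y - c * dg y"
      unfolding mf using M by (simp add: M_def[unfolded vol_def, symmetric] c_def power2_eq_square)
    also have "\<dots> \<le> dg y" using M by (simp add: c_def)
    finally show ?thesis .
  qed
  have "nrm (g n) \<le> (1 - \<phi>\<^sup>2 / 4) ^ n * dg y" for n
  proof -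
    have "0 \<le> 1 - \<phi>\<^sup>2 / 4" using \<phi> power_le_one[of \<phi> 2] by auto
    then have "(1 - \<phi>\<^sup>2 / 4) ^ n * nrm (g 0) \<le> (1 - \<phi>\<^sup>2 / 4) ^ n * dg y"
      using \<open>nrm (g 0) \<le> dg y\<close> by (intro mult_left_mono) auto
    then show ?thesis using decay[of n] by linarith
  qed
  then have "nrm (g n) \<le> (1 - \<phi>\<^sup>2 / 4) ^ n * dg y" .
  also have "\<dots> \<le> 1 / (4 * M\<^sup>2) * dg y" using n by (intro mult_right_mono dg_nonneg) (simp add: M_def)
  also have "\<dots> \<le> 1 / (4 * M\<^sup>2) * (dg y * dg y)" using pos[OF y] by (intro mult_left_mono) auto
  also have "\<dots> = (c / 2)\<^sup>2" by (simp add: c_def power2_eq_square)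
  finally have 1: "nrm (g n) \<le> (c / 2)\<^sup>2" .
  have "(g n x)\<^sup>2 \<le> dg x * (g n x)\<^sup>2" using pos[OF x] by (simp add: mult_le_cancel_right1)
  also have "\<dots> \<le> nrm (g n)" unfolding nrm_def using x finite_V
    by (intro member_le_sum) (auto intro!: mult_nonneg_nonneg dg_nonneg)
  finally have "(g n x)\<^sup>2 \<le> (c / 2)\<^sup>2" using 1 by linarith
  then have "\<bar>g n x\<bar> \<le> \<bar>c / 2\<bar>" by (simp only: abs_le_square_iff)
  moreover have "c \<ge> 0" using M dg_nonneg by (simp add: c_def)
  ultimately have "f n x \<ge> c / 2" unfolding g_def by linarith
  then show ?thesis by (simp add: c_def M_def)
qed

end

section \<open>Joint marginals of product distributions\<close>

lemma Pi_pmf_marginal: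
  assumes "finite A" "x \<in> A"
  shows "Pi_pmf A d p = bind_pmf (p x) (\<lambda>y. map_pmf (\<lambda>f. f(x := y)) (Pi_pmf (A - {x}) d p))"
proof -
  have "Pi_pmf A d p = Pi_pmf (insert x (A - {x})) d p" using assms by (simp add: insert_absorb)
  also have "\<dots> = bind_pmf (p x) (\<lambda>y. bind_pmf (Pi_pmf (A - {x}) d p) (\<lambda>f. return_pmf (f(x := y))))"
    using assms by (subst Pi_pmf_insert') auto
  finally show ?thesis by (simp add: map_pmf_def)
qed

lemma Pi_pmf_marginal2:
  assumes "finite A" "x \<in> A" "y \<in> A" "x \<noteq> y"
  shows "map_pmf (\<lambda>f. (f x, f y)) (Pi_pmf A d p) = pair_pmf (p x) (p y)"
proof -
  have "map_pmf (\<lambda>f. (f x, f y)) (Pi_pmf A d p) =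
     bind_pmf (p x) (\<lambda>a. map_pmf (\<lambda>b. (a, b)) (map_pmf (\<lambda>f. f y) (Pi_pmf (A - {x}) d p)))"
    unfolding Pi_pmf_marginal[OF assms(1,2)] using assms(4) by (simp add: map_bind_pmf map_pmf_comp)
  also have "\<dots> = bind_pmf (p x) (\<lambda>a. map_pmf (\<lambda>b. (a, b)) (p y))"
    using assms by (subst Pi_pmf_component) auto
  finally show ?thesis by (simp add: pair_pmf_def map_pmf_def bind_return_pmf)
qed

text \<open>Two disjoint edges of the complete graph on five vertices have four distinct ends, whose
  joint law is needed.\<close>

lemma Pi_pmf_marginal4:
  assumes A: "finite A" "i \<in> A" "j \<in> A" "k \<in> A" "l \<in> A" and d: "distinct [i, j, k, l]"
  shows "map_pmf (\<lambda>f. ((f i, f j), (f k, f l))) (Pi_pmf A d p) = pair_pmf (pair_pmf (p i) (p j)) (pair_pmf (p k) (p l))"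
proof -
  have 1: "map_pmf (\<lambda>f. (f k, f l)) (Pi_pmf (A - {i} - {j}) d p) = pair_pmf (p k) (p l)"
    using assms by (intro Pi_pmf_marginal2) auto
  have 2: "map_pmf (\<lambda>f. (f j, (f k, f l))) (Pi_pmf (A - {i}) d p) = pair_pmf (p j) (pair_pmf (p k) (p l))"
  proof -
    have "map_pmf (\<lambda>f. (f j, (f k, f l))) (Pi_pmf (A - {i}) d p)
      = bind_pmf (p j) (\<lambda>b. map_pmf (Pair b) (map_pmf (\<lambda>f. (f k, f l)) (Pi_pmf (A - {i} - {j}) d p)))"
      using assms by (subst Pi_pmf_marginal[of _ j]) (auto simp: map_bind_pmf map_pmf_comp)
    then show ?thesis unfolding 1 by (simp add: pair_pmf_def map_pmf_def bind_return_pmf)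
  qed
  have "map_pmf (\<lambda>f. ((f i, f j), (f k, f l))) (Pi_pmf A d p)
      = bind_pmf (p i) (\<lambda>a. map_pmf (\<lambda>(b, q). ((a, b), q)) (map_pmf (\<lambda>f. (f j, (f k, f l))) (Pi_pmf (A - {i}) d p)))"
    using assms by (subst Pi_pmf_marginal[of _ i]) (auto simp: map_bind_pmf map_pmf_comp)
  also have "\<dots> = map_pmf (\<lambda>(a, (b, q)). ((a, b), q)) (pair_pmf (p i) (pair_pmf (p j) (pair_pmf (p k) (p l))))"
    unfolding 2 by (simp add: pair_pmf_def map_bind_pmf bind_assoc_pmf bind_return_pmf bind_map_pmf map_pmf_def case_prod_beta)
  finally show ?thesis unfolding pair_pair_pmf .
qed

text \<open>Serves to carry bounds for independent stationary walks over to bridges.\<close>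

lemma measure_pmf_dominated:
  assumes fin: "finite (set_pmf p)" and dom: "\<And>z. pmf p z \<le> c * pmf q z" and c: "c \<ge> 0"
  shows "measure_pmf.prob p S \<le> c * measure_pmf.prob q S"
proof -
  have "measure_pmf.prob p S = measure_pmf.prob p (S \<inter> set_pmf p)" by (rule measure_Int_set_pmf[symmetric])
  also have "\<dots> = sum (pmf p) (S \<inter> set_pmf p)" using fin by (intro measure_measure_pmf_finite) auto
  also have "\<dots> \<le> (\<Sum>z\<in>S \<inter> set_pmf p. c * pmf q z)" by (intro sum_mono dom)
  also have "\<dots> = c * measure_pmf.prob q (S \<inter> set_pmf p)"
    using fin by (subst measure_measure_pmf_finite) (auto simp: sum_distrib_left)
  also have "\<dots> \<le> c * measure_pmf.prob q S" using c by (intro mult_left_mono measure_pmf.finite_measure_mono) auto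
  finally show ?thesis .
qed

section \<open>Stationary lazy walks and their bridges\<close>

context weighted_graph
begin

definition step :: "'v \<Rightarrow> 'v pmf" where
  "step x = bind_pmf (bernoulli_pmf (1/2)) (\<lambda>b. if b then return_pmf x else pmf_of_set (nb x))"

text \<open>The tail of a uniform dart has probability proportional to its degree: this is the
  stationary distribution of the walk.\<close>

definition stat :: "'v pmf" where "stat = map_pmf fst (pmf_of_set D)"

fun walk :: "nat \<Rightarrow> 'v \<Rightarrow> 'v list pmf" where
  "walk 0 x = return_pmf [x]"
| "walk (Suc n) x = bind_pmf (step x) (\<lambda>z. map_pmf (Cons x) (walk n z))"

definition swalk :: "nat \<Rightarrow> 'v list pmf" where "swalk n = bind_pmf stat (walk n)"

definition nonisol :: bool where "nonisol \<longleftrightarrow> V \<noteq> {} \<and> (\<forall>x\<in>V. nb x \<noteq> {})"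

lemma D_ne: "nonisol \<Longrightarrow> D \<noteq> {}"
  by (auto simp: nonisol_def nb_def)

lemma set_stat: "nonisol \<Longrightarrow> set_pmf stat \<subseteq> V"
  using D_ne finite_D D_sub by (auto simp: stat_def)

lemma set_step: assumes "nonisol" "x \<in> V" shows "set_pmf (step x) = insert x (nb x)"
  using assms finite_nb by (auto simp: step_def nonisol_def split: if_splits)

lemma set_walk:
  assumes "nonisol" "x \<in> V" "w \<in> set_pmf (walk n x)"
  shows "length w = Suc n \<and> hd w = x \<and> set w \<subseteq> V \<and> (\<forall>(a, b)\<in>set (zip w (tl w)). a = b \<or> (a, b) \<in> D)"
  using assms(2,3)
proof (induction n arbitrary: x w)
  case (Suc n)
  then obtain z w' where z: "z \<in> set_pmf (step x)" "w' \<in> set_pmf (walk n z)" "w = x # w'" by auto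
  have zV: "z \<in> V" "z = x \<or> (x, z) \<in> D" using z(1) set_step[OF assms(1) Suc.prems(1)] nb_sub Suc.prems(1) by (auto simp: nb_def)
  note IH = Suc.IH[OF zV(1) z(2)]
  then obtain u where "w' = z # u" by (cases w') auto
  then show ?case using IH z zV Suc.prems(1) by auto
qed auto

lemma pmf_stat: assumes "nonisol" shows "pmf stat a = dg a / card D"
proof -
  have "pmf stat a = measure_pmf.prob (pmf_of_set D) (fst -` {a})" by (simp add: stat_def pmf_map)
  also have "\<dots> = card (D \<inter> fst -` {a}) / card D" using D_ne[OF assms] finite_D by (simp add: measure_pmf_of_set)
  also have "D \<inter> fst -` {a} = Pair a ` nb a" by (auto simp: nb_def)
  also have "card \<dots> = card (nb a)" by (rule card_image) (auto simp: inj_on_def)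
  finally show ?thesis by (simp add: dg_def)
qed

lemma stat_dart: assumes "nonisol"
  shows "bind_pmf stat (\<lambda>x. map_pmf (Pair x) (pmf_of_set (nb x))) = pmf_of_set D"
proof (rule pmf_eqI, clarify)
  fix a b
  have inner: "pmf (map_pmf (Pair x) (pmf_of_set (nb x))) (a, b) = (if x = a then of_bool (b \<in> nb a) / card (nb a) else 0)" if "x \<in> V" for x
  proof -
    have ne: "nb x \<noteq> {}" using assms that by (auto simp: nonisol_def)
    show ?thesis
    proof (cases "x = a")
      case True
      have "pmf (map_pmf (Pair x) (pmf_of_set (nb x))) (x, b) = pmf (pmf_of_set (nb x)) b"
        by (rule pmf_map_inj') (auto simp: inj_on_def)
      then show ?thesis using True ne finite_nb[of x] by (simp add: indicator_def)
    next
      case False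
      then have "(a, b) \<notin> set_pmf (map_pmf (Pair x) (pmf_of_set (nb x)))" by auto
      then show ?thesis using False by (simp add: pmf_eq_0_set_pmf)
    qed
  qed
  have "pmf (bind_pmf stat (\<lambda>x. map_pmf (Pair x) (pmf_of_set (nb x)))) (a, b)
      = (\<Sum>p\<in>D. pmf (map_pmf (Pair (fst p)) (pmf_of_set (nb (fst p)))) (a, b)) / card D"
    unfolding pmf_bind stat_def integral_map_pmf using D_ne[OF assms] finite_D by (subst integral_pmf_of_set) auto
  also have "(\<Sum>p\<in>D. pmf (map_pmf (Pair (fst p)) (pmf_of_set (nb (fst p)))) (a, b))
     = (\<Sum>(x, y)\<in>D. if x = a then of_bool (b \<in> nb a) / card (nb a) else 0)"
    by (rule sum.cong[OF refl]) (use D_sub inner in \<open>auto simp: case_prod_beta\<close>)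
  also have "\<dots> = (\<Sum>x\<in>V. dg x * (if x = a then of_bool (b \<in> nb a) / card (nb a) else 0))"
    by (rule sum_D_fst)
  also have "\<dots> = (\<Sum>x\<in>V. if x = a then of_bool (b \<in> nb a) else 0)"
    by (rule sum.cong) (use assms finite_nb in \<open>auto simp: dg_def nonisol_def\<close>)
  also have "\<dots> = of_bool ((a, b) \<in> D)" using finite_V D_sub by (auto simp: nb_def)
  finally show "pmf (bind_pmf stat (\<lambda>x. map_pmf (Pair x) (pmf_of_set (nb x)))) (a, b) = pmf (pmf_of_set D) (a, b)"
    using D_ne[OF assms] finite_D by (simp add: indicator_def)
qed

lemma stat_snd: assumes "nonisol" shows "map_pmf snd (pmf_of_set D) = stat"
proof -
  have sw: "prod.swap ` D = D" using D_sym by (auto simp: image_iff) (metis swap_simp)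
  have "map_pmf prod.swap (pmf_of_set D) = pmf_of_set D"
  proof -
    have "inj_on prod.swap D" by (rule inj_onI) (metis swap_swap)
    then show ?thesis using map_pmf_of_set_inj[of prod.swap D] D_ne[OF assms] finite_D sw by simp
  qed
  then have "map_pmf snd (pmf_of_set D) = map_pmf snd (map_pmf prod.swap (pmf_of_set D))" by simp
  also have "\<dots> = stat" by (simp add: stat_def map_pmf_comp)
  finally show ?thesis .
qed

text \<open>Tossing the lazy coin first separates staying from moving, so the identities for uniform
  darts become applicable.\<close>

lemma bind_step: "bind_pmf M (\<lambda>x. bind_pmf (step x) (F x)) =
    bind_pmf (bernoulli_pmf (1/2)) (\<lambda>b. if b then bind_pmf M (\<lambda>x. F x x) else bind_pmf M (\<lambda>x. bind_pmf (pmf_of_set (nb x)) (F x)))"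
proof -
  have "bind_pmf M (\<lambda>x. bind_pmf (step x) (F x)) =
    bind_pmf M (\<lambda>x. bind_pmf (bernoulli_pmf (1/2)) (\<lambda>b. if b then F x x else bind_pmf (pmf_of_set (nb x)) (F x)))"
    unfolding step_def bind_assoc_pmf
    by (intro bind_pmf_cong refl) (auto simp: bind_return_pmf)
  also have "\<dots> = bind_pmf (bernoulli_pmf (1/2)) (\<lambda>b. bind_pmf M (\<lambda>x. if b then F x x else bind_pmf (pmf_of_set (nb x)) (F x)))"
    by (rule bind_commute_pmf)
  also have "\<dots> = bind_pmf (bernoulli_pmf (1/2)) (\<lambda>b. if b then bind_pmf M (\<lambda>x. F x x) else bind_pmf M (\<lambda>x. bind_pmf (pmf_of_set (nb x)) (F x)))"
    by (intro bind_pmf_cong refl) auto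
  finally show ?thesis .
qed

definition jump :: "('v \<times> 'v) pmf" where "jump = bind_pmf stat (\<lambda>x. map_pmf (Pair x) (step x))"

lemma jump_eq: assumes "nonisol"
  shows "jump = bind_pmf (bernoulli_pmf (1/2)) (\<lambda>b. if b then map_pmf (\<lambda>x. (x, x)) stat else pmf_of_set D)"
  unfolding jump_def map_pmf_def[of "Pair _"] bind_step
  by (intro bind_pmf_cong refl) (auto simp: map_pmf_def[symmetric] stat_dart[OF assms])

lemma stat_step: assumes "nonisol" shows "bind_pmf stat step = stat"
proof -
  have "bind_pmf stat step = bind_pmf stat (\<lambda>x. bind_pmf (step x) return_pmf)" by (simp add: bind_return_pmf')
  also have "\<dots> = bind_pmf (bernoulli_pmf (1/2)) (\<lambda>b. if b then stat else map_pmf snd (pmf_of_set D))"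
    unfolding bind_step stat_dart[OF assms, symmetric]
    by (intro bind_pmf_cong refl) (auto simp: bind_return_pmf' map_bind_pmf map_pmf_comp)
  also have "\<dots> = stat" unfolding stat_snd[OF assms] by simp
  finally show ?thesis .
qed

text \<open>By stationarity. Iterating it gives every position the law \<open>stat\<close> and every
  pair of consecutive positions the law \<open>jump\<close>.\<close>

lemma swalk_Suc: assumes "nonisol" shows "map_pmf tl (swalk (Suc n)) = swalk n"
proof -
  have "map_pmf tl (swalk (Suc n)) = bind_pmf stat (\<lambda>x. bind_pmf (step x) (walk n))"
    by (simp add: swalk_def map_bind_pmf map_pmf_comp)
  also have "\<dots> = bind_pmf (bind_pmf stat step) (walk n)" by (simp add: bind_assoc_pmf)
  finally show ?thesis by (simp add: stat_step[OF assms] swalk_def)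
qed

lemma walk_hd: "map_pmf (\<lambda>w. w ! 0) (walk n x) = return_pmf x"
  by (cases n) (auto simp: map_bind_pmf map_pmf_comp)

lemma swalk_length: assumes "nonisol" "w \<in> set_pmf (swalk n)" shows "length w = Suc n"
  using assms set_walk set_stat by (fastforce simp: swalk_def)

lemma swalk_nth: assumes "nonisol" "i \<le> n" shows "map_pmf (\<lambda>w. w ! i) (swalk n) = stat"
  using assms(2)
proof (induction i arbitrary: n)
  case 0
  then show ?case by (simp add: swalk_def map_bind_pmf walk_hd bind_return_pmf')
next
  case (Suc i)
  then obtain n' where n': "n = Suc n'" "i \<le> n'" by (cases n) auto
  have "map_pmf (\<lambda>w. w ! Suc i) (swalk n) = map_pmf (\<lambda>w. w ! i) (map_pmf tl (swalk n))"
    unfolding map_pmf_comp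
  proof (rule map_pmf_cong[OF refl])
    fix w assume "w \<in> set_pmf (swalk n)"
    then have "length w = Suc n" by (rule swalk_length[OF assms(1)])
    then show "w ! Suc i = tl w ! i" by (cases w) auto
  qed
  then show ?case using Suc.IH[OF n'(2)] swalk_Suc[OF assms(1)] n' by simp
qed

lemma swalk_jump: assumes "nonisol" "i < n" shows "map_pmf (\<lambda>w. (w ! i, w ! Suc i)) (swalk n) = jump"
  using assms(2)
proof (induction i arbitrary: n)
  case 0
  then obtain n' where n': "n = Suc n'" by (cases n) auto
  have "map_pmf (\<lambda>w. (w ! 0, w ! Suc 0)) (swalk n)
     = bind_pmf stat (\<lambda>x. bind_pmf (step x) (\<lambda>z. map_pmf (Pair x) (map_pmf (\<lambda>w. w ! 0) (walk n' z))))"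
    by (simp add: n' swalk_def map_bind_pmf map_pmf_comp)
  then show ?case unfolding walk_hd by (simp add: jump_def map_pmf_def bind_return_pmf)
next
  case (Suc i)
  then obtain n' where n': "n = Suc n'" "i < n'" by (cases n) auto
  have "map_pmf (\<lambda>w. (w ! Suc i, w ! Suc (Suc i))) (swalk n) = map_pmf (\<lambda>w. (w ! i, w ! Suc i)) (map_pmf tl (swalk n))"
    unfolding map_pmf_comp
  proof (rule map_pmf_cong[OF refl])
    fix w assume "w \<in> set_pmf (swalk n)"
    then have "length w = Suc n" by (rule swalk_length[OF assms(1)])
    then show "(w ! Suc i, w ! Suc (Suc i)) = (tl w ! i, tl w ! Suc i)" by (cases w) auto
  qed
  then show ?case using Suc.IH[OF n'(2)] swalk_Suc[OF assms(1)] n' by simp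
qed

text \<open>The factor 2 is the lazy coin: half of the mass of \<open>jump\<close> is on the
  diagonal.\<close>

lemma pmf_jump: assumes "nonisol" "(a, b) \<in> D" "a \<noteq> b" shows "pmf jump (a, b) = 1 / (2 * card D)"
proof -
  have "(a, b) \<notin> set_pmf (map_pmf (\<lambda>x. (x, x)) stat)" using assms(3) by auto
  then have "pmf (map_pmf (\<lambda>x. (x, x)) stat) (a, b) = 0" by (simp add: pmf_eq_0_set_pmf)
  then show ?thesis unfolding jump_eq[OF assms(1)] pmf_bind using assms D_ne finite_D by simp
qed

definition lastp :: "nat \<Rightarrow> 'v \<Rightarrow> 'v \<Rightarrow> real" where "lastp n x y = pmf (map_pmf last (walk n x)) y"

text \<open>First-step analysis. It identifies the transition probabilities with iterates of
  \<open>lazy\<close>, the form that \<open>lazy_power_mixing\<close> expects.\<close>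

lemma lastp_Suc: assumes "nonisol" "x \<in> V" shows "lastp (Suc n) x y = lazy (\<lambda>z. lastp n z y) x"
proof -
  have ne: "w \<noteq> []" if "z \<in> V" "w \<in> set_pmf (walk n z)" for z w using set_walk[OF assms(1) that] by auto
  have stepV: "set_pmf (step x) \<subseteq> V" using set_step[OF assms] nb_sub assms by auto
  have "map_pmf last (walk (Suc n) x) = bind_pmf (step x) (\<lambda>z. map_pmf last (walk n z))"
    unfolding walk.simps map_bind_pmf map_pmf_comp
    using ne stepV by (intro bind_pmf_cong map_pmf_cong refl) fastforce
  also have "\<dots> = bind_pmf (bernoulli_pmf (1/2)) (\<lambda>b. if b then map_pmf last (walk n x)
      else bind_pmf (pmf_of_set (nb x)) (\<lambda>z. map_pmf last (walk n z)))"
    unfolding step_def bind_assoc_pmf by (intro bind_pmf_cong refl) (auto simp: bind_return_pmf)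
  finally have eq: "map_pmf last (walk (Suc n) x) = \<dots>" .
  have "nb x \<noteq> {}" using assms by (auto simp: nonisol_def)
  then have "(\<integral>z. lastp n z y \<partial>measure_pmf (pmf_of_set (nb x))) = (\<Sum>z\<in>nb x. lastp n z y) / dg x"
    using finite_nb[of x] by (simp add: integral_pmf_of_set dg_def)
  then show ?thesis unfolding lastp_def eq pmf_bind
    by (simp add: pmf_bind lazy_def field_simps)
qed

lemma prob_swalk_ends: assumes "nonisol" shows "measure_pmf.prob (swalk n) {w. hd w = x \<and> last w = y} = pmf stat x * lastp n x y"
proof -
  have "measure_pmf.prob (swalk n) {w. hd w = x \<and> last w = y} = pmf (map_pmf (\<lambda>w. (hd w, last w)) (swalk n)) (x, y)"
    by (simp add: pmf_map vimage_def)
  also have "map_pmf (\<lambda>w. (hd w, last w)) (swalk n) = bind_pmf stat (\<lambda>z. map_pmf (Pair z) (map_pmf last (walk n z)))"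
    unfolding swalk_def map_bind_pmf map_pmf_comp
  proof (intro bind_pmf_cong map_pmf_cong refl)
    fix z w assume "z \<in> set_pmf stat" "w \<in> set_pmf (walk n z)"
    then show "(hd w, last w) = (z, last w)" using set_walk[OF assms, of z w n] set_stat[OF assms] by auto
  qed
  also have "pmf \<dots> (x, y) = (\<integral>z. pmf (map_pmf (Pair z) (map_pmf last (walk n z))) (x, y) \<partial>measure_pmf stat)"
    by (rule pmf_bind)
  also have "\<dots> = (\<Sum>z\<in>{x}. pmf (map_pmf (Pair z) (map_pmf last (walk n z))) (x, y) * pmf stat z)"
  proof (rule integral_measure_pmf_real)
    fix z assume "pmf (map_pmf (Pair z) (map_pmf last (walk n z))) (x, y) \<noteq> 0"
    then have "(x, y) \<in> set_pmf (map_pmf (Pair z) (map_pmf last (walk n z)))" unfolding set_pmf_iff .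
    then show "z \<in> {x}" by auto
  qed simp
  also have "pmf (map_pmf (Pair x) (map_pmf last (walk n x))) (x, y) = lastp n x y"
    unfolding lastp_def by (rule pmf_map_inj') (auto simp: inj_on_def)
  ultimately show ?thesis
    using \<open>pmf (map_pmf (Pair x) (map_pmf last (walk n x))) (x, y) = lastp n x y\<close> by simp
qed

lemma finite_swalk: assumes "nonisol" shows "finite (set_pmf (swalk n))"
proof (rule finite_subset)
  show "set_pmf (swalk n) \<subseteq> {w. set w \<subseteq> V \<and> length w = Suc n}"
    using set_walk[OF assms] set_stat[OF assms] by (fastforce simp: swalk_def)
  show "finite {w. set w \<subseteq> V \<and> length w = Suc n}" using finite_V by (rule finite_lists_length_eq)
qed

text \<open>Bounds the chance that two independent stationary walks are at the same vertex at given
  times.\<close>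

lemma stat_pair_eq_prob:
  assumes "nonisol" and \<mu>: "\<And>x. x \<in> V \<Longrightarrow> pmf stat x \<le> \<mu>"
  shows "measure_pmf.prob (pair_pmf stat stat) {(a, b). a = b} \<le> \<mu>"
proof -
  have sV: "set_pmf stat \<subseteq> V" by (rule set_stat[OF assms(1)])
  have "measure_pmf.prob (pair_pmf stat stat) {(a, b). a = b} \<le> measure_pmf.prob (pair_pmf stat stat) ((\<lambda>v. (v, v)) ` V)"
    by (subst measure_Int_set_pmf[symmetric]) (rule measure_pmf.finite_measure_mono, use sV in auto)
  also have "\<dots> = (\<Sum>v\<in>V. pmf stat v * pmf stat v)"
    using finite_V by (subst measure_measure_pmf_finite) (auto simp: sum.reindex inj_on_def pmf_pair)
  also have "\<dots> \<le> (\<Sum>v\<in>V. \<mu> * pmf stat v)" using \<mu> by (intro sum_mono mult_right_mono) auto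
  also have "\<dots> = \<mu> * (\<Sum>v\<in>V. pmf stat v)" by (simp add: sum_distrib_left)
  also have "(\<Sum>v\<in>V. pmf stat v) = 1" using sV finite_V by (intro sum_pmf_eq_1) auto
  finally show ?thesis by simp
qed

lemma jump_pair_prob:
  assumes "nonisol" and C: "C \<subseteq> D \<times> D" and irr: "\<And>a b. (a, b) \<in> D \<Longrightarrow> a \<noteq> b"
  shows "measure_pmf.prob (pair_pmf jump jump) C = real (card C) / (4 * (real (card D))\<^sup>2)"
proof -
  have fC: "finite C" using C finite_D by (meson finite_SigmaI finite_subset)
  have "measure_pmf.prob (pair_pmf jump jump) C = (\<Sum>p\<in>C. pmf (pair_pmf jump jump) p)"
    by (rule measure_measure_pmf_finite[OF fC])
  also have "\<dots> = (\<Sum>p\<in>C. 1 / (4 * (real (card D))\<^sup>2))"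
  proof (rule sum.cong[OF refl])
    fix p assume "p \<in> C"
    then obtain a b x y where p: "p = ((a, b), (x, y))" "(a, b) \<in> D" "(x, y) \<in> D" using C by (cases p) auto
    then show "pmf (pair_pmf jump jump) p = 1 / (4 * (real (card D))\<^sup>2)"
      using pmf_jump[OF assms(1) p(2)] pmf_jump[OF assms(1) p(3)] irr by (simp add: pmf_pair power2_eq_square)
  qed
  finally show ?thesis by simp
qed

text \<open>Union bound over \<open>(n + 1)^2\<close> pairs of positions and \<open>n^2\<close>
  pairs of steps. A pair in \<open>C\<close> consists of proper darts, each with probability
  \<open>1 / (2 * card D)\<close> under \<open>jump\<close>.\<close>

lemma swalk_pair_bad_prob:
  assumes ni: "nonisol" and C: "C \<subseteq> D \<times> D" and irr: "\<And>a b. (a, b) \<in> D \<Longrightarrow> a \<noteq> b"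
    and \<mu>: "\<And>x. x \<in> V \<Longrightarrow> pmf stat x \<le> \<mu>"
    and F: "F = {(w, w'). set w \<inter> set w' \<noteq> {} \<or> (set (zip w (tl w)) \<times> set (zip w' (tl w'))) \<inter> C \<noteq> {}}"
  shows "measure_pmf.prob (pair_pmf (swalk n) (swalk n)) F \<le> (real n + 1)\<^sup>2 * \<mu> + (real n)\<^sup>2 * (real (card C) / (4 * (real (card D))\<^sup>2))"
proof -
  let ?M = "pair_pmf (swalk n) (swalk n)"
  define G where "G i j = {p. fst p ! i = (snd p :: 'v list) ! j}" for i j
  define H where "H i j = {p. ((fst p ! i, fst p ! Suc i), (snd p ! j, snd p ! Suc j)) \<in> C}" for i j
  have G: "measure_pmf.prob ?M (G i j) \<le> \<mu>" if "i \<le> n" "j \<le> n" for i j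
  proof -
    have "measure_pmf.prob ?M (G i j) = measure_pmf.prob (map_pmf (\<lambda>(w, w'). (w ! i, w' ! j)) ?M) {(a, b). a = b}"
      by (simp add: G_def vimage_def case_prod_beta)
    then show ?thesis unfolding map_pair swalk_nth[OF ni that(1)] swalk_nth[OF ni that(2)]
      using stat_pair_eq_prob[OF ni \<mu>] by simp
  qed
  have H: "measure_pmf.prob ?M (H i j) = real (card C) / (4 * (real (card D))\<^sup>2)" if "i < n" "j < n" for i j
  proof -
    have "measure_pmf.prob ?M (H i j) = measure_pmf.prob (map_pmf (\<lambda>(w, w'). ((w ! i, w ! Suc i), (w' ! j, w' ! Suc j))) ?M) C"
      by (simp add: H_def vimage_def case_prod_beta)
    then show ?thesis
      unfolding map_pair[of "\<lambda>w. (w ! i, w ! Suc i)" "\<lambda>w'. (w' ! j, w' ! Suc j)"] swalk_jump[OF ni that(1)] swalk_jump[OF ni that(2)]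
      using jump_pair_prob[OF ni C irr] by simp
  qed
  have sub: "F \<inter> set_pmf ?M \<subseteq> (\<Union>(i, j)\<in>{..n} \<times> {..n}. G i j) \<union> (\<Union>(i, j)\<in>{..<n} \<times> {..<n}. H i j)"
  proof clarify
    fix w w' assume A: "(w, w') \<in> F" "(w, w') \<in> set_pmf ?M" and nH: "(w, w') \<notin> (\<Union>(i, j)\<in>{..<n} \<times> {..<n}. H i j)"
    have len: "length w = Suc n" "length w' = Suc n" using A swalk_length[OF ni] by auto
    have "set w \<inter> set w' \<noteq> {}"
    proof (rule ccontr)
      assume "\<not> ?thesis"
      then obtain p q where pq: "p \<in> set (zip w (tl w))" "q \<in> set (zip w' (tl w'))" "(p, q) \<in> C" using A(1) F by auto
      then obtain i j where ij: "i < n" "p = (w ! i, w ! Suc i)" "j < n" "q = (w' ! j, w' ! Suc j)"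
        using len by (auto simp: in_set_zip nth_tl)
      then have "(w, w') \<in> H i j" using pq by (simp add: H_def)
      then show False using nH ij by auto
    qed
    then obtain i j where "i < length w" "j < length w'" "w ! i = w' ! j" by (metis disjoint_iff in_set_conv_nth)
    then have "i \<le> n" "j \<le> n" "(w, w') \<in> G i j" using len by (auto simp: G_def)
    then show "(w, w') \<in> (\<Union>(i, j)\<in>{..n} \<times> {..n}. G i j)" by auto
  qed
  have "measure_pmf.prob ?M F = measure_pmf.prob ?M (F \<inter> set_pmf ?M)" by (rule measure_Int_set_pmf[symmetric])
  also have "\<dots> \<le> measure_pmf.prob ?M ((\<Union>(i, j)\<in>{..n} \<times> {..n}. G i j) \<union> (\<Union>(i, j)\<in>{..<n} \<times> {..<n}. H i j))"
    by (rule measure_pmf.finite_measure_mono[OF sub]) simp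
  also have "\<dots> \<le> measure_pmf.prob ?M (\<Union>(i, j)\<in>{..n} \<times> {..n}. G i j) + measure_pmf.prob ?M (\<Union>(i, j)\<in>{..<n} \<times> {..<n}. H i j)"
    by (rule measure_Un_le) auto
  also have "measure_pmf.prob ?M (\<Union>(i, j)\<in>{..n} \<times> {..n}. G i j) \<le> (\<Sum>(i, j)\<in>{..n} \<times> {..n}. measure_pmf.prob ?M (G i j))"
    unfolding case_prod_beta by (rule measure_UNION_le) auto
  also have "\<dots> \<le> (\<Sum>(i, j)\<in>{..n} \<times> {..n}. \<mu>)" by (rule sum_mono) (use G in auto)
  also have "measure_pmf.prob ?M (\<Union>(i, j)\<in>{..<n} \<times> {..<n}. H i j) \<le> (\<Sum>(i, j)\<in>{..<n} \<times> {..<n}. measure_pmf.prob ?M (H i j))"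
    unfolding case_prod_beta by (rule measure_UNION_le) auto
  also have "\<dots> = (\<Sum>(i, j)\<in>{..<n} \<times> {..<n}. real (card C) / (4 * (real (card D))\<^sup>2))" by (rule sum.cong) (use H in auto)
  finally show ?thesis by (simp add: power2_eq_square algebra_simps)
qed

text \<open>A bridge is a stationary walk conditioned on its ends. Drawing the ends independently
  instead changes the law by the ratio of \<open>pmf stat x * pmf stat y\<close> to the probability
  that the walk has these ends; mixing bounds this ratio by 2.\<close>

lemma dominated_bridges:
  assumes ni: "nonisol" and mix: "\<And>x y. x \<in> V \<Longrightarrow> y \<in> V \<Longrightarrow> pmf stat y / 2 \<le> lastp n x y"
  obtains B where "\<And>x y w. x \<in> V \<Longrightarrow> y \<in> V \<Longrightarrow> w \<in> set_pmf (B x y) \<Longrightarrow> w \<in> set_pmf (swalk n) \<and> hd w = x \<and> last w = y"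
    "\<And>w. pmf (bind_pmf (pair_pmf stat stat) (\<lambda>(x, y). B x y)) w \<le> 2 * pmf (swalk n) w"
proof -
  define A where "A x y = {w :: 'v list. hd w = x \<and> last w = y}" for x y
  define B where "B x y = cond_pmf (swalk n) (A x y)" for x y
  have cD: "card D > 0" using D_ne[OF ni] finite_D by (simp add: card_gt_0_iff)
  have spos: "pmf stat x > 0" if "x \<in> V" for x
    using that ni cD finite_nb[of x] unfolding pmf_stat[OF ni] dg_def nonisol_def by (simp add: card_gt_0_iff)
  have prA: "measure_pmf.prob (swalk n) (A x y) = pmf stat x * lastp n x y" for x y
    unfolding A_def by (rule prob_swalk_ends[OF ni])
  have lb: "pmf stat x * pmf stat y / 2 \<le> measure_pmf.prob (swalk n) (A x y)" if "x \<in> V" "y \<in> V" for x y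
    unfolding prA using mult_left_mono[OF mix[OF that], of "pmf stat x"] by simp
  have Ane: "set_pmf (swalk n) \<inter> A x y \<noteq> {}" if "x \<in> V" "y \<in> V" for x y
  proof
    assume "set_pmf (swalk n) \<inter> A x y = {}"
    then have "measure_pmf.prob (swalk n) (A x y) = 0" by (simp add: measure_pmf_zero_iff)
    moreover have "pmf stat x * pmf stat y / 2 > 0" using spos that by simp
    ultimately show False using lb[OF that] by linarith
  qed
  show thesis
  proof (rule that[of B])
    fix x y w assume "x \<in> V" "y \<in> V" "w \<in> set_pmf (B x y)"
    then show "w \<in> set_pmf (swalk n) \<and> hd w = x \<and> last w = y"
      using Ane by (simp add: B_def set_cond_pmf) (simp add: A_def)
  next
    fix w :: "'v list"
    let ?p = "(hd w, last w)"
    have supp: "set_pmf (pair_pmf stat stat) \<subseteq> V \<times> V" using set_stat[OF ni] by auto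
    have "pmf (bind_pmf (pair_pmf stat stat) (\<lambda>(x, y). B x y)) w
       = (\<integral>p. pmf (case p of (x, y) \<Rightarrow> B x y) w \<partial>measure_pmf (pair_pmf stat stat))" by (rule pmf_bind)
    \<comment> \<open>A bridge equal to \<open>w\<close> can only arise from the ends of
      \<open>w\<close> itself.\<close>
    also have "\<dots> = (\<Sum>p\<in>{?p}. pmf (case p of (x, y) \<Rightarrow> B x y) w * pmf (pair_pmf stat stat) p)"
    proof (rule integral_measure_pmf_real)
      fix p assume p: "p \<in> set_pmf (pair_pmf stat stat)" "pmf (case p of (x, y) \<Rightarrow> B x y) w \<noteq> 0"
      then obtain x y where xy: "p = (x, y)" "x \<in> V" "y \<in> V" using supp by (cases p) auto
      then have "w \<in> set_pmf (B x y)" using p(2) by (simp add: set_pmf_iff)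
      then have "w \<in> A x y" using set_cond_pmf[OF Ane[OF xy(2,3)]] by (simp add: B_def)
      then show "p \<in> {?p}" using xy by (auto simp: A_def)
    qed simp
    also have "\<dots> = pmf (B (hd w) (last w)) w * (pmf stat (hd w) * pmf stat (last w))" by (simp add: pmf_pair)
    also have "\<dots> \<le> 2 * pmf (swalk n) w"
    proof (cases "hd w \<in> V \<and> last w \<in> V")
      case True
      let ?q = "measure_pmf.prob (swalk n) (A (hd w) (last w))"
      have q: "pmf stat (hd w) * pmf stat (last w) \<le> 2 * ?q" "?q > 0"
        using lb[of "hd w" "last w"] spos[of "hd w"] spos[of "last w"] True mult_pos_pos[of "pmf stat (hd w)" "pmf stat (last w)"]
        by linarith+
      have "pmf (B (hd w) (last w)) w = pmf (swalk n) w / ?q"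
        unfolding B_def using pmf_cond[OF Ane, of "hd w" "last w" w] True by (simp add: A_def)
      moreover have "pmf (swalk n) w / ?q * (pmf stat (hd w) * pmf stat (last w)) \<le> pmf (swalk n) w / ?q * (2 * ?q)"
        by (rule mult_left_mono[OF q(1)]) simp
      ultimately show ?thesis using q(2) by simp
    next
      case False
      then have z: "pmf stat (hd w) * pmf stat (last w) = 0" using set_stat[OF ni] by (auto simp: set_pmf_iff subset_iff)
      show ?thesis unfolding z by simp
    qed
    finally show "pmf (bind_pmf (pair_pmf stat stat) (\<lambda>(x, y). B x y)) w \<le> 2 * pmf (swalk n) w" .
  qed
qed

text \<open>Five independent stationary vertices are joined by bridges. Were odd pairs rare, a union
  bound would leave an outcome in which walks without a common end are disjoint and carry no odd
  pair, against \<open>K5_walks_odd_pair\<close>.\<close>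

lemma many_odd_pairs:
  assumes ni: "nonisol" and irr: "\<And>a b. (a, b) \<in> D \<Longrightarrow> a \<noteq> b"
    and rep: "parity_rep {{a, b} | a b. (a, b) \<in> D} c"
    and mix: "\<And>x y. x \<in> V \<Longrightarrow> y \<in> V \<Longrightarrow> pmf stat y / 2 \<le> lastp n x y"
    and \<mu>: "\<And>x. x \<in> V \<Longrightarrow> pmf stat x \<le> \<mu>" "5000 * (real n + 1)\<^sup>2 * \<mu> \<le> 1"
    and C: "C = {((a, b), (x, y)). (a, b) \<in> D \<and> (x, y) \<in> D \<and> {a, b} \<inter> {x, y} = {} \<and> c {a, b} {x, y}}"
  shows "4 * (real (card D))\<^sup>2 \<le> 5000 * (real n)\<^sup>2 * card C"
proof (rule ccontr)
  assume small: "\<not> ?thesis"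
  have cD: "card D > 0" using D_ne[OF ni] finite_D by (simp add: card_gt_0_iff)
  define F where "F = {(w, w'). set w \<inter> set w' \<noteq> {} \<or> (set (zip w (tl w)) \<times> set (zip w' (tl w'))) \<inter> C \<noteq> {}}"
  have CD: "C \<subseteq> D \<times> D" by (auto simp: C)
  have "measure_pmf.prob (pair_pmf (swalk n) (swalk n)) F \<le> (real n + 1)\<^sup>2 * \<mu> + (real n)\<^sup>2 * (real (card C) / (4 * (real (card D))\<^sup>2))"
    by (rule swalk_pair_bad_prob[OF ni CD irr \<mu>(1) F_def])
  \<comment> \<open>5000 is \<open>2 * 4 * 625\<close>: two kinds of failure, a factor 2 for each of
    two bridges, and at most \<open>25^2\<close> pairs of walks.\<close>
  also have "\<dots> < 1 / 5000 + 1 / 5000"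
  proof -
    have "(real n)\<^sup>2 * (real (card C) / (4 * (real (card D))\<^sup>2)) < 1 / 5000"
      using small cD by (simp add: field_simps)
    then show ?thesis using \<mu>(2) by linarith
  qed
  finally have PF: "measure_pmf.prob (pair_pmf (swalk n) (swalk n)) F < 1 / 2500" by simp
  obtain B where B: "\<And>x y w. x \<in> V \<Longrightarrow> y \<in> V \<Longrightarrow> w \<in> set_pmf (B x y) \<Longrightarrow> w \<in> set_pmf (swalk n) \<and> hd w = x \<and> last w = y"
    "\<And>w. pmf (bind_pmf (pair_pmf stat stat) (\<lambda>(x, y). B x y)) w \<le> 2 * pmf (swalk n) w"
    using dominated_bridges[OF ni mix] by blast
  define Bh where "Bh = bind_pmf (pair_pmf stat stat) (\<lambda>(x, y). B x y)"
  have finB: "finite (set_pmf Bh)"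
  proof (rule finite_subset[OF _ finite_swalk[OF ni, of n]])
    show "set_pmf Bh \<subseteq> set_pmf (swalk n)" using B(1) set_stat[OF ni] by (auto simp: Bh_def)
  qed
  have PB: "measure_pmf.prob (pair_pmf Bh Bh) F < 1 / 625"
  proof -
    have "measure_pmf.prob (pair_pmf Bh Bh) F \<le> 4 * measure_pmf.prob (pair_pmf (swalk n) (swalk n)) F"
    proof (rule measure_pmf_dominated)
      fix z :: "'v list \<times> 'v list"
      have "pmf Bh (fst z) * pmf Bh (snd z) \<le> (2 * pmf (swalk n) (fst z)) * (2 * pmf (swalk n) (snd z))"
        using B(2) unfolding Bh_def by (intro mult_mono) auto
      then show "pmf (pair_pmf Bh Bh) z \<le> 4 * pmf (pair_pmf (swalk n) (swalk n)) z" by (cases z) (simp add: pmf_pair)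
    qed (use finB in auto)
    then show ?thesis using PF by linarith
  qed
  define I where "I = {..<5::nat} \<times> {..<5::nat}"
  \<comment> \<open>The bridges are independent only given the five vertices.\<close>
  define \<Omega> where "\<Omega> = bind_pmf (Pi_pmf {..<5::nat} undefined (\<lambda>_. stat)) (\<lambda>v. Pi_pmf I [] (\<lambda>(i, j). B (v i) (v j)))"
  define PQ where "PQ = {((i, j), (k, l)). i < j \<and> k < l \<and> i < k \<and> j < (5::nat) \<and> l < 5 \<and> j \<noteq> k \<and> j \<noteq> l}"
  have PQI: "PQ \<subseteq> I \<times> I" by (auto simp: PQ_def I_def)
  have finI: "finite I" by (simp add: I_def)
  have cPQ: "finite PQ" "card PQ \<le> 625"
  proof -
    show "finite PQ" using PQI finI by (meson finite_SigmaI finite_subset)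
    have "card PQ \<le> card (I \<times> I)" using PQI finI by (intro card_mono) auto
    then show "card PQ \<le> 625" by (simp add: I_def card_cartesian_product)
  qed
  \<comment> \<open>Two walks of a pair in \<open>PQ\<close> have four distinct end indices, so
    their ends are independent, and with them the walks.\<close>
  have marg: "map_pmf (\<lambda>f. (f p, f q)) \<Omega> = pair_pmf Bh Bh" if pq: "(p, q) \<in> PQ" for p q
  proof -
    obtain i j k l where e: "p = (i, j)" "q = (k, l)" by (cases p, cases q) auto
    have d: "i \<in> {..<5}" "j \<in> {..<5}" "k \<in> {..<5}" "l \<in> {..<5}" "distinct [i, j, k, l]"
      using pq by (auto simp: e PQ_def)
    have "map_pmf (\<lambda>f. (f p, f q)) \<Omega> = bind_pmf (Pi_pmf {..<5} undefined (\<lambda>_. stat)) (\<lambda>v. pair_pmf (B (v i) (v j)) (B (v k) (v l)))"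
      unfolding \<Omega>_def map_bind_pmf
    proof (rule bind_pmf_cong[OF refl])
      fix v
      have "map_pmf (\<lambda>f. (f p, f q)) (Pi_pmf I [] (\<lambda>(i, j). B (v i) (v j))) =
          pair_pmf ((\<lambda>(i, j). B (v i) (v j)) p) ((\<lambda>(i, j). B (v i) (v j)) q)"
        using d by (intro Pi_pmf_marginal2 finI) (auto simp: e I_def)
      then show "map_pmf (\<lambda>f. (f p, f q)) (Pi_pmf I [] (\<lambda>(i, j). B (v i) (v j))) = pair_pmf (B (v i) (v j)) (B (v k) (v l))"
        by (simp add: e)
    qed
    also have "\<dots> = bind_pmf (map_pmf (\<lambda>v. ((v i, v j), (v k, v l))) (Pi_pmf {..<5} undefined (\<lambda>_. stat)))
        (\<lambda>((a, b), (x, y)). pair_pmf (B a b) (B x y))"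
      by (simp add: bind_map_pmf)
    also have "\<dots> = bind_pmf (pair_pmf (pair_pmf stat stat) (pair_pmf stat stat)) (\<lambda>((a, b), (x, y)). pair_pmf (B a b) (B x y))"
      using d by (subst Pi_pmf_marginal4) auto
    also have "\<dots> = pair_pmf Bh Bh"
    proof -
      have "pair_pmf Bh Bh = bind_pmf Bh (\<lambda>w. bind_pmf Bh (\<lambda>w'. return_pmf (w, w')))" by (rule pair_pmf_def)
      also have "\<dots> = bind_pmf (pair_pmf stat stat) (\<lambda>(a, b). bind_pmf (B a b) (\<lambda>w. bind_pmf (pair_pmf stat stat) (\<lambda>(x, y). bind_pmf (B x y) (\<lambda>w'. return_pmf (w, w')))))"
        unfolding Bh_def by (simp add: bind_assoc_pmf case_prod_beta')
      also have "\<dots> = bind_pmf (pair_pmf stat stat) (\<lambda>(a, b). bind_pmf (pair_pmf stat stat) (\<lambda>(x, y). pair_pmf (B a b) (B x y)))"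
        unfolding case_prod_beta' pair_pmf_def[of "B _ _"]
        by (intro bind_pmf_cong refl) (rule bind_commute_pmf)
      finally show ?thesis
        by (simp add: pair_pmf_def[of "pair_pmf stat stat"] bind_assoc_pmf bind_return_pmf case_prod_beta')
    qed
    finally show ?thesis .
  qed
  have "measure_pmf.prob \<Omega> (\<Union>pq\<in>PQ. {f. (f (fst pq), f (snd pq)) \<in> F}) \<le> (\<Sum>pq\<in>PQ. measure_pmf.prob \<Omega> {f. (f (fst pq), f (snd pq)) \<in> F})"
    using cPQ(1) by (intro measure_UNION_le) auto
  also have "\<dots> = (\<Sum>pq\<in>PQ. measure_pmf.prob (pair_pmf Bh Bh) F)"
  proof (rule sum.cong[OF refl])
    fix pq assume "pq \<in> PQ"
    then have m: "map_pmf (\<lambda>f. (f (fst pq), f (snd pq))) \<Omega> = pair_pmf Bh Bh" by (intro marg) simp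
    have "measure_pmf.prob \<Omega> {f. (f (fst pq), f (snd pq)) \<in> F}
        = measure_pmf.prob (map_pmf (\<lambda>f. (f (fst pq), f (snd pq))) \<Omega>) F"
      unfolding measure_map_pmf vimage_def ..
    then show "measure_pmf.prob \<Omega> {f. (f (fst pq), f (snd pq)) \<in> F} = measure_pmf.prob (pair_pmf Bh Bh) F"
      unfolding m .
  qed
  also have "\<dots> = card PQ * measure_pmf.prob (pair_pmf Bh Bh) F" by simp
  also have "\<dots> \<le> 625 * measure_pmf.prob (pair_pmf Bh Bh) F" using cPQ(2) by (intro mult_right_mono) auto
  also have "\<dots> < 1" using PB by simp
  finally have "\<not> set_pmf \<Omega> \<subseteq> (\<Union>pq\<in>PQ. {f. (f (fst pq), f (snd pq)) \<in> F})"
    using measure_pmf.prob_eq_1[of "\<Union>pq\<in>PQ. {f. (f (fst pq), f (snd pq)) \<in> F}" \<Omega>]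
    unfolding AE_measure_pmf_iff by (metis (no_types, lifting) UNIV_I less_irrefl sets_measure_pmf subset_iff)
  then obtain f where f0: "f \<in> set_pmf \<Omega>" "f \<notin> (\<Union>pq\<in>PQ. {f. (f (fst pq), f (snd pq)) \<in> F})" by blast
  have fF: "(f p, f q) \<notin> F" if "(p, q) \<in> PQ" for p q using f0(2) that by force
  from f0(1) obtain v where v: "v \<in> set_pmf (Pi_pmf {..<5::nat} undefined (\<lambda>_. stat))"
      "f \<in> set_pmf (Pi_pmf I [] (\<lambda>(i, j). B (v i) (v j)))" by (auto simp: \<Omega>_def)
  have vV: "v i \<in> V" if "i < 5" for i
    using v(1) that set_stat[OF ni] by (auto simp: set_Pi_pmf PiE_dflt_def)
  have fB: "f (i, j) \<in> set_pmf (B (v i) (v j))" if "i < 5" "j < 5" for i j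
    using v(2) that finI by (auto simp: set_Pi_pmf PiE_dflt_def I_def)
  let ?E = "{{a, b} | a b. (a, b) \<in> D}"
  have fw: "is_walk ?E (f (i, j)) \<and> hd (f (i, j)) = v i \<and> last (f (i, j)) = v j \<and>
      (\<forall>(a, b)\<in>set (zip (f (i, j)) (tl (f (i, j)))). a = b \<or> (a, b) \<in> D)" if ij: "i < 5" "j < 5" for i j
  proof -
    have w: "f (i, j) \<in> set_pmf (swalk n)" "hd (f (i, j)) = v i" "last (f (i, j)) = v j"
      using B(1)[OF vV[OF ij(1)] vV[OF ij(2)] fB[OF ij]] by auto
    from w(1) obtain x where "x \<in> V" "f (i, j) \<in> set_pmf (walk n x)" using set_stat[OF ni] by (auto simp: swalk_def)
    from set_walk[OF ni this] show ?thesis using w unfolding is_walk_def by fastforce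
  qed
  show False
  proof (rule K5_walks_odd_pair[OF rep, of "\<lambda>i j. f (i, j)" v])
    fix i j k l a b x y
    assume A: "i < j" "k < l" "i < k" "j < (5::nat)" "l < 5" "j \<noteq> k" "j \<noteq> l"
      "(a, b) \<in> set (zip (f (i, j)) (tl (f (i, j))))" "(x, y) \<in> set (zip (f (k, l)) (tl (f (k, l))))"
      "a \<noteq> b" "x \<noteq> y" "c {a, b} {x, y}"
    have nF: "(f (i, j), f (k, l)) \<notin> F" using A by (intro fF) (auto simp: PQ_def)
    have "(a, b) \<in> D" "(x, y) \<in> D" using fw[of i j] fw[of k l] A by auto
    moreover have "{a, b} \<inter> {x, y} = {}"
      using nF zip_tl_mem[OF A(8)] zip_tl_mem[OF A(9)] by (auto simp: F_def)
    ultimately have "((a, b), (x, y)) \<in> C" using A by (simp add: C)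
    then show False using nF A(8,9) by (auto simp: F_def)
  next
    fix i j k l :: nat assume A: "i < j" "k < l" "i < k" "j < 5" "l < 5" "j \<noteq> k" "j \<noteq> l"
    have "(f (i, j), f (k, l)) \<notin> F" using A by (intro fF) (auto simp: PQ_def)
    then show "set (f (i, j)) \<inter> set (f (k, l)) = {}" by (auto simp: F_def)
  qed (use fw in auto)
qed

end

section \<open>Expanding subgraphs of nearly maximal density\<close>

definition darts :: "'v set set \<Rightarrow> ('v \<times> 'v) set" where "darts F = {(x, y). {x, y} \<in> F}"

lemma darts_ne: "(\<And>e. e \<in> F \<Longrightarrow> card e = 2) \<Longrightarrow> (x, y) \<in> darts F \<Longrightarrow> x \<noteq> y"
  by (force simp: darts_def)

lemma card_darts:
  assumes "finite F" "\<And>e. e \<in> F \<Longrightarrow> card e = 2"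
  shows "finite (darts F) \<and> card (darts F) = 2 * card F"
  using assms
proof (induction F)
  case empty then show ?case by (simp add: darts_def)
next
  case (insert e F)
  have "card e = 2" using insert.prems by simp
  then obtain a b where e: "e = {a, b}" "a \<noteq> b" by (auto simp: card_2_iff)
  have "darts (insert e F) = insert (a, b) (insert (b, a) (darts F))" by (auto simp: darts_def e doubleton_eq_iff)
  moreover have "(a, b) \<notin> darts F" "(b, a) \<notin> darts F" using insert.hyps e by (auto simp: darts_def insert_commute)
  moreover have "finite (darts F) \<and> card (darts F) = 2 * card F" using insert by auto
  ultimately show ?case using insert.hyps e by auto
qed

text \<open>The added 1 makes \<open>lg\<close> at least 1 on numbers from 1 on, so that it can be
  divided by; halving the argument lowers it by 1.\<close>

definition lg :: "real \<Rightarrow> real" where "lg x = 1 + log 2 x"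

lemma lg_ge_1: "x \<ge> 1 \<Longrightarrow> lg x \<ge> 1" by (simp add: lg_def)

lemma lg_mono: "1 \<le> x \<Longrightarrow> x \<le> y \<Longrightarrow> lg x \<le> lg y" by (simp add: lg_def)

lemma lg_half: "1 \<le> x \<Longrightarrow> x \<le> y / 2 \<Longrightarrow> lg x \<le> lg y - 1"
proof -
  assume "1 \<le> x" "x \<le> y / 2"
  then have "log 2 x \<le> log 2 (y / 2)" by simp
  also have "\<dots> = log 2 y - 1" using \<open>1 \<le> x\<close> \<open>x \<le> y / 2\<close> by (subst log_divide) auto
  finally show ?thesis by (simp add: lg_def)
qed

text \<open>\<open>U\<close> maximises the number of edges per vertex divided by \<open>lg\<close>
  of the number of edges. Of two parts of \<open>U\<close>, the one with fewer edges has a divisor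
  smaller by at least 1, so its plain density falls clearly below that of \<open>U\<close>, and this
  forces many edges between the parts. Comparison with \<open>V\<close> shows that only a
  logarithmic factor of density is lost.\<close>

lemma densest_subgraph_expands:
  fixes V :: "'v set" and E :: "'v set set"
  assumes V: "finite V" and E: "\<And>e. e \<in> E \<Longrightarrow> e \<subseteq> V \<and> card e = 2" and ne: "E \<noteq> {}"
  defines "ind U \<equiv> {e \<in> E. e \<subseteq> U}"
  obtains U where "U \<subseteq> V" "ind U \<noteq> {}"
    "real (card E) * card U \<le> lg (card E) * card (ind U) * card V"
    "\<And>x. x \<in> U \<Longrightarrow> \<exists>e\<in>ind U. x \<in> e"
    "\<And>S. S \<subseteq> U \<Longrightarrow> card (ind S) \<le> card (ind (U - S)) \<Longrightarrow>
        real (card (ind S)) \<le> lg (card (ind U)) * (real (card (ind U)) - card (ind S) - card (ind (U - S)))"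
proof -
  have finE: "finite E" by (rule finite_subset[of _ "Pow V"]) (use V E in auto)
  have find: "finite (ind U)" for U using finE by (simp add: ind_def)
  define r where "r U = real (card (ind U)) / (card U * lg (card (ind U)))" for U
  define \<U> where "\<U> = {U. U \<subseteq> V \<and> ind U \<noteq> {}}"
  have "ind V = E" using E by (auto simp: ind_def)
  then have VU: "V \<in> \<U>" using ne by (simp add: \<U>_def)
  have "finite \<U>" using V by (simp add: \<U>_def)
  then have fr: "finite (r ` \<U>)" "r ` \<U> \<noteq> {}" using VU by auto
  obtain U where U0: "U \<in> \<U>" "r U = Max (r ` \<U>)" using Max_in[OF fr] by auto
  have U: "U \<in> \<U>" "\<And>W. W \<in> \<U> \<Longrightarrow> r W \<le> r U"
    using U0 Max_ge[OF fr(1)] by auto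
  have pos: "card (ind W) \<ge> 1" "card W \<ge> 2" "finite W" if "W \<in> \<U>" for W
  proof -
    show f: "finite W" using that V finite_subset by (auto simp: \<U>_def)
    have "ind W \<noteq> {}" using that by (simp add: \<U>_def)
    then show "card (ind W) \<ge> 1" using find[of W] by (simp add: Suc_le_eq card_gt_0_iff)
    obtain e where "e \<in> ind W" using \<open>ind W \<noteq> {}\<close> by auto
    then have "e \<subseteq> W" "card e = 2" using E by (auto simp: ind_def)
    then show "card W \<ge> 2" using f card_mono by metis
  qed
  define \<epsilon> where "\<epsilon> = real (card (ind U))"
  define G where "G = lg \<epsilon>"
  have e1: "\<epsilon> \<ge> 1" using pos[OF U(1)] by (simp add: \<epsilon>_def)
  have G1: "G \<ge> 1" using lg_ge_1[OF e1] by (simp add: G_def)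
  have cU: "real (card U) \<ge> 2" using pos[OF U(1)] by simp
  define \<rho> where "\<rho> = r U"
  have \<rho>: "\<rho> = \<epsilon> / (card U * G)" "\<rho> > 0" using e1 G1 cU by (auto simp: \<rho>_def r_def \<epsilon>_def G_def)
  have bound: "real (card (ind W)) \<le> \<rho> * card W * lg (card (ind W))" if W: "W \<in> \<U>" for W
  proof -
    have "card W * lg (card (ind W)) > 0" using pos[OF W] lg_ge_1[of "card (ind W)"] by (intro mult_pos_pos) auto
    then show ?thesis using U(2)[OF W] unfolding r_def[of W] \<rho>_def[symmetric] by (simp add: field_simps)
  qed
  show thesis
  proof (rule that[of U])
    show "U \<subseteq> V" "ind U \<noteq> {}" using U by (auto simp: \<U>_def)
    have "real (card E) \<le> \<rho> * card V * lg (card E)" using bound[OF VU] \<open>ind V = E\<close> by simp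
    then have "real (card E) * card U \<le> \<rho> * card V * lg (card E) * card U" by (intro mult_right_mono) auto
    also have "\<dots> = (\<epsilon> / G) * card V * lg (card E)" using \<rho> cU by simp
    also have "\<dots> \<le> \<epsilon> * card V * lg (card E)"
    proof -
      have "\<epsilon> / G \<le> \<epsilon>" using G1 e1 by (simp add: divide_le_eq mult_le_cancel_left1)
      moreover have "lg (card E) \<ge> 0" using lg_ge_1[of "card E"] pos[OF VU] \<open>ind V = E\<close> by simp
      ultimately show ?thesis by (intro mult_right_mono) auto
    qed
    finally show "real (card E) * card U \<le> lg (card E) * card (ind U) * card V" by (simp add: \<epsilon>_def mult_ac)
  next
    \<comment> \<open>Deleting an isolated vertex would raise the maximal ratio.\<close>
    fix x assume x: "x \<in> U"
    show "\<exists>e\<in>ind U. x \<in> e"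
    proof (rule ccontr)
      assume "\<not> ?thesis"
      then have eq: "ind (U - {x}) = ind U" by (auto simp: ind_def)
      then have W: "U - {x} \<in> \<U>" using U(1) by (auto simp: \<U>_def)
      have "\<epsilon> \<le> \<rho> * card (U - {x}) * G" using bound[OF W] by (simp add: eq \<epsilon>_def G_def)
      also have "\<dots> < \<rho> * card U * G" using x pos[OF U(1)] \<rho>(2) G1 by (intro mult_strict_right_mono mult_strict_left_mono) auto
      also have "\<dots> = \<epsilon>" using \<rho>(1) cU G1 by simp
      finally show False by simp
    qed
  next
    fix S assume S: "S \<subseteq> U" "card (ind S) \<le> card (ind (U - S))"
    let ?a = "real (card (ind S))" and ?b = "real (card (ind (U - S)))"
    have dis: "ind S \<inter> ind (U - S) = {}"
    proof (rule ccontr)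
      assume "\<not> ?thesis"
      then obtain e where "e \<in> E" "e \<subseteq> S" "e \<subseteq> U - S" by (auto simp: ind_def)
      then have "e = {}" by auto
      then show False using E[OF \<open>e \<in> E\<close>] by simp
    qed
    have "ind S \<union> ind (U - S) \<subseteq> ind U" using S(1) by (auto simp: ind_def)
    then have "card (ind S \<union> ind (U - S)) \<le> card (ind U)" by (intro card_mono find)
    then have sum: "?a + ?b \<le> \<epsilon>" using dis find by (simp add: card_Un_disjoint \<epsilon>_def)
    have "?a \<le> G * (\<epsilon> - ?a - ?b)"
    proof (cases "card (ind S) = 0")
      case True
      then show ?thesis using sum G1 by simp
    next
      case False
      then have a1: "?a \<ge> 1" "?b \<ge> 1" using S(2) by auto
      have W: "S \<in> \<U>" "U - S \<in> \<U>" using a1 S(1) U(1) by (auto simp: \<U>_def)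
      have ge: "lg ?a \<ge> 1" "lg ?b \<ge> 1" using lg_ge_1 a1 by auto
      \<comment> \<open>The part with fewer edges has at most half of them.\<close>
      have half: "lg ?a \<le> G - 1" unfolding G_def using sum S(2) a1 by (intro lg_half) auto
      then have G2: "G - 1 \<ge> 1" using ge by linarith
      have lb: "lg ?b \<le> G" unfolding G_def using sum a1 by (intro lg_mono) auto
      have "?a / (G - 1) \<le> \<rho> * card S"
      proof -
        have "?a \<le> \<rho> * card S * lg ?a" by (rule bound[OF W(1)])
        also have "\<dots> \<le> \<rho> * card S * (G - 1)" using half \<rho>(2) by (intro mult_left_mono) auto
        finally show ?thesis using G2 by (simp add: divide_le_eq)
      qed
      moreover have "?b / G \<le> \<rho> * card (U - S)"
      proof -
        have "?b \<le> \<rho> * card (U - S) * lg ?b" by (rule bound[OF W(2)])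
        also have "\<dots> \<le> \<rho> * card (U - S) * G" using lb \<rho>(2) by (intro mult_left_mono) auto
        finally show ?thesis using G1 by (simp add: divide_le_eq)
      qed
      moreover have "\<rho> * card S + \<rho> * card (U - S) = \<rho> * card U"
      proof -
        have "card S + card (U - S) = card U" using S(1) pos(3)[OF U(1)] by (metis card_Diff_subset card_mono finite_subset le_add_diff_inverse)
        then show ?thesis by (metis distrib_left of_nat_add)
      qed
      moreover have "\<rho> * card U = \<epsilon> / G" using \<rho>(1) cU by simp
      \<comment> \<open>With \<open>G\<close> in both denominators this would be the trivial
        \<open>?a + ?b \<le> \<epsilon>\<close>; the smaller denominator is the whole gain.\<close>
      ultimately have le: "?a / (G - 1) + ?b / G \<le> \<epsilon> / G" by linarith
      have "(?a / (G - 1) + ?b / G) * G \<le> \<epsilon> / G * G" using le G1 by (intro mult_right_mono) auto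
      then have "?a * G / (G - 1) + ?b \<le> \<epsilon>" using G1 by (simp add: distrib_right)
      moreover have "?a * G / (G - 1) = ?a + ?a / (G - 1)" using G2 by (simp add: field_simps)
      ultimately have "?a / (G - 1) \<le> \<epsilon> - ?a - ?b" by linarith
      then have "?a \<le> (\<epsilon> - ?a - ?b) * (G - 1)" using G2 by (simp add: divide_le_eq)
      also have "\<dots> \<le> G * (\<epsilon> - ?a - ?b)" using sum by (simp add: algebra_simps)
      finally show ?thesis .
    qed
    then show "?a \<le> lg (card (ind U)) * (real (card (ind U)) - ?a - ?b)" by (simp add: G_def \<epsilon>_def)
  qed
qed

text \<open>The decay reaches \<open>exp (- (2 * lm + 2))\<close> after this many steps, and
  \<open>2 powr (- (2 * lm + 2))\<close> is one over four times the square of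
  \<open>2 powr lm\<close>. In the bound on the length, 146 is \<open>4 * 9 * 4\<close> and 1 each
  for rounding up and for the added 1.\<close>

lemma walk_length_suffices:
  fixes lm :: real and \<phi> :: real
  assumes "lm \<ge> 1" "\<phi> = 1 / (2 * lm + 1)" "M > 0" "M \<le> 2 powr lm"
  defines "n \<equiv> nat \<lceil>4 * (2 * lm + 1)\<^sup>2 * (2 * lm + 2)\<rceil>"
  shows "(1 - \<phi>\<^sup>2 / 4) ^ n \<le> 1 / (4 * M\<^sup>2)" "real n + 1 \<le> 146 * lm ^ 3" "n > 0"
proof -
  let ?y = "4 * (2 * lm + 1)\<^sup>2 * (2 * lm + 2)"
  have y0: "?y > 0" using assms(1) by (intro mult_pos_pos) auto
  have ny: "?y \<le> real n" "real n \<le> ?y + 1" using y0 unfolding n_def by linarith+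
  show "n > 0" using ny y0 by linarith
  have \<phi>: "0 < \<phi>" "\<phi> \<le> 1" using assms by auto
  have "1 - \<phi>\<^sup>2 / 4 \<le> exp (- (\<phi>\<^sup>2 / 4))" using exp_ge_add_one_self[of "- (\<phi>\<^sup>2 / 4)"] by simp
  moreover have "0 \<le> 1 - \<phi>\<^sup>2 / 4" using \<phi> power_le_one[of \<phi> 2] by auto
  ultimately have "(1 - \<phi>\<^sup>2 / 4) ^ n \<le> exp (- (\<phi>\<^sup>2 / 4)) ^ n" by (rule power_mono)
  also have "\<dots> = exp (- (real n * (\<phi>\<^sup>2 / 4)))" by (simp add: exp_of_nat_mult[symmetric])
  also have "\<dots> \<le> exp (- (2 * lm + 2))"
  proof -
    have "2 * lm + 2 = ?y * (\<phi>\<^sup>2 / 4)" using assms(1) by (simp add: assms(2) power2_eq_square)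
    also have "\<dots> \<le> real n * (\<phi>\<^sup>2 / 4)" using ny by (intro mult_right_mono) auto
    finally show ?thesis by simp
  qed
  also have "\<dots> \<le> 2 powr (- (2 * lm + 2))"
  proof -
    have "2 powr (- (2 * lm + 2)) = exp (- ((2 * lm + 2) * ln 2))" unfolding powr_def by (simp add: algebra_simps)
    moreover have "(2 * lm + 2) * ln 2 \<le> (2 * lm + 2) * (1::real)" using assms(1) ln_2_less_1 by (intro mult_left_mono) auto
    ultimately show ?thesis by simp
  qed
  also have "\<dots> = 1 / (4 * (2 powr lm)\<^sup>2)"
    by (simp add: powr_minus powr_add power2_eq_square powr_add[symmetric] field_simps)
  also have "\<dots> \<le> 1 / (4 * M\<^sup>2)" using assms(3,4) by (intro divide_left_mono mult_left_mono power_mono) auto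
  finally show "(1 - \<phi>\<^sup>2 / 4) ^ n \<le> 1 / (4 * M\<^sup>2)" .
  have l: "1 \<le> lm ^ 3" using assms(1) by (simp add: one_le_power)
  have "?y \<le> 4 * (3 * lm)\<^sup>2 * (4 * lm)" using assms(1) by (intro mult_mono power_mono) auto
  also have "\<dots> = 144 * lm ^ 3" by (simp add: power2_eq_square power3_eq_cube)
  finally show "real n + 1 \<le> 146 * lm ^ 3" using ny l by linarith
qed

text \<open>53290000 is \<open>5000 * 146^2 / 2\<close>, from the constants of
  \<open>many_odd_pairs\<close> and of the walk length. The count of odd pairs presupposes that
  \<open>F\<close> is dense, as walks avoid each other only if no vertex carries much of the
  stationary measure.\<close>

theorem dense_odd_subgraph:
  fixes V :: "'v set" and E :: "'v set set"
  assumes V: "finite V" and E: "\<And>e. e \<in> E \<Longrightarrow> e \<subseteq> V \<and> card e = 2" and ne: "E \<noteq> {}" and rep: "parity_rep E c"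
    and lm: "lm = lg (card E)"
  obtains U F where "U \<subseteq> V" "F \<subseteq> E" "F \<noteq> {}" "\<And>e. e \<in> F \<Longrightarrow> e \<subseteq> U" "real (card E) * card U \<le> lm * card F * card V"
    "53290000 * lm ^ 6 * card U \<le> card F \<Longrightarrow>
      (real (card F))\<^sup>2 \<le> 53290000 * lm ^ 6 * card {(e, f). e \<in> F \<and> f \<in> F \<and> e \<inter> f = {} \<and> c e f}"
proof -
  have finE: "finite E" by (rule finite_subset[of _ "Pow V"]) (use V E in auto)
  define ind where "ind U = {e \<in> E. e \<subseteq> U}" for U
  obtain U where U: "U \<subseteq> V" "ind U \<noteq> {}" "real (card E) * card U \<le> lg (card E) * card (ind U) * card V"
    "\<And>x. x \<in> U \<Longrightarrow> \<exists>e\<in>ind U. x \<in> e"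
    "\<And>S. S \<subseteq> U \<Longrightarrow> card (ind S) \<le> card (ind (U - S)) \<Longrightarrow>
        real (card (ind S)) \<le> lg (card (ind U)) * (real (card (ind U)) - card (ind S) - card (ind (U - S)))"
    using densest_subgraph_expands[OF V E ne] unfolding ind_def by blast
  define F where "F = ind U"
  have FE: "F \<subseteq> E" "\<And>e. e \<in> F \<Longrightarrow> e \<subseteq> U \<and> card e = 2" "F \<noteq> {}" using E U(2) by (auto simp: F_def ind_def)
  have finU: "finite U" using U(1) V finite_subset by blast
  have finF: "finite F" using FE(1) finE finite_subset by blast
  have cF: "1 \<le> card F" using finF FE(3) by (simp add: Suc_le_eq card_gt_0_iff)
  have cFE: "card F \<le> card E" using FE(1) finE by (rule card_mono[rotated])
  have l1: "lm \<ge> 1" using lg_ge_1 cF cFE lm by simp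
  have find: "finite (ind S)" "\<And>e. e \<in> ind S \<Longrightarrow> card e = 2" for S using finE E by (auto simp: ind_def)
  interpret weighted_graph U "darts F"
  proof
    show "finite U" by (rule finU)
    show "darts F \<subseteq> U \<times> U" using FE(2) by (force simp: darts_def)
    show "(y, x) \<in> darts F" if "(x, y) \<in> darts F" for x y using that by (simp add: darts_def insert_commute)
  qed
  have irr: "a \<noteq> b" if "(a, b) \<in> darts F" for a b using darts_ne[of F] FE(2) that by blast
  have cD: "card (darts F) = 2 * card F" using card_darts[OF finF] FE(2) by blast
  have Une: "U \<noteq> {}" using FE(2,3) by fastforce
  have ni: nonisol unfolding nonisol_def nb_def
  proof (intro conjI ballI)
    fix x assume "x \<in> U"
    then obtain e where e: "e \<in> F" "x \<in> e" using U(4) by (auto simp: F_def)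
    then obtain y where "e = {x, y}" using FE(2)[OF e(1)] by (auto simp: card_2_iff doubleton_eq_iff insert_commute)
    then show "{y. (x, y) \<in> darts F} \<noteq> {}" using e by (auto simp: darts_def)
  qed (rule Une)
  have dg1: "dg x \<ge> 1" if "x \<in> U" for x
    using ni that finite_nb[of x] by (auto simp: nonisol_def dg_def Suc_le_eq card_gt_0_iff)
  have inS: "real (card {(x, y) \<in> darts F. x \<in> S \<and> y \<in> S}) = 2 * card (ind S)" if "S \<subseteq> U" for S
  proof -
    have "{(x, y) \<in> darts F. x \<in> S \<and> y \<in> S} = darts (ind S)" using that by (auto simp: darts_def F_def ind_def)
    then show ?thesis using card_darts[OF find(1,2)] by simp
  qed
  have volS: "vol S = 2 * card (ind S) + cut S" if "S \<subseteq> U" for S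
  proof -
    have finS: "finite S" using that finU finite_subset by blast
    have "vol S = real (card (Sigma S nb))" unfolding vol_def dg_def using finS finite_nb by simp
    also have "Sigma S nb = {(x, y) \<in> darts F. x \<in> S \<and> y \<in> S} \<union> {(x, y) \<in> darts F. x \<in> S \<and> y \<notin> S}" by (auto simp: nb_def)
    also have "real (card \<dots>) = real (card {(x, y) \<in> darts F. x \<in> S \<and> y \<in> S}) + card {(x, y) \<in> darts F. x \<in> S \<and> y \<notin> S}"
    proof -
      have "finite {(x, y) \<in> darts F. x \<in> S \<and> y \<in> S}" "finite {(x, y) \<in> darts F. x \<in> S \<and> y \<notin> S}"
        by (rule finite_subset[OF _ finite_D]; auto)+
      then show ?thesis by (subst card_Un_disjoint) auto
    qed
    finally show ?thesis unfolding inS[OF that] cut_def .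
  qed
  have cutU: "cut U = 0"
  proof -
    have "{(x, y) \<in> darts F. x \<in> U \<and> y \<notin> U} = {}" using D_sub by auto
    then show ?thesis unfolding cut_def by (simp only: card.empty of_nat_0)
  qed
  have volU: "vol U = 2 * card F" using volS[of U] cutU by (simp add: F_def)
  have cutc: "cut (U - S) = cut S" if "S \<subseteq> U" for S
  proof -
    have sw: "(y, x) \<in> darts F \<longleftrightarrow> (x, y) \<in> darts F" for x y by (simp add: darts_def insert_commute)
    have inU: "x \<in> U \<and> y \<in> U" if "(x, y) \<in> darts F" for x y using D_sub that by blast
    have "prod.swap ` {(x, y) \<in> darts F. x \<in> S \<and> y \<notin> S} = {(x, y) \<in> darts F. x \<in> U - S \<and> y \<notin> U - S}"
    proof (intro equalityI subsetI)
      fix p assume "p \<in> {(x, y) \<in> darts F. x \<in> U - S \<and> y \<notin> U - S}"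
      then obtain x y where p: "p = (x, y)" "(x, y) \<in> darts F" "x \<in> U - S" "y \<notin> U - S" by blast
      then have "(y, x) \<in> {(x, y) \<in> darts F. x \<in> S \<and> y \<notin> S}" using inU[OF p(2)] sw by blast
      then show "p \<in> prod.swap ` {(x, y) \<in> darts F. x \<in> S \<and> y \<notin> S}" using p(1) by (intro image_eqI[of _ _ "(y, x)"]) auto
    next
      fix p assume "p \<in> prod.swap ` {(x, y) \<in> darts F. x \<in> S \<and> y \<notin> S}"
      then obtain x y where p: "p = (y, x)" "(x, y) \<in> darts F" "x \<in> S" "y \<notin> S" by auto
      then show "p \<in> {(x, y) \<in> darts F. x \<in> U - S \<and> y \<notin> U - S}" using inU[OF p(2)] sw by blast
    qed
    moreover have "inj_on prod.swap A" for A :: "('v \<times> 'v) set" by (rule inj_onI) (metis swap_swap)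
    ultimately show ?thesis unfolding cut_def by (metis (no_types, lifting) card_image)
  qed
  have voladd: "vol S + vol (U - S) = vol U" if "S \<subseteq> U" for S
    unfolding vol_def using that finU by (metis add.commute sum.subset_diff)
  define \<phi> where "\<phi> = 1 / (2 * lm + 1)"
  have \<phi>: "0 \<le> \<phi>" "\<phi> \<le> 1" using l1 by (auto simp: \<phi>_def)
  \<comment> \<open>The volume is twice the number of inner edges plus the cut, and \<open>S\<close>
    and its complement have the same cut. So at most half the volume means at most as many inner
    edges as the complement has, the situation covered by the choice of \<open>U\<close>.\<close>
  have cond: "\<phi> * vol S \<le> cut S" if S: "S \<subseteq> U" "vol S \<le> vol U / 2" for S
  proof -
    have v: "vol S = 2 * card (ind S) + cut S" "vol (U - S) = 2 * card (ind (U - S)) + cut S"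
      using volS[of S] volS[of "U - S"] cutc[OF S(1)] S(1) by auto
    have va: "vol S + vol (U - S) = 2 * card F" using voladd[OF S(1)] volU by simp
    have "card (ind S) \<le> card (ind (U - S))" using v va S(2) volU by linarith
    then have "real (card (ind S)) \<le> lg (card F) * (real (card F) - card (ind S) - card (ind (U - S)))"
      using U(5)[OF S(1)] by (simp add: F_def)
    moreover have "real (card F) - card (ind S) - card (ind (U - S)) = cut S" using v va by linarith
    ultimately have "real (card (ind S)) \<le> lg (card F) * cut S" by simp
    also have "\<dots> \<le> lm * cut S" unfolding lm using cF cFE by (intro mult_right_mono lg_mono) (auto simp: cut_def)
    finally have "vol S \<le> (2 * lm + 1) * cut S" using v by (simp add: algebra_simps)
    then show ?thesis using l1 by (simp add: \<phi>_def field_simps)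
  qed
  define n where "n = nat \<lceil>4 * (2 * lm + 1)\<^sup>2 * (2 * lm + 2)\<rceil>"
  \<comment> \<open>By the definition of \<open>lg\<close>, \<open>2 powr lm\<close> is
    \<open>2 * card E\<close>, while the volume is \<open>2 * card F\<close>.\<close>
  have volpow: "vol U > 0" "vol U \<le> 2 powr lm"
  proof -
    show "vol U > 0" using volU cF by simp
    have "2 powr lm = 2 * card E" using cF cFE by (simp add: lm lg_def powr_add)
    then show "vol U \<le> 2 powr lm" using volU cFE by simp
  qed
  note wl = walk_length_suffices[OF l1 \<phi>_def volpow, folded n_def]
  have mix: "pmf stat y / 2 \<le> lastp n x y" if "x \<in> U" "y \<in> U" for x y
  proof -
    have "dg y / (2 * vol U) \<le> lastp n x y"
    proof (rule lazy_power_mixing[OF cond \<phi> dg1 _ _ that, where f = "\<lambda>n x. lastp n x y"])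
      fix x show "lastp 0 x y = of_bool (x = y)" by (simp add: lastp_def)
    qed (use lastp_Suc[OF ni] wl(1) in auto)
    moreover have "pmf stat y = dg y / vol U" by (simp add: pmf_stat[OF ni] cD volU)
    ultimately show ?thesis by simp
  qed
  have key: "(real (card F))\<^sup>2 \<le> 53290000 * lm ^ 6 * card {(e, f). e \<in> F \<and> f \<in> F \<and> e \<inter> f = {} \<and> c e f}"
    if big: "53290000 * lm ^ 6 * card U \<le> card F"
  proof -
    \<comment> \<open>Degrees are at most \<open>card U\<close>, and there are twice as many darts
      as edges.\<close>
    define \<mu> where "\<mu> = card U / (2 * real (card F))"
    have \<mu>1: "pmf stat x \<le> \<mu>" if "x \<in> U" for x
    proof -
      have "card (nb x) \<le> card U" using nb_sub finU by (intro card_mono) auto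
      then show ?thesis unfolding pmf_stat[OF ni] \<mu>_def cD dg_def by (simp add: divide_right_mono)
    qed
    have n2: "(real n + 1)\<^sup>2 \<le> (146 * lm ^ 3)\<^sup>2" using wl(2) by (intro power_mono) auto
    have sq: "(146 * lm ^ 3)\<^sup>2 = 21316 * lm ^ 6" by (simp add: power_mult_distrib power_mult[symmetric])
    have \<mu>2: "5000 * (real n + 1)\<^sup>2 * \<mu> \<le> 1"
    proof -
      have "5000 * (real n + 1)\<^sup>2 * \<mu> \<le> 5000 * (21316 * lm ^ 6) * \<mu>"
        using n2 sq by (intro mult_right_mono mult_left_mono) (auto simp: \<mu>_def)
      also have "\<dots> = (53290000 * lm ^ 6 * card U) / card F" by (simp add: \<mu>_def)
      also have "\<dots> \<le> 1" using big cF by (simp add: divide_le_eq)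
      finally show ?thesis .
    qed
    have repF: "parity_rep {{a, b} | a b. (a, b) \<in> darts F} c"
    proof -
      have "{{a, b} | a b. (a, b) \<in> darts F} \<subseteq> E" using FE(1) by (auto simp: darts_def)
      then show ?thesis using rep unfolding parity_rep_def by (meson subsetD)
    qed
    define O' where "O' = {(e, f). e \<in> F \<and> f \<in> F \<and> e \<inter> f = {} \<and> c e f}"
    define C where "C = {((a, b), (x, y)). (a, b) \<in> darts F \<and> (x, y) \<in> darts F \<and> {a, b} \<inter> {x, y} = {} \<and> c {a, b} {x, y}}"
    have main: "4 * (real (card (darts F)))\<^sup>2 \<le> 5000 * (real n)\<^sup>2 * card C"
      by (rule many_odd_pairs[OF ni irr repF mix \<mu>1 \<mu>2 C_def])
    have finO: "finite O'" by (rule finite_subset[of _ "F \<times> F"]) (use finF in \<open>auto simp: O'_def\<close>)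
    have dart1: "finite (darts {e}) \<and> card (darts {e}) = 2" if "e \<in> F" for e using card_darts[of "{e}"] FE(2) that by simp
    \<comment> \<open>An ordered pair of edges accounts for four pairs of darts.\<close>
    have "card C \<le> card (\<Union>(e, f)\<in>O'. darts {e} \<times> darts {f})"
    proof (rule card_mono)
      show "finite (\<Union>(e, f)\<in>O'. darts {e} \<times> darts {f})" using finO dart1 by (auto simp: O'_def)
      show "C \<subseteq> (\<Union>(e, f)\<in>O'. darts {e} \<times> darts {f})" by (force simp: C_def O'_def darts_def)
    qed
    also have "\<dots> \<le> (\<Sum>(e, f)\<in>O'. card (darts {e} \<times> darts {f}))"
      unfolding case_prod_beta by (rule card_UN_le[OF finO])
    also have "\<dots> = (\<Sum>(e, f)\<in>O'. 4)" by (rule sum.cong[OF refl]) (use dart1 in \<open>auto simp: O'_def card_cartesian_product\<close>)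
    finally have CO: "real (card C) \<le> 4 * card O'" by simp
    have "16 * (real (card F))\<^sup>2 \<le> 5000 * (real n)\<^sup>2 * card C" using main by (simp add: cD power_mult_distrib)
    also have "\<dots> \<le> 5000 * (21316 * lm ^ 6) * (4 * card O')"
    proof (intro mult_mono)
      have "(real n)\<^sup>2 \<le> (real n + 1)\<^sup>2" by (intro power_mono) auto
      then show "(real n)\<^sup>2 \<le> 21316 * lm ^ 6" using n2 sq by linarith
    qed (use CO l1 in auto)
    finally have "16 * (real (card F))\<^sup>2 \<le> 426320000 * (lm ^ 6 * card O')" by simp
    moreover have "0 \<le> lm ^ 6 * card O'" using l1 by simp
    ultimately have "(real (card F))\<^sup>2 \<le> 53290000 * (lm ^ 6 * card O')" by linarith
    then show ?thesis unfolding O'_def[symmetric] by (simp only: mult.assoc)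
  qed
  show thesis
    by (rule that[of U F]) (use U(1,3) FE key lm in \<open>auto simp: F_def[symmetric]\<close>)
qed

section \<open>Crossing bicliques\<close>

text \<open>Bernoulli's inequality says that the power lies above its tangent at the mean; summed
  over \<open>I\<close>, the linear parts of the tangent cancel.\<close>

lemma power_mean:
  fixes x :: "'a \<Rightarrow> real"
  assumes "finite I" "I \<noteq> {}" "\<And>i. i \<in> I \<Longrightarrow> x i \<ge> 0"
  shows "card I * (sum x I / card I) ^ s \<le> (\<Sum>i\<in>I. x i ^ s)"
proof -
  define a where "a = sum x I / card I"
  have cI: "card I > 0" using assms by (simp add: card_gt_0_iff)
  have a0: "a \<ge> 0" unfolding a_def using assms by (simp add: sum_nonneg)
  show ?thesis
  proof (cases "a = 0")
    case True
    then have "sum x I = 0" using cI by (simp add: a_def)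
    then have "x i = 0" if "i \<in> I" for i using assms that by (simp add: sum_nonneg_eq_0_iff)
    then have "(\<Sum>i\<in>I. x i ^ s) = (\<Sum>i\<in>I. 0 ^ s)" by (intro sum.cong) auto
    then show ?thesis using True unfolding a_def[symmetric] by simp
  next
    case False
    then have a: "a > 0" using a0 by simp
    have tangent: "a ^ s * (1 + s * (x i / a - 1)) \<le> x i ^ s" if "i \<in> I" for i
    proof -
      have "x i / a \<ge> 0" using a assms(3)[OF that] by simp
      then have "1 + s * (x i / a - 1) \<le> (1 + (x i / a - 1)) ^ s" by (intro Bernoulli_inequality) linarith
      then have "a ^ s * (1 + s * (x i / a - 1)) \<le> a ^ s * (x i / a) ^ s" using a by (intro mult_left_mono) auto
      also have "\<dots> = x i ^ s" using a by (simp add: power_divide)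
      finally show ?thesis .
    qed
    have "sum x I = a * card I" using cI by (simp add: a_def)
    moreover have "(\<Sum>i\<in>I. x i / a - 1) = sum x I / a - card I" by (simp add: sum_subtractf sum_divide_distrib)
    ultimately have "(\<Sum>i\<in>I. x i / a - 1) = 0" using a by simp
    then have "card I * a ^ s = (\<Sum>i\<in>I. a ^ s * (1 + s * (x i / a - 1)))"
      by (simp add: sum_distrib_left[symmetric] sum.distrib)
    also have "\<dots> \<le> (\<Sum>i\<in>I. x i ^ s)" by (rule sum_mono) (rule tangent)
    finally show ?thesis unfolding a_def .
  qed
qed

text \<open>The power mean is used twice: on the degrees, to count \<open>s\<close>-tuples with a
  common neighbour, and on the numbers of common neighbours of \<open>s\<close>-tuples. Tuples may
  repeat entries, which makes both counts exact sums of powers.\<close>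

lemma count_complete_bipartite:
  fixes R :: "'e \<Rightarrow> 'e \<Rightarrow> bool" and \<delta> :: real
  assumes X: "finite X" "X \<noteq> {}" and \<delta>: "\<delta> \<ge> 0"
    and dense: "\<delta> * (real (card X))\<^sup>2 \<le> card {(a, b). a \<in> X \<and> b \<in> X \<and> R a b}"
  shows "\<delta> ^ (s * s) * real (card X) ^ (2 * s) \<le>
     card {(\<alpha>, \<beta>). \<alpha> \<in> {..<s} \<rightarrow>\<^sub>E X \<and> \<beta> \<in> {..<s} \<rightarrow>\<^sub>E X \<and> (\<forall>i<s. \<forall>j<s. R (\<alpha> i) (\<beta> j))}"
proof -
  define m where "m = real (card X)"
  have m: "m > 0" using X by (simp add: m_def card_gt_0_iff)
  define P where "P = ({..<s} \<rightarrow>\<^sub>E X)"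
  have P: "finite P" "real (card P) = m ^ s" using X by (auto simp: P_def m_def finite_PiE card_PiE)
  have Pne: "P \<noteq> {}" using P(2) m by auto
  define N where "N \<alpha> = {b \<in> X. \<forall>i<s. R (\<alpha> i) b}" for \<alpha>
  have finN: "finite (N \<alpha>)" for \<alpha> using X by (simp add: N_def)
  define d where "d b = card {a \<in> X. R a b}" for b
  have "{(a, b). a \<in> X \<and> b \<in> X \<and> R a b} = (\<lambda>(b, a). (a, b)) ` Sigma X (\<lambda>b. {a \<in> X. R a b})" by auto
  moreover have "inj_on (\<lambda>(b, a). (a, b)) (Sigma X (\<lambda>b. {a \<in> X. R a b}))" by (auto simp: inj_on_def)
  ultimately have "card {(a, b). a \<in> X \<and> b \<in> X \<and> R a b} = (\<Sum>b\<in>X. d b)"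
    using X by (simp add: card_image d_def)
  then have sumd: "\<delta> * m\<^sup>2 \<le> (\<Sum>b\<in>X. real (d b))" using dense by (simp add: m_def)
  have "(\<Sum>\<alpha>\<in>P. card (N \<alpha>)) = (\<Sum>b\<in>X. d b ^ s)"
  proof -
    have "(\<Sum>\<alpha>\<in>P. card (N \<alpha>)) = (\<Sum>\<alpha>\<in>P. \<Sum>b\<in>X. of_bool (\<forall>i<s. R (\<alpha> i) b))"
      using X by (intro sum.cong refl) (simp add: N_def Int_def)
    also have "\<dots> = (\<Sum>b\<in>X. \<Sum>\<alpha>\<in>P. of_bool (\<forall>i<s. R (\<alpha> i) b))" by (rule sum.swap)
    also have "\<dots> = (\<Sum>b\<in>X. d b ^ s)"
    proof (rule sum.cong[OF refl])
      fix b
      have "(\<Sum>\<alpha>\<in>P. of_bool (\<forall>i<s. R (\<alpha> i) b)) = card (P \<inter> {\<alpha>. \<forall>i<s. R (\<alpha> i) b})" using P(1) by (simp only: sum_of_bool_eq of_nat_id)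
      also have "P \<inter> {\<alpha>. \<forall>i<s. R (\<alpha> i) b} = {\<alpha> \<in> P. \<forall>i<s. R (\<alpha> i) b}" by auto
      also have "{\<alpha> \<in> P. \<forall>i<s. R (\<alpha> i) b} = ({..<s} \<rightarrow>\<^sub>E {a \<in> X. R a b})"
        unfolding P_def set_eq_iff mem_Collect_eq PiE_iff lessThan_iff Ball_def by blast
      also have "card \<dots> = d b ^ s" by (simp add: card_PiE d_def)
      finally show "(\<Sum>\<alpha>\<in>P. of_bool (\<forall>i<s. R (\<alpha> i) b)) = d b ^ s" .
    qed
    finally show ?thesis .
  qed
  then have "(\<Sum>\<alpha>\<in>P. real (card (N \<alpha>))) = (\<Sum>b\<in>X. real (d b) ^ s)"
    by (simp only: of_nat_sum[symmetric] of_nat_power[symmetric])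
  also have "\<dots> \<ge> m * ((\<Sum>b\<in>X. real (d b)) / m) ^ s" unfolding m_def using X by (intro power_mean) auto
  finally have 1: "m * ((\<Sum>b\<in>X. real (d b)) / m) ^ s \<le> (\<Sum>\<alpha>\<in>P. real (card (N \<alpha>)))" .
  have "\<delta> * m \<le> (\<Sum>b\<in>X. real (d b)) / m" using sumd m by (simp add: field_simps power2_eq_square)
  then have "m * (\<delta> * m) ^ s \<le> m * ((\<Sum>b\<in>X. real (d b)) / m) ^ s" using m \<delta> by (intro mult_left_mono power_mono) auto
  then have 2: "m * (\<delta> * m) ^ s \<le> (\<Sum>\<alpha>\<in>P. real (card (N \<alpha>)))" using 1 by linarith
  have "\<delta> ^ s * m \<le> (\<Sum>\<alpha>\<in>P. real (card (N \<alpha>))) / card P"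
    using 2 m unfolding P(2) by (simp add: field_simps power_mult_distrib)
  then have "card P * (\<delta> ^ s * m) ^ s \<le> card P * ((\<Sum>\<alpha>\<in>P. real (card (N \<alpha>))) / card P) ^ s"
    using m \<delta> by (intro mult_left_mono power_mono) auto
  also have "\<dots> \<le> (\<Sum>\<alpha>\<in>P. real (card (N \<alpha>)) ^ s)" using P Pne by (intro power_mean) auto
  also have "\<dots> = real (\<Sum>\<alpha>\<in>P. card ({..<s} \<rightarrow>\<^sub>E N \<alpha>))" by (simp add: card_PiE)
  also have "(\<Sum>\<alpha>\<in>P. card ({..<s} \<rightarrow>\<^sub>E N \<alpha>)) = card (Sigma P (\<lambda>\<alpha>. {..<s} \<rightarrow>\<^sub>E N \<alpha>))"
    using P finN by (intro card_SigmaI[symmetric]) (auto intro: finite_PiE)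
  also have "Sigma P (\<lambda>\<alpha>. {..<s} \<rightarrow>\<^sub>E N \<alpha>) =
     {(\<alpha>, \<beta>). \<alpha> \<in> {..<s} \<rightarrow>\<^sub>E X \<and> \<beta> \<in> {..<s} \<rightarrow>\<^sub>E X \<and> (\<forall>i<s. \<forall>j<s. R (\<alpha> i) (\<beta> j))}"
    unfolding P_def N_def set_eq_iff mem_Sigma_iff split_paired_All mem_Collect_eq prod.case PiE_iff lessThan_iff Ball_def
    by blast
  finally have "card P * (\<delta> ^ s * m) ^ s \<le>
    card {(\<alpha>, \<beta>). \<alpha> \<in> {..<s} \<rightarrow>\<^sub>E X \<and> \<beta> \<in> {..<s} \<rightarrow>\<^sub>E X \<and> (\<forall>i<s. \<forall>j<s. R (\<alpha> i) (\<beta> j))}" .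
  moreover have "card P * (\<delta> ^ s * m) ^ s = \<delta> ^ (s * s) * m ^ (2 * s)"
    unfolding P(2) by (simp add: power_mult_distrib power_mult[symmetric] power_add[symmetric] mult_2)
  ultimately show ?thesis by (simp add: m_def)
qed

lemma card_le_fibres:
  assumes "finite S" "\<And>y. y \<in> f ` S \<Longrightarrow> card {x \<in> S. f x = y} \<le> K"
  shows "card S \<le> card (f ` S) * K"
proof -
  have "card S = (\<Sum>x\<in>S. 1)" by simp
  also have "\<dots> = (\<Sum>y\<in>f ` S. \<Sum>x\<in>{x \<in> S. f x = y}. 1)" by (rule sum.image_gen[OF assms(1)])
  also have "\<dots> \<le> (\<Sum>y\<in>f ` S. K)" using assms(2) by (intro sum_mono) simp
  finally show ?thesis by simp
qed

text \<open>Entry \<open>i\<close> of \<open>\<alpha>\<close> and entry \<open>j\<close> of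
  \<open>\<beta>\<close> are forgotten; \<open>K\<close> bounds the number of ways to restore
  them.\<close>

lemma tuple_pairs_fibre_bound:
  fixes X :: "'e set"
  assumes X: "finite X" and S: "S \<subseteq> ({..<s} \<rightarrow>\<^sub>E X) \<times> ({..<s} \<rightarrow>\<^sub>E X)" and ij: "i < s" "j < s"
    and K: "\<And>\<alpha> \<beta>. (\<alpha>, \<beta>) \<in> S \<Longrightarrow> card {(a, b). a \<in> X \<and> b \<in> X \<and> (\<alpha>(i := a), \<beta>(j := b)) \<in> S} \<le> K"
  shows "card S \<le> card X ^ (2 * (s - 1)) * K"
proof -
  define f where "f = (\<lambda>(\<alpha> :: nat \<Rightarrow> 'e, \<beta> :: nat \<Rightarrow> 'e). (restrict \<alpha> ({..<s} - {i}), restrict \<beta> ({..<s} - {j})))"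
  let ?Y = "(({..<s} - {i}) \<rightarrow>\<^sub>E X) \<times> (({..<s} - {j}) \<rightarrow>\<^sub>E X)"
  have finP: "finite ({..<s} \<rightarrow>\<^sub>E X)" using X by (intro finite_PiE) auto
  have finS: "finite S" using S finP by (meson finite_SigmaI finite_subset)
  have fY: "f ` S \<subseteq> ?Y"
  proof
    fix y assume "y \<in> f ` S"
    then obtain \<alpha> \<beta> where "(\<alpha>, \<beta>) \<in> S" "y = f (\<alpha>, \<beta>)" by auto
    moreover from this S have "\<alpha> \<in> {..<s} \<rightarrow>\<^sub>E X" "\<beta> \<in> {..<s} \<rightarrow>\<^sub>E X" by auto
    ultimately show "y \<in> ?Y" by (auto simp: f_def PiE_iff)
  qed
  have cY: "finite ?Y" "card ?Y = card X ^ (2 * (s - 1))"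
    using X ij by (auto simp: card_PiE card_cartesian_product finite_PiE power_add[symmetric] mult_2)
  have fib: "card {x \<in> S. f x = y} \<le> K" if "y \<in> f ` S" for y
  proof -
    obtain \<alpha>0 \<beta>0 where 0: "(\<alpha>0, \<beta>0) \<in> S" "y = f (\<alpha>0, \<beta>0)" using \<open>y \<in> f ` S\<close> by auto
    have ab0: "\<alpha>0 \<in> {..<s} \<rightarrow>\<^sub>E X" "\<beta>0 \<in> {..<s} \<rightarrow>\<^sub>E X" using S 0 by auto
    have agree: "\<alpha> = \<alpha>0(i := \<alpha> i) \<and> \<beta> = \<beta>0(j := \<beta> j) \<and> \<alpha> i \<in> X \<and> \<beta> j \<in> X"
      if x: "(\<alpha>, \<beta>) \<in> S" "f (\<alpha>, \<beta>) = y" for \<alpha> \<beta>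
    proof -
      have ab: "\<alpha> \<in> {..<s} \<rightarrow>\<^sub>E X" "\<beta> \<in> {..<s} \<rightarrow>\<^sub>E X" using S x by auto
      have r: "restrict \<alpha> ({..<s} - {i}) = restrict \<alpha>0 ({..<s} - {i})" "restrict \<beta> ({..<s} - {j}) = restrict \<beta>0 ({..<s} - {j})"
        using x(2) 0(2) by (auto simp: f_def)
      have 1: "\<alpha> k = (\<alpha>0(i := \<alpha> i)) k" for k
        using fun_cong[OF r(1), of k] PiE_arb[OF ab(1), of k] PiE_arb[OF ab0(1), of k]
        by (cases "k = i"; cases "k < s") auto
      have 2: "\<beta> k = (\<beta>0(j := \<beta> j)) k" for k
        using fun_cong[OF r(2), of k] PiE_arb[OF ab(2), of k] PiE_arb[OF ab0(2), of k]
        by (cases "k = j"; cases "k < s") auto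
      have 3: "\<alpha> i \<in> X" "\<beta> j \<in> X" using ab ij by (auto simp: PiE_iff)
      show ?thesis by (intro conjI ext 1 2 3)
    qed
    have "card {x \<in> S. f x = y} \<le> card {(a, b). a \<in> X \<and> b \<in> X \<and> (\<alpha>0(i := a), \<beta>0(j := b)) \<in> S}"
    proof (rule card_inj_on_le[of "\<lambda>(\<alpha>, \<beta>). (\<alpha> i, \<beta> j)"])
      show "inj_on (\<lambda>(\<alpha>, \<beta>). (\<alpha> i, \<beta> j)) {x \<in> S. f x = y}"
      proof (rule inj_onI, clarify)
        fix \<alpha> \<beta> \<alpha>' \<beta>' assume A: "(\<alpha>, \<beta>) \<in> S" "(\<alpha>', \<beta>') \<in> S" "y = f (\<alpha>, \<beta>)" "f (\<alpha>', \<beta>') = f (\<alpha>, \<beta>)"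
          "\<alpha> i = \<alpha>' i" "\<beta> j = \<beta>' j"
        have f: "f (\<alpha>', \<beta>') = y" using A(3,4) by simp
        note a1 = agree[OF A(1) A(3)[symmetric]] and a2 = agree[OF A(2) f]
        have "\<alpha> = \<alpha>0(i := \<alpha> i)" using a1 by (elim conjE)
        also have "\<dots> = \<alpha>0(i := \<alpha>' i)" unfolding A(5) ..
        also have "\<dots> = \<alpha>'" using a2 by (elim conjE) (rule sym)
        finally have "\<alpha> = \<alpha>'" .
        moreover have "\<beta> = \<beta>0(j := \<beta> j)" using a1 by (elim conjE)
        then have "\<beta> = \<beta>0(j := \<beta>' j)" unfolding A(6) .
        then have "\<beta> = \<beta>'" using a2 by (elim conjE) (rule trans, assumption, rule sym)
        ultimately show "\<alpha> = \<alpha>' \<and> \<beta> = \<beta>'" ..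
      qed
      show "(\<lambda>(\<alpha>, \<beta>). (\<alpha> i, \<beta> j)) ` {x \<in> S. f x = y} \<subseteq> {(a, b). a \<in> X \<and> b \<in> X \<and> (\<alpha>0(i := a), \<beta>0(j := b)) \<in> S}"
      proof clarify
        fix \<alpha> \<beta> assume A: "(\<alpha>, \<beta>) \<in> S" "y = f (\<alpha>, \<beta>)"
        note ag = agree[OF A(1) A(2)[symmetric]]
        have "(\<alpha>0(i := \<alpha> i), \<beta>0(j := \<beta> j)) = (\<alpha>, \<beta>)"
          by (simp only: ag[THEN conjunct1, symmetric] ag[THEN conjunct2, THEN conjunct1, symmetric])
        then have "(\<alpha>0(i := \<alpha> i), \<beta>0(j := \<beta> j)) \<in> S" using A(1) by (simp only:)
        moreover have "\<alpha> i \<in> X" by (rule ag[THEN conjunct2, THEN conjunct2, THEN conjunct1])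
        moreover have "\<beta> j \<in> X" by (rule ag[THEN conjunct2, THEN conjunct2, THEN conjunct2])
        ultimately show "\<alpha> i \<in> X \<and> \<beta> j \<in> X \<and> (\<alpha>0(i := \<alpha> i), \<beta>0(j := \<beta> j)) \<in> S" by (intro conjI)
      qed
      show "finite {(a, b). a \<in> X \<and> b \<in> X \<and> (\<alpha>0(i := a), \<beta>0(j := b)) \<in> S}"
        by (rule finite_subset[of _ "X \<times> X"]) (use X in auto)
    qed
    also have "\<dots> \<le> K" by (rule K[OF 0(1)])
    finally show ?thesis .
  qed
  have "card S \<le> card (f ` S) * K" by (rule card_le_fibres[OF finS fib])
  also have "\<dots> \<le> card ?Y * K" using card_mono[OF cY(1) fY] by simp
  finally show ?thesis using cY(2) by simp
qed

lemma pigeonhole_fibre: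
  assumes "finite A" "finite B" "f ` A \<subseteq> B" "card B * k \<le> card A" "A \<noteq> {}"
  obtains b where "b \<in> B" "k \<le> card {x \<in> A. f x = b}"
proof -
  have "\<exists>b\<in>B. k \<le> card {x \<in> A. f x = b}"
  proof (rule ccontr)
    assume "\<not> ?thesis"
    then have lt: "card {x \<in> A. f x = b} < k" if "b \<in> B" for b using that by force
    have "card A = (\<Sum>x\<in>A. 1)" by simp
    also have "\<dots> = (\<Sum>b\<in>B. \<Sum>x\<in>{x \<in> A. f x = b}. 1)" using assms by (intro sum.group[symmetric]) auto
    also have "\<dots> = (\<Sum>b\<in>B. card {x \<in> A. f x = b})" by simp
    also have "\<dots> < (\<Sum>b\<in>B. k)" using assms lt by (intro sum_strict_mono) auto
    finally show False using assms(4) by simp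
  qed
  then show ?thesis using that by blast
qed

lemma increasing_enumeration:
  fixes f :: "'a \<Rightarrow> real"
  assumes "finite J" "inj_on f J"
  obtains p where "bij_betw p {..<card J} J" "\<And>k l. k < l \<Longrightarrow> l < card J \<Longrightarrow> f (p k) < f (p l)"
proof -
  define L where "L = sorted_list_of_set (f ` J)"
  have L: "set L = f ` J" "sorted_wrt (<) L" "distinct L" "length L = card J"
    using assms by (auto simp: L_def card_image strict_sorted_list_of_set)
  have fp: "f (the_inv_into J f (L ! k)) = L ! k" "the_inv_into J f (L ! k) \<in> J" if "k < card J" for k
  proof -
    have "L ! k \<in> f ` J" using L that by (metis nth_mem)
    then show "f (the_inv_into J f (L ! k)) = L ! k" "the_inv_into J f (L ! k) \<in> J"
      using assms(2) by (auto simp: f_the_inv_into_f intro: the_inv_into_into)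
  qed
  show ?thesis
  proof (rule that[of "\<lambda>k. the_inv_into J f (L ! k)"])
    show less: "f (the_inv_into J f (L ! k)) < f (the_inv_into J f (L ! l))" if "k < l" "l < card J" for k l
      using fp(1)[of k] fp(1)[of l] that L(2,4) by (simp add: sorted_wrt_nth_less)
    have inj: "inj_on (\<lambda>k. the_inv_into J f (L ! k)) {..<card J}"
    proof (rule inj_onI)
      fix k l assume kl: "k \<in> {..<card J}" "l \<in> {..<card J}" "the_inv_into J f (L ! k) = the_inv_into J f (L ! l)"
      then show "k = l" using less[of k l] less[of l k] by (cases k l rule: linorder_cases) auto
    qed
    have "(\<lambda>k. the_inv_into J f (L ! k)) ` {..<card J} \<subseteq> J" using fp(2) by auto
    moreover have "card ((\<lambda>k. the_inv_into J f (L ! k)) ` {..<card J}) = card J" using card_image[OF inj] by simp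
    ultimately have "(\<lambda>k. the_inv_into J f (L ! k)) ` {..<card J} = J" using assms(1) by (simp add: card_subset_eq)
    then show "bij_betw (\<lambda>k. the_inv_into J f (L ! k)) {..<card J} J" using inj by (simp add: bij_betw_def)
  qed
qed

section \<open>Quadrilateral patterns in grids of crossing arcs\<close>

context pseudo_segments
begin

text \<open>The two conditions on betweenness put the crossing of the chords on their pieces between
  the sides; this is what forces both pieces to the same side of the frame.\<close>

definition pattern :: "'e \<Rightarrow> 'e \<Rightarrow> 'e \<Rightarrow> 'e \<Rightarrow> 'e \<Rightarrow> 'e \<Rightarrow> bool" where
  "pattern g h u v a b \<longleftrightarrow> quad g h u v \<and> chord g h u v a \<and> chord u v g h b \<and> cr a b \<and>
     btw (tm a g) (tm a b) (tm a h) \<and> btw (tm b u) (tm b a) (tm b v)"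

lemma pc_disjoint:
  assumes "cr e f" "cr e g" "cr e' f'" "cr e' g'" "e \<noteq> e'"
    and "\<not> (cr e e' \<and> tm e e' \<in> closed_segment (tm e f) (tm e g))"
  shows "pc e f g \<inter> pc e' f' g' = {}"
proof (rule ccontr)
  assume "\<not> ?thesis"
  then obtain z where z: "z \<in> pc e f g" "z \<in> pc e' f' g'" by blast
  obtain x where x: "x \<in> closed_segment (tm e f) (tm e g)" "z = \<gamma> e x" using z(1) by (auto simp: pc_def)
  obtain y where y: "y \<in> closed_segment (tm e' f') (tm e' g')" "z = \<gamma> e' y" using z(2) by (auto simp: pc_def)
  have xy: "x \<in> {0<..<1}" "y \<in> {0<..<1}" using seg01[OF assms(1,2)] seg01[OF assms(3,4)] x y by auto
  have X: "e \<in> X" "e' \<in> X" using crD assms by blast+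
  have c: "cr e e'" unfolding cr_def using X assms(5) xy x(2) y(2) by metis
  have "z = \<gamma> e (tm e e')"
    using tm_unique[OF c] z pc_subset[OF assms(1,2)] pc_subset[OF assms(3,4)] by blast
  then have "\<gamma> e (tm e e') \<in> pc e f g" using z(1) by simp
  then show False using pc_imageD[OF assms(1,2) c] assms(6) c by blast
qed

text \<open>An arc meets another arc of its group of three at one parameter, and its 13 parameter
  intervals are disjoint. So each of the \<open>13 * 6\<close> ordered pairs within groups spoils at
  most one block.\<close>

lemma block_has_few_hits:
  fixes t :: "nat \<Rightarrow> nat \<Rightarrow> real" and x :: "nat \<Rightarrow> nat \<Rightarrow> real"
  assumes "\<And>k l l'. k < 39 \<Longrightarrow> l < l' \<Longrightarrow> l' < 39 \<Longrightarrow> t k l < t k l'"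
  shows "card {(K, L). K < 13 \<and> L < 13 \<and> (\<exists>p<3. \<exists>q<3. p \<noteq> q \<and> x (3*K+p) (3*K+q) \<in> {t (3*K+p) (3*L)..t (3*K+p) (3*L+2)})} \<le> 78"
    (is "card ?B \<le> 78")
proof -
  define PQ where "PQ = {(p, q). p < (3::nat) \<and> q < (3::nat) \<and> p \<noteq> q}"
  have "PQ = {..<3} \<times> {..<3} - (\<lambda>p. (p, p)) ` {..<3}" by (auto simp: PQ_def)
  moreover have "card ((\<lambda>p. (p, p)) ` {..<3::nat}) = 3" by (simp add: card_image inj_on_def)
  moreover have "(\<lambda>p. (p, p)) ` {..<3} \<subseteq> {..<3::nat} \<times> {..<3::nat}" by auto
  ultimately have PQ: "finite PQ" "card PQ = 6" by (simp_all add: card_Diff_subset card_cartesian_product)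
  define H where "H K p q = {L. L < 13 \<and> x (3*K+p) (3*K+q) \<in> {t (3*K+p) (3*L)..t (3*K+p) (3*L+2)}}" for K p q
  have H1: "card (H K p q) \<le> 1" if "K < 13" "p < 3" for K p q
  proof -
    have "L = L'" if "L \<in> H K p q" "L' \<in> H K p q" for L L'
    proof (rule ccontr)
      assume "L \<noteq> L'"
      moreover have no: False if "L < L'" "L \<in> H K p q" "L' \<in> H K p q" for L L'
      proof -
        have "t (3*K+p) (3*L+2) < t (3*K+p) (3*L')"
          using that \<open>K < 13\<close> \<open>p < 3\<close> by (intro assms) (auto simp: H_def)
        then show False using that by (auto simp: H_def)
      qed
      ultimately show False using that by (metis linorder_less_linear)
    qed
    moreover have "finite (H K p q)" by (simp add: H_def)
    ultimately show ?thesis by (simp add: card_le_Suc0_iff_eq)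
  qed
  have "?B \<subseteq> (\<Union>(K, pq)\<in>{..<13::nat} \<times> PQ. Pair K ` H K (fst pq) (snd pq))"
  proof clarify
    fix K L p q assume A: "K < 13" "L < 13" "p < 3" "q < 3" "p \<noteq> q" "x (3*K+p) (3*K+q) \<in> {t (3*K+p) (3*L)..t (3*K+p) (3*L+2)}"
    then have "(K, (p, q)) \<in> {..<13} \<times> PQ" "L \<in> H K p q" by (auto simp: PQ_def H_def)
    then show "(K, L) \<in> (\<Union>(K, pq)\<in>{..<13::nat} \<times> PQ. Pair K ` H K (fst pq) (snd pq))" by force
  qed
  then have "card ?B \<le> card (\<Union>(K, pq)\<in>{..<13::nat} \<times> PQ. Pair K ` H K (fst pq) (snd pq))"
    using PQ(1) by (intro card_mono) (auto simp: H_def)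
  also have "\<dots> \<le> (\<Sum>(K, pq)\<in>{..<13::nat} \<times> PQ. card (Pair K ` H K (fst pq) (snd pq)))"
    unfolding case_prod_beta using PQ(1) by (intro card_UN_le) auto
  also have "\<dots> \<le> (\<Sum>(K, pq)\<in>{..<13::nat} \<times> PQ. 1)"
  proof (rule sum_mono)
    fix z assume "z \<in> {..<13::nat} \<times> PQ"
    then obtain K p q where z: "z = (K, (p, q))" "K < 13" "(p, q) \<in> PQ" by auto
    have "card (H K p q) \<le> 1" using z by (intro H1) (auto simp: PQ_def)
    then show "(case z of (K, pq) \<Rightarrow> card (Pair K ` H K (fst pq) (snd pq))) \<le> (case z of (K, pq) \<Rightarrow> 1)"
      using card_image_le[of "H K p q" "Pair K"] by (simp add: z(1) H_def)
  qed
  also have "\<dots> = 78" using PQ by (simp add: card_cartesian_product)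
  finally show ?thesis .
qed

text \<open>39 is \<open>3 * 13\<close>: there are 169 blocks of three by three arcs. Crossings
  within the first family spoil at most 78 of them, crossings within the second another 78. In a
  block that is left, the pieces of each family are disjoint; the outer arcs bound a quadrilateral
  and the middle ones are its crossing chords.\<close>

lemma pattern_in_monotone_grid:
  fixes a b :: "nat \<Rightarrow> 'e"
  assumes cr: "\<And>k l. k < 39 \<Longrightarrow> l < 39 \<Longrightarrow> cr (a k) (b l)"
    and ta: "\<And>k l l'. k < 39 \<Longrightarrow> l < l' \<Longrightarrow> l' < 39 \<Longrightarrow> tm (a k) (b l) < tm (a k) (b l')"
    and tb: "\<And>k k' l. l < 39 \<Longrightarrow> k < k' \<Longrightarrow> k' < 39 \<Longrightarrow> tm (b l) (a k) < tm (b l) (a k')"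
  obtains K L where "K < 13" "L < 13" "pattern (b (3*L)) (b (3*L+2)) (a (3*K)) (a (3*K+2)) (a (3*K+1)) (b (3*L+1))"
proof -
  define B1 where "B1 = {(K, L). K < 13 \<and> L < 13 \<and> (\<exists>p<3. \<exists>q<3. p \<noteq> q \<and> tm (a (3*K+p)) (a (3*K+q)) \<in> {tm (a (3*K+p)) (b (3*L))..tm (a (3*K+p)) (b (3*L+2))})}"
  define B2 where "B2 = {(L, K). L < 13 \<and> K < 13 \<and> (\<exists>p<3. \<exists>q<3. p \<noteq> q \<and> tm (b (3*L+p)) (b (3*L+q)) \<in> {tm (b (3*L+p)) (a (3*K))..tm (b (3*L+p)) (a (3*K+2))})}"
  have c1: "card B1 \<le> 78" unfolding B1_def
    by (rule block_has_few_hits[of "\<lambda>k l. tm (a k) (b l)" "\<lambda>k k'. tm (a k) (a k')"]) (rule ta)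
  have c2: "card B2 \<le> 78" unfolding B2_def
    by (rule block_has_few_hits[of "\<lambda>l k. tm (b l) (a k)" "\<lambda>l l'. tm (b l) (b l')"]) (rule tb)
  have fin: "finite B1" "finite B2"
    by (rule finite_subset[of _ "{..<13} \<times> {..<13}"]; auto simp: B1_def B2_def)+
  have "card (B1 \<union> prod.swap ` B2) \<le> card B1 + card (prod.swap ` B2)" by (rule card_Un_le)
  also have "\<dots> \<le> 78 + 78" using c1 c2 card_image_le[OF fin(2), of prod.swap] by linarith
  finally have "card (B1 \<union> prod.swap ` B2) < card ({..<13::nat} \<times> {..<13::nat})" by (simp add: card_cartesian_product)
  then have "\<not> {..<13::nat} \<times> {..<13::nat} \<subseteq> B1 \<union> prod.swap ` B2" using fin card_mono[of "B1 \<union> prod.swap ` B2"]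
    by (metis finite_Un finite_imageI leD)
  then obtain x where x: "x \<in> {..<13::nat} \<times> {..<13::nat}" "x \<notin> B1 \<union> prod.swap ` B2" by blast
  obtain K L where xKL: "x = (K, L)" by (cases x)
  have KL: "K < 13" "L < 13" "(K, L) \<notin> B1" "(K, L) \<notin> prod.swap ` B2" using x unfolding xKL by blast+
  have n2: "(L, K) \<notin> B2" using KL(4) by (metis image_eqI swap_simp)
  have good1: "tm (a (3*K+p)) (a (3*K+q)) \<notin> {tm (a (3*K+p)) (b (3*L))..tm (a (3*K+p)) (b (3*L+2))}" if "p < 3" "q < 3" "p \<noteq> q" for p q
    using KL that unfolding B1_def by blast
  have good2: "tm (b (3*L+p)) (b (3*L+q)) \<notin> {tm (b (3*L+p)) (a (3*K))..tm (b (3*L+p)) (a (3*K+2))}" if "p < 3" "q < 3" "p \<noteq> q" for p q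
    using KL n2 that unfolding B2_def by blast
  define a' where "a' p = a (3*K+p)" for p
  define b' where "b' p = b (3*L+p)" for p
  have cr': "cr (a' p) (b' q)" "cr (b' q) (a' p)" if "p < 3" "q < 3" for p q
    using cr[of "3*K+p" "3*L+q"] cr_sym that KL by (auto simp: a'_def b'_def)
  have ta': "tm (a' p) (b' 0) < tm (a' p) (b' 1)" "tm (a' p) (b' 1) < tm (a' p) (b' 2)" if "p < 3" for p
    using that KL unfolding a'_def b'_def by (intro ta; simp)+
  have tb': "tm (b' p) (a' 0) < tm (b' p) (a' 1)" "tm (b' p) (a' 1) < tm (b' p) (a' 2)" if "p < 3" for p
    using that KL unfolding a'_def b'_def by (intro tb; simp)+
  have ane: "a' p \<noteq> a' q" if "p < 3" "q < 3" "p \<noteq> q" for p q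
  proof -
    have "tm (b' 0) (a' 0) < tm (b' 0) (a' 1)" "tm (b' 0) (a' 1) < tm (b' 0) (a' 2)" using tb'[of 0] by auto
    moreover have "p = 0 \<or> p = 1 \<or> p = 2" "q = 0 \<or> q = 1 \<or> q = 2" using that by auto
    ultimately show ?thesis using that(3) by auto
  qed
  have bne: "b' p \<noteq> b' q" if "p < 3" "q < 3" "p \<noteq> q" for p q
  proof -
    have "tm (a' 0) (b' 0) < tm (a' 0) (b' 1)" "tm (a' 0) (b' 1) < tm (a' 0) (b' 2)" using ta'[of 0] by auto
    moreover have "p = 0 \<or> p = 1 \<or> p = 2" "q = 0 \<or> q = 1 \<or> q = 2" using that by auto
    ultimately show ?thesis using that(3) by auto
  qed
  have da: "pc (a' p) (b' 0) (b' 2) \<inter> pc (a' q) (b' 0) (b' 2) = {}" if "p < 3" "q < 3" "p \<noteq> q" for p q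
  proof (rule pc_disjoint)
    have "closed_segment (tm (a' p) (b' 0)) (tm (a' p) (b' 2)) = {tm (a' p) (b' 0)..tm (a' p) (b' 2)}"
      using ta'[OF that(1)] by (simp add: closed_segment_eq_real_ivl)
    then show "\<not> (cr (a' p) (a' q) \<and> tm (a' p) (a' q) \<in> closed_segment (tm (a' p) (b' 0)) (tm (a' p) (b' 2)))"
      using good1[OF that] by (simp add: a'_def b'_def)
  qed (use cr' ane that in auto)
  have db: "pc (b' p) (a' 0) (a' 2) \<inter> pc (b' q) (a' 0) (a' 2) = {}" if "p < 3" "q < 3" "p \<noteq> q" for p q
  proof (rule pc_disjoint)
    have "closed_segment (tm (b' p) (a' 0)) (tm (b' p) (a' 2)) = {tm (b' p) (a' 0)..tm (b' p) (a' 2)}"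
      using tb'[OF that(1)] by (simp add: closed_segment_eq_real_ivl)
    then show "\<not> (cr (b' p) (b' q) \<and> tm (b' p) (b' q) \<in> closed_segment (tm (b' p) (a' 0)) (tm (b' p) (a' 2)))"
      using good2[OF that] by (simp add: a'_def b'_def)
  qed (use cr' bne that in auto)
  have "pattern (b' 0) (b' 2) (a' 0) (a' 2) (a' 1) (b' 1)"
    unfolding pattern_def quad_def chord_def btw_def using cr' ta' tb' da db by auto
  then show thesis using that[of K L] KL by (simp add: a'_def b'_def)
qed

end

text \<open>On \<open>m\<close> arcs there are at most \<open>2 ^ (m * m)\<close> order relations.
  Among \<open>ramsey2\<close> arcs of the first family, 39 therefore meet \<open>ramsey1\<close>
  given arcs of the second in the same order; of the latter, 39 meet those 39 in the same
  order.\<close>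

definition ramsey1 :: nat where "ramsey1 = 2 ^ (39 * 39) * 39"
definition ramsey2 :: nat where "ramsey2 = 2 ^ (ramsey1 * ramsey1) * 39"

context pseudo_segments
begin

text \<open>Pigeonhole on the set of pairs from \<open>J\<close> that are in increasing order along
  \<open>i\<close>.\<close>

lemma same_order_subset:
  fixes f :: "nat \<Rightarrow> nat \<Rightarrow> real"
  assumes A: "finite A" "2 ^ (card J * card J) * 39 \<le> card A" and J: "finite J"
  obtains A' where "A' \<subseteq> A" "card A' = 39"
    "\<And>i i' j j'. i \<in> A' \<Longrightarrow> i' \<in> A' \<Longrightarrow> j \<in> J \<Longrightarrow> j' \<in> J \<Longrightarrow> f i j < f i j' \<longleftrightarrow> f i' j < f i' j'"
proof -
  define h where "h i = {(j, j'). j \<in> J \<and> j' \<in> J \<and> f i j < f i j'}" for i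
  have cP: "card (Pow (J \<times> J)) = 2 ^ (card J * card J)" using J by (simp add: card_Pow card_cartesian_product)
  have sub: "h ` A \<subseteq> Pow (J \<times> J)" by (auto simp: h_def)
  have c: "card (Pow (J \<times> J)) * 39 \<le> card A" using A(2) unfolding cP .
  have Ane: "A \<noteq> {}"
  proof
    assume "A = {}"
    then have "(2::nat) ^ (card J * card J) * 39 \<le> 0" using A(2) by simp
    then show False by simp
  qed
  have fP: "finite (Pow (J \<times> J))" using J by simp
  obtain B where B39: "39 \<le> card {x \<in> A. h x = B}" by (rule pigeonhole_fibre[OF A(1) fP sub c Ane]) blast
  obtain A' where A': "A' \<subseteq> {x \<in> A. h x = B}" "card A' = 39" by (rule obtain_subset_with_card_n[OF B39])
  show thesis
  proof (rule that[of A'])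
    fix i i' j j' assume I: "i \<in> A'" "i' \<in> A'" "j \<in> J" "j' \<in> J"
    then have "h i = h i'" using A' by auto
    then have "(j, j') \<in> h i \<longleftrightarrow> (j, j') \<in> h i'" by simp
    then show "f i j < f i j' \<longleftrightarrow> f i' j < f i' j'" using I by (simp add: h_def)
  qed (use A' in auto)
qed

text \<open>Once all arcs of a family meet the other family in one common order, renumbering by that
  order makes the grid monotone. The distinctness of the parameters makes the order strict.\<close>

lemma pattern_in_grid:
  assumes cr: "\<And>i j. i < ramsey2 \<Longrightarrow> j < ramsey2 \<Longrightarrow> cr (\<alpha> i) (\<beta> j)"
    and ta: "\<And>i j j'. i < ramsey2 \<Longrightarrow> j < ramsey2 \<Longrightarrow> j' < ramsey2 \<Longrightarrow> j \<noteq> j' \<Longrightarrow> tm (\<alpha> i) (\<beta> j) \<noteq> tm (\<alpha> i) (\<beta> j')"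
    and tb: "\<And>i i' j. i < ramsey2 \<Longrightarrow> i' < ramsey2 \<Longrightarrow> j < ramsey2 \<Longrightarrow> i \<noteq> i' \<Longrightarrow> tm (\<beta> j) (\<alpha> i) \<noteq> tm (\<beta> j) (\<alpha> i')"
  obtains i1 i2 i3 j1 j2 j3 where "i1 < ramsey2" "i2 < ramsey2" "i3 < ramsey2" "j1 < ramsey2" "j2 < ramsey2" "j3 < ramsey2"
    "distinct [i1, i2, i3]" "distinct [j1, j2, j3]" "pattern (\<beta> j1) (\<beta> j3) (\<alpha> i1) (\<alpha> i3) (\<alpha> i2) (\<beta> j2)"
proof -
  have r12: "ramsey1 \<le> ramsey2"
  proof -
    have "ramsey1 \<le> ramsey1 * ramsey1" by simp
    also have "\<dots> \<le> 2 ^ (ramsey1 * ramsey1)" by (rule less_imp_le[OF less_exp])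
    also have "\<dots> \<le> 2 ^ (ramsey1 * ramsey1) * 39" by simp
    finally show ?thesis unfolding ramsey2_def .
  qed
  have c1: "2 ^ (card {..<ramsey1} * card {..<ramsey1}) * 39 \<le> card {..<ramsey2}"
    by (simp only: card_lessThan ramsey2_def order_refl)
  obtain I where I: "I \<subseteq> {..<ramsey2}" "card I = 39"
    "\<And>i i' j j'. i \<in> I \<Longrightarrow> i' \<in> I \<Longrightarrow> j \<in> {..<ramsey1} \<Longrightarrow> j' \<in> {..<ramsey1} \<Longrightarrow> tm (\<alpha> i) (\<beta> j) < tm (\<alpha> i) (\<beta> j') \<longleftrightarrow> tm (\<alpha> i') (\<beta> j) < tm (\<alpha> i') (\<beta> j')"
    by (rule same_order_subset[OF finite_lessThan c1 finite_lessThan, of "\<lambda>i j. tm (\<alpha> i) (\<beta> j)"]) blast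
  have finI: "finite I" using I(1) finite_subset by blast
  have c2: "2 ^ (card I * card I) * 39 \<le> card {..<ramsey1}"
    by (simp only: card_lessThan ramsey1_def I(2) order_refl)
  obtain J where J: "J \<subseteq> {..<ramsey1}" "card J = 39"
    "\<And>j j' i i'. j \<in> J \<Longrightarrow> j' \<in> J \<Longrightarrow> i \<in> I \<Longrightarrow> i' \<in> I \<Longrightarrow> tm (\<beta> j) (\<alpha> i) < tm (\<beta> j) (\<alpha> i') \<longleftrightarrow> tm (\<beta> j') (\<alpha> i) < tm (\<beta> j') (\<alpha> i')"
    by (rule same_order_subset[OF finite_lessThan c2 finI, of "\<lambda>j i. tm (\<beta> j) (\<alpha> i)"]) blast
  have finJ: "finite J" using J(1) finite_subset by blast
  obtain i0 j0 where ij0: "i0 \<in> I" "j0 \<in> J" using I(2) J(2) by fastforce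
  have Ilt: "i < ramsey2" if "i \<in> I" for i using I(1) that by auto
  have Jlt: "j < ramsey2" "j \<in> {..<ramsey1}" if "j \<in> J" for j using J(1) that r12 by auto
  have injJ: "inj_on (\<lambda>j. tm (\<alpha> i0) (\<beta> j)) J"
  proof (rule inj_onI, rule ccontr)
    fix j j' assume j: "j \<in> J" "j' \<in> J" "tm (\<alpha> i0) (\<beta> j) = tm (\<alpha> i0) (\<beta> j')" "j \<noteq> j'"
    have "tm (\<alpha> i0) (\<beta> j) \<noteq> tm (\<alpha> i0) (\<beta> j')" by (rule ta[OF Ilt[OF ij0(1)] Jlt(1)[OF j(1)] Jlt(1)[OF j(2)] j(4)])
    then show False using j(3) by simp
  qed
  obtain p where p: "bij_betw p {..<39::nat} J" "\<And>k l. k < l \<Longrightarrow> l < 39 \<Longrightarrow> tm (\<alpha> i0) (\<beta> (p k)) < tm (\<alpha> i0) (\<beta> (p l))"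
    by (rule increasing_enumeration[OF finJ injJ, unfolded J(2)]) blast
  have injI: "inj_on (\<lambda>i. tm (\<beta> j0) (\<alpha> i)) I"
  proof (rule inj_onI, rule ccontr)
    fix i i' assume i: "i \<in> I" "i' \<in> I" "tm (\<beta> j0) (\<alpha> i) = tm (\<beta> j0) (\<alpha> i')" "i \<noteq> i'"
    have "tm (\<beta> j0) (\<alpha> i) \<noteq> tm (\<beta> j0) (\<alpha> i')" by (rule tb[OF Ilt[OF i(1)] Ilt[OF i(2)] Jlt(1)[OF ij0(2)] i(4)])
    then show False using i(3) by simp
  qed
  obtain q where q: "bij_betw q {..<39::nat} I" "\<And>k l. k < l \<Longrightarrow> l < 39 \<Longrightarrow> tm (\<beta> j0) (\<alpha> (q k)) < tm (\<beta> j0) (\<alpha> (q l))"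
    by (rule increasing_enumeration[OF finI injI, unfolded I(2)]) blast
  have pJ: "p k \<in> J" if "k < 39" for k using p(1) that by (auto simp: bij_betw_def)
  have qI: "q k \<in> I" if "k < 39" for k using q(1) that by (auto simp: bij_betw_def)
  obtain K L where KL: "K < 13" "L < 13"
    "pattern (\<beta> (p (3*L))) (\<beta> (p (3*L+2))) (\<alpha> (q (3*K))) (\<alpha> (q (3*K+2))) (\<alpha> (q (3*K+1))) (\<beta> (p (3*L+1)))"
  proof (rule pattern_in_monotone_grid[of "\<lambda>k. \<alpha> (q k)" "\<lambda>l. \<beta> (p l)"])
    fix k l assume "k < (39::nat)" "l < (39::nat)"
    then show "cr (\<alpha> (q k)) (\<beta> (p l))" by (intro cr Ilt qI Jlt(1) pJ)
  next
    fix k l l' assume A: "k < (39::nat)" "l < l'" "l' < (39::nat)"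
    have "p l \<in> J" "p l' \<in> J" "q k \<in> I" using A pJ qI by auto
    then show "tm (\<alpha> (q k)) (\<beta> (p l)) < tm (\<alpha> (q k)) (\<beta> (p l'))"
      using p(2)[OF A(2,3)] I(3)[of "q k" i0 "p l" "p l'"] ij0 Jlt by blast
  next
    fix k k' l assume A: "l < (39::nat)" "k < k'" "k' < (39::nat)"
    have "p l \<in> J" "q k \<in> I" "q k' \<in> I" using A pJ qI by auto
    then show "tm (\<beta> (p l)) (\<alpha> (q k)) < tm (\<beta> (p l)) (\<alpha> (q k'))"
      using q(2)[OF A(2,3)] J(3)[of "p l" j0 "q k" "q k'"] ij0 by blast
  qed
  have injp: "p k \<noteq> p l" if "k < l" "l < 39" for k l using p(2)[OF that] by auto
  have injq: "q k \<noteq> q l" if "k < l" "l < 39" for k l using q(2)[OF that] by auto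
  show thesis
    by (rule that[of "q (3*K)" "q (3*K+1)" "q (3*K+2)" "p (3*L)" "p (3*L+1)" "p (3*L+2)"])
       (use KL qI pJ Ilt Jlt injp[of "3*L" "3*L+1"] injp[of "3*L" "3*L+2"] injp[of "3*L+1" "3*L+2"]
         injq[of "3*K" "3*K+1"] injq[of "3*K" "3*K+2"] injq[of "3*K+1" "3*K+2"] in auto)
qed

end

lemma ramsey2_pos: "ramsey2 \<ge> 1"
proof -
  have "0 < (2::nat) ^ (ramsey1 * ramsey1)" by (rule zero_less_power) simp
  then have "0 < (2::nat) ^ (ramsey1 * ramsey1) * 39" by (rule mult_pos_pos) simp
  then show ?thesis unfolding ramsey2_def by (simp only: One_nat_def Suc_le_eq)
qed

context pseudo_segments
begin

text \<open>Arcs that cross \<open>a\<close> at one point meet each other there, so a bundle of them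
  is pairwise crossing.\<close>

lemma concurrent_cross:
  assumes "cr a b" "cr a b'" "tm a b = tm a b'" "b \<noteq> b'"
  shows "cr b b'"
proof -
  have "\<gamma> b (tm b a) = \<gamma> b' (tm b' a)" using tm_sym[OF assms(1)] tm_sym[OF assms(2)] assms(3) by simp
  moreover have "tm b a \<in> {0<..<1}" "tm b' a \<in> {0<..<1}" using tm cr_sym assms by auto
  ultimately show ?thesis unfolding cr_def using crD[OF assms(1)] crD[OF assms(2)] assms(4) by blast
qed

text \<open>Either many arcs cross some arc at a single point, and one half of this bundle against
  the other half is a biclique, or coincidences are so rare that most pairs of crossing
  \<open>s\<close>-tuples have strict orders. Each of these contains a pattern, so by averaging some
  four arcs bound a quadrilateral with very many pairs of crossing chords.\<close>

lemma dense_crossing_biclique: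
  fixes \<delta> :: real
  assumes \<delta>: "0 < \<delta>" "\<delta> \<le> 1" and Xne: "X \<noteq> {}"
    and dense: "\<delta> * (real (card X))\<^sup>2 \<le> card {(a, b). cr a b}"
  obtains A B where "A \<subseteq> X" "B \<subseteq> X" "\<And>a b. a \<in> A \<Longrightarrow> b \<in> B \<Longrightarrow> cr a b"
    "\<delta> ^ (ramsey2 * ramsey2) * card X \<le> 12 * real ramsey2 ^ 6 * card A"
    "\<delta> ^ (ramsey2 * ramsey2) * card X \<le> 12 * real ramsey2 ^ 6 * card B"
proof -
  define s where "s = ramsey2"
  define m where "m = real (card X)"
  define \<eta> where "\<eta> = \<delta> ^ (s * s)"
  \<comment> \<open>Two kinds of coincidence, each with at most \<open>s^3\<close> index triples,
    may together spoil half of the \<open>\<eta> * m ^ (2 * s)\<close> grids, which leaves a share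
    of \<open>1 / (4 * s^3)\<close> to each triple.\<close>
  define \<theta> where "\<theta> = \<eta> / (4 * real s ^ 3)"
  have s1: "real s \<ge> 1" using ramsey2_pos by (simp add: s_def)
  have s36: "real s ^ 3 \<le> real s ^ 6" "1 \<le> real s ^ 3" "1 \<le> real s ^ 6"
    using s1 by (auto intro: power_increasing one_le_power)
  have s3pos: "real s ^ 3 > 0" "real s \<noteq> 0" using s1 by auto
  have m0: "m > 0" using Xne finite_X by (simp add: m_def card_gt_0_iff)
  have \<eta>: "0 < \<eta>" "\<eta> \<le> 1" using \<delta> by (auto simp: \<eta>_def power_le_one)
  have \<theta>0: "\<theta> > 0" using \<eta> s36(2) unfolding \<theta>_def by (intro divide_pos_pos mult_pos_pos) linarith+
  have finish: thesis if "A \<subseteq> X" "B \<subseteq> X" "\<And>a b. a \<in> A \<Longrightarrow> b \<in> B \<Longrightarrow> cr a b"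
    "\<eta> * m \<le> 12 * real s ^ 6 * card A" "\<eta> * m \<le> 12 * real s ^ 6 * card B" for A B
    using \<open>\<And>A B. \<lbrakk>A \<subseteq> X; B \<subseteq> X; \<And>a b. \<lbrakk>a \<in> A; b \<in> B\<rbrakk> \<Longrightarrow> cr a b;
       \<delta> ^ (ramsey2 * ramsey2) * card X \<le> 12 * real ramsey2 ^ 6 * card A;
       \<delta> ^ (ramsey2 * ramsey2) * card X \<le> 12 * real ramsey2 ^ 6 * card B\<rbrakk> \<Longrightarrow> thesis\<close>[of A B] that
    unfolding \<eta>_def m_def s_def by blast
  consider (tiny) "\<theta> * m \<le> 1" | (conc) a b where "\<theta> * m > 1" "cr a b" "\<theta> * m \<le> card {b'. cr a b' \<and> tm a b' = tm a b}"
    | (gen) "\<theta> * m > 1" "\<And>a b. cr a b \<Longrightarrow> card {b'. cr a b' \<and> tm a b' = tm a b} < \<theta> * m"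
    by (meson not_le_imp_less)
  then show thesis
  proof cases
    \<comment> \<open>There are so few arcs that a single crossing pair, as two singletons, is large
      enough.\<close>
    case tiny
    have "card {(a, b). cr a b} > 0"
    proof -
      have "\<delta> * (real (card X))\<^sup>2 > 0" using \<delta> m0 by (simp add: m_def)
      then show ?thesis using dense by linarith
    qed
    then obtain a b where ab: "cr a b" by (metis (no_types, lifting) card.empty case_prodE ex_in_conv less_irrefl mem_Collect_eq)
    have "\<eta> * m \<le> 4 * real s ^ 3" using tiny s3pos by (simp add: \<theta>_def divide_le_eq)
    also have "\<dots> \<le> 12 * real s ^ 6" using s36 by linarith
    finally have "\<eta> * m \<le> 12 * real s ^ 6" .
    then show thesis using crD[OF ab] ab by (intro finish[of "{a}" "{b}"]) auto
  next
    case (conc a b)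
    define Z where "Z = {b'. cr a b' \<and> tm a b' = tm a b}"
    have ZX: "Z \<subseteq> X" using crD by (auto simp: Z_def)
    have Zcr: "cr x y" if "x \<in> Z" "y \<in> Z" "x \<noteq> y" for x y
      using concurrent_cross[of a x y] that by (auto simp: Z_def)
    have finZ: "finite Z" using ZX finite_X finite_subset by blast
    have cZ: "real (card Z) \<ge> \<theta> * m" "card Z \<ge> 2" using conc by (auto simp: Z_def)
    obtain A where A: "A \<subseteq> Z" "card A = card Z div 2" by (meson obtain_subset_with_card_n div_le_dividend)
    define B where "B = Z - A"
    have cB: "card B = card Z - card Z div 2" using A finZ finite_subset[OF A(1) finZ] by (simp add: B_def card_Diff_subset)
    \<comment> \<open>Half of at least two elements, rounded down, is at least a third of them; this
      turns 4 into the 12 of the bound.\<close>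
    have "card Z \<le> 3 * card A" "card Z \<le> 3 * card B" unfolding A(2) cB using cZ(2) by presburger+
    then have third: "real (card Z) \<le> 3 * card A" "real (card Z) \<le> 3 * card B" by (simp_all only: of_nat_le_iff)
    have Zbig: "\<eta> * m \<le> 4 * real s ^ 6 * card Z"
    proof -
      have "\<eta> * m = 4 * real s ^ 3 * (\<theta> * m)" using s3pos by (simp add: \<theta>_def)
      also have "\<dots> \<le> 4 * real s ^ 6 * card Z" using cZ(1) s36 \<theta>0 m0 by (intro mult_mono) auto
      finally show ?thesis .
    qed
    show thesis
    proof (rule finish[of A B])
      show "cr x y" if "x \<in> A" "y \<in> B" for x y using that A(1) by (intro Zcr) (auto simp: B_def)
      have "4 * real s ^ 6 * card Z \<le> 4 * real s ^ 6 * (3 * card A)" by (intro mult_left_mono third(1)) auto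
      then show "\<eta> * m \<le> 12 * real s ^ 6 * card A" using Zbig by linarith
      have "4 * real s ^ 6 * card Z \<le> 4 * real s ^ 6 * (3 * card B)" by (intro mult_left_mono third(2)) auto
      then show "\<eta> * m \<le> 12 * real s ^ 6 * card B" using Zbig by linarith
    qed (use A ZX B_def in auto)
  next
    case gen
    define \<zeta> where "\<zeta> = nat \<lfloor>\<theta> * m\<rfloor>"
    have \<zeta>: "card {b'. cr a b' \<and> tm a b' = tm a b} \<le> \<zeta>" if "cr a b" for a b
      using gen(2)[OF that] unfolding \<zeta>_def by linarith
    have \<zeta>m: "real \<zeta> \<le> \<theta> * m" using \<theta>0 m0 by (simp add: \<zeta>_def)
    define P where "P = ({..<s} \<rightarrow>\<^sub>E X)"
    define T where "T = {(\<alpha>, \<beta>). \<alpha> \<in> P \<and> \<beta> \<in> P \<and> (\<forall>i<s. \<forall>j<s. cr (\<alpha> i) (\<beta> j))}"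
    have finP: "finite P" using finite_X by (auto simp: P_def intro: finite_PiE)
    have TP: "T \<subseteq> P \<times> P" by (auto simp: T_def)
    have finT: "finite T" using TP finP by (meson finite_SigmaI finite_subset)
    have Tbig: "\<eta> * m ^ (2 * s) \<le> card T"
    proof -
      have "{(a, b). cr a b} = {(a, b). a \<in> X \<and> b \<in> X \<and> cr a b}" using crD by auto
      then show ?thesis
        using count_complete_bipartite[OF finite_X Xne, of \<delta> cr s] dense \<delta> unfolding \<eta>_def m_def T_def P_def by auto
    qed
    have s0: "s > 0" using s1 by linarith
    have pw: "m ^ (2 * (s - 1)) * m\<^sup>2 = m ^ (2 * s)" 
    proof -
      have e: "2 * s = 2 * (s - 1) + 2" using s0 by simp
      show ?thesis unfolding arg_cong[OF e, of "power m"] power_add ..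
    qed
    \<comment> \<open>The grids in which two arcs of the second family cross an arc of the first at
      the same point; \<open>B2\<close> has the families exchanged.\<close>
    define B1 where "B1 i j j' = {(\<alpha>, \<beta>) \<in> T. tm (\<alpha> i) (\<beta> j) = tm (\<alpha> i) (\<beta> j')}" for i j j'
    define B2 where "B2 j i i' = {(\<alpha>, \<beta>) \<in> T. tm (\<beta> j) (\<alpha> i) = tm (\<beta> j) (\<alpha> i')}" for j i i'
    have KX: "card {(a, b). a \<in> X \<and> b \<in> X \<and> S a b} \<le> card X * \<zeta>"
      if "\<And>a. a \<in> X \<Longrightarrow> card {b \<in> X. S a b} \<le> \<zeta>" for S
    proof -
      have "{(a, b). a \<in> X \<and> b \<in> X \<and> S a b} = Sigma X (\<lambda>a. {b \<in> X. S a b})" by auto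
      then have "card {(a, b). a \<in> X \<and> b \<in> X \<and> S a b} = (\<Sum>a\<in>X. card {b \<in> X. S a b})" using finite_X by simp
      also have "\<dots> \<le> (\<Sum>a\<in>X. \<zeta>)" by (rule sum_mono) (rule that)
      finally show ?thesis by simp
    qed
    have KX': "card {(a, b). a \<in> X \<and> b \<in> X \<and> S a b} \<le> card X * \<zeta>"
      if "\<And>b. b \<in> X \<Longrightarrow> card {a \<in> X. S a b} \<le> \<zeta>" for S
    proof -
      have "{(a, b). a \<in> X \<and> b \<in> X \<and> S a b} = prod.swap ` {(b, a). b \<in> X \<and> a \<in> X \<and> S a b}" by auto
      then have "card {(a, b). a \<in> X \<and> b \<in> X \<and> S a b} \<le> card {(b, a). b \<in> X \<and> a \<in> X \<and> S a b}"
        using finite_X by (simp add: card_image)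
      also have "\<dots> \<le> card X * \<zeta>" using KX[of "\<lambda>b a. S a b"] that by simp
      finally show ?thesis .
    qed
    \<comment> \<open>With everything else fixed, \<open>\<alpha> i\<close> is free, and
      \<open>\<beta> j'\<close> has to pass through the point where \<open>\<alpha> i\<close>
      crosses the fixed arc \<open>\<beta> j\<close>.\<close>
    have B1c: "card (B1 i j j') \<le> card X ^ (2 * (s - 1)) * (card X * \<zeta>)" if "i < s" "j < s" "j' < s" "j \<noteq> j'" for i j j'
    proof (rule tuple_pairs_fibre_bound[OF finite_X _ that(1,3)])
      show "B1 i j j' \<subseteq> ({..<s} \<rightarrow>\<^sub>E X) \<times> ({..<s} \<rightarrow>\<^sub>E X)" using TP by (auto simp: B1_def P_def)
      fix \<alpha> \<beta>
      show "card {(a, b). a \<in> X \<and> b \<in> X \<and> (\<alpha>(i := a), \<beta>(j' := b)) \<in> B1 i j j'} \<le> card X * \<zeta>"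
      proof (rule KX)
        fix a
        let ?S = "{b \<in> X. (\<alpha>(i := a), \<beta>(j' := b)) \<in> B1 i j j'}"
        have sub: "?S \<subseteq> {b'. cr a b' \<and> tm a b' = tm a (\<beta> j)}"
          using that by (auto simp: B1_def T_def)
        show "card ?S \<le> \<zeta>"
        proof (cases "?S = {}")
          case False
          then obtain b where "(\<alpha>(i := a), \<beta>(j' := b)) \<in> B1 i j j'" by blast
          then have "cr ((\<alpha>(i := a)) i) ((\<beta>(j' := b)) j)" using that(1,2) by (auto simp: B1_def T_def simp del: fun_upd_apply)
          then have "cr a (\<beta> j)" using that(4) by simp
          then have "card {b'. cr a b' \<and> tm a b' = tm a (\<beta> j)} \<le> \<zeta>" by (rule \<zeta>)
          moreover have "finite {b'. cr a b' \<and> tm a b' = tm a (\<beta> j)}"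
            by (rule finite_subset[OF _ finite_X]) (use crD in auto)
          ultimately show ?thesis using card_mono[OF _ sub] by (meson le_trans)
        qed (simp only: card.empty)
      qed
    qed
    have B2c: "card (B2 j i i') \<le> card X ^ (2 * (s - 1)) * (card X * \<zeta>)" if "j < s" "i < s" "i' < s" "i \<noteq> i'" for i i' j
    proof (rule tuple_pairs_fibre_bound[OF finite_X _ that(3,1)])
      show "B2 j i i' \<subseteq> ({..<s} \<rightarrow>\<^sub>E X) \<times> ({..<s} \<rightarrow>\<^sub>E X)" using TP by (auto simp: B2_def P_def)
      fix \<alpha> \<beta>
      show "card {(a, b). a \<in> X \<and> b \<in> X \<and> (\<alpha>(i' := a), \<beta>(j := b)) \<in> B2 j i i'} \<le> card X * \<zeta>"
      proof (rule KX')
        fix b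
        let ?S = "{a \<in> X. (\<alpha>(i' := a), \<beta>(j := b)) \<in> B2 j i i'}"
        have sub: "?S \<subseteq> {b'. cr b b' \<and> tm b b' = tm b (\<alpha> i)}"
          using that by (auto simp: B2_def T_def intro: cr_sym)
        show "card ?S \<le> \<zeta>"
        proof (cases "?S = {}")
          case False
          then obtain a where "(\<alpha>(i' := a), \<beta>(j := b)) \<in> B2 j i i'" by blast
          then have "cr ((\<alpha>(i' := a)) i) ((\<beta>(j := b)) j)" using that(1,2) by (auto simp: B2_def T_def simp del: fun_upd_apply)
          then have "cr b (\<alpha> i)" using that(4) cr_sym by simp
          then have "card {b'. cr b b' \<and> tm b b' = tm b (\<alpha> i)} \<le> \<zeta>" by (rule \<zeta>)
          moreover have "finite {b'. cr b b' \<and> tm b b' = tm b (\<alpha> i)}"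
            by (rule finite_subset[OF _ finite_X]) (use crD in auto)
          ultimately show ?thesis using card_mono[OF _ sub] by (meson le_trans)
        qed (simp only: card.empty)
      qed
    qed
    have Kr: "real (card X ^ (2 * (s - 1)) * (card X * \<zeta>)) \<le> \<theta> * m ^ (2 * s)"
    proof -
      have "real (card X ^ (2 * (s - 1)) * (card X * \<zeta>)) = m ^ (2 * (s - 1)) * (m * real \<zeta>)" by (simp add: m_def)
      also have "\<dots> \<le> m ^ (2 * (s - 1)) * (m * (\<theta> * m))" using \<zeta>m m0 by (intro mult_left_mono) auto
      also have "\<dots> = \<theta> * (m ^ (2 * (s - 1)) * m\<^sup>2)" by (simp add: power2_eq_square)
      finally show ?thesis unfolding pw .
    qed
    define Ix where "Ix = {(x, y, z). x < s \<and> y < s \<and> z < s \<and> y \<noteq> z}"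
    have Ix: "finite Ix" "card Ix \<le> s ^ 3"
    proof -
      have sub: "Ix \<subseteq> {..<s} \<times> {..<s} \<times> {..<s}" by (auto simp: Ix_def)
      then show "finite Ix" by (rule finite_subset) simp
      show "card Ix \<le> s ^ 3" using card_mono[OF _ sub] by (simp add: card_cartesian_product power3_eq_cube)
    qed
    define Bad where "Bad = (\<Union>(x, y, z)\<in>Ix. B1 x y z) \<union> (\<Union>(x, y, z)\<in>Ix. B2 x y z)"
    have BadU: "real (card (\<Union>(x, y, z)\<in>Ix. B x y z)) \<le> \<eta> / 4 * m ^ (2 * s)"
      if "\<And>x y z. (x, y, z) \<in> Ix \<Longrightarrow> card (B x y z) \<le> card X ^ (2 * (s - 1)) * (card X * \<zeta>)" for B :: "nat \<Rightarrow> nat \<Rightarrow> nat \<Rightarrow> ((nat \<Rightarrow> 'e) \<times> (nat \<Rightarrow> 'e)) set"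
    proof -
      let ?c = "card X ^ (2 * (s - 1)) * (card X * \<zeta>)"
      have "card (\<Union>(x, y, z)\<in>Ix. B x y z) \<le> (\<Sum>(x, y, z)\<in>Ix. card (B x y z))"
        unfolding case_prod_beta by (rule card_UN_le[OF Ix(1)])
      also have "\<dots> \<le> (\<Sum>(x, y, z)\<in>Ix. ?c)" by (rule sum_mono) (use that in auto)
      also have "\<dots> = card Ix * ?c" by simp
      also have "\<dots> \<le> s ^ 3 * ?c" using Ix(2) by (rule mult_right_mono) simp
      finally have "real (card (\<Union>(x, y, z)\<in>Ix. B x y z)) \<le> real (s ^ 3 * ?c)" by (simp only: of_nat_le_iff)
      also have "\<dots> = real s ^ 3 * real ?c" by simp
      also have "\<dots> \<le> real s ^ 3 * (\<theta> * m ^ (2 * s))" using Kr s1 by (intro mult_left_mono) auto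
      also have "\<dots> = \<eta> / 4 * m ^ (2 * s)" using s3pos by (simp add: \<theta>_def)
      finally show ?thesis .
    qed
    have "real (card Bad) \<le> real (card (\<Union>(x, y, z)\<in>Ix. B1 x y z)) + real (card (\<Union>(x, y, z)\<in>Ix. B2 x y z))"
      unfolding Bad_def using card_Un_le[of "\<Union>(x, y, z)\<in>Ix. B1 x y z" "\<Union>(x, y, z)\<in>Ix. B2 x y z"] by linarith
    also have "\<dots> \<le> \<eta> / 4 * m ^ (2 * s) + \<eta> / 4 * m ^ (2 * s)"
      by (intro add_mono BadU) (use B1c B2c in \<open>auto simp: Ix_def\<close>)
    finally have cBad: "real (card Bad) \<le> \<eta> / 2 * m ^ (2 * s)" by simp
    have BadT: "Bad \<subseteq> T" by (auto simp: Bad_def B1_def B2_def)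
    have "real (card (T - Bad)) = real (card T) - real (card Bad)"
      using BadT finT card_mono[OF finT BadT] by (subst card_Diff_subset) (auto intro: finite_subset)
    then have good: "\<eta> / 2 * m ^ (2 * s) \<le> card (T - Bad)" using Tbig cBad by linarith
    define PP where "PP g h u v = {(a, b). a \<in> X \<and> b \<in> X \<and> pattern g h u v a b}" for g h u v
    define Q4 where "Q4 = X \<times> X \<times> X \<times> X"
    have fQ4: "finite Q4" "Q4 \<noteq> {}" using finite_X Xne by (auto simp: Q4_def)
    \<comment> \<open>The largest number of crossing chord pairs over all choices of four sides. The
      number of good grids is bounded through it, which shows that it is of order
      \<open>m^2\<close>.\<close>
    define Kx where "Kx = Max ((\<lambda>(g, h, u, v). card (PP g h u v)) ` Q4)"
    have Kx: "card (PP g h u v) \<le> Kx" if "g \<in> X" "h \<in> X" "u \<in> X" "v \<in> X" for g h u v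
      unfolding Kx_def using fQ4 that by (intro Max_ge) (auto simp: Q4_def image_iff)
    obtain g h u v where Qm: "card (PP g h u v) = Kx"
    proof -
      have "Kx \<in> (\<lambda>(g, h, u, v). card (PP g h u v)) ` Q4" unfolding Kx_def using fQ4 by (intro Max_in) auto
      then show thesis using that by auto
    qed
    define Jx where "Jx = {(i1, i2, i3, j1, j2, j3). i1 < s \<and> i2 < s \<and> i3 < s \<and> j1 < s \<and> j2 < s \<and> j3 < s \<and> distinct [i1, i2, i3] \<and> distinct [j1, j2, j3]}"
    have Jx: "finite Jx" "card Jx \<le> s ^ 6"
    proof -
      have sub: "Jx \<subseteq> {..<s} \<times> {..<s} \<times> {..<s} \<times> {..<s} \<times> {..<s} \<times> {..<s}" by (auto simp: Jx_def)
      then show "finite Jx" by (rule finite_subset) simp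
      have "card Jx \<le> card ({..<s} \<times> {..<s} \<times> {..<s} \<times> {..<s} \<times> {..<s} \<times> {..<s})" by (rule card_mono[OF _ sub]) simp
      also have "\<dots> = s ^ 6" by (simp add: card_cartesian_product power_numeral_reduce)
      finally show "card Jx \<le> s ^ 6" .
    qed
    define PW where "PW = (\<lambda>(i1, i2, i3, j1, j2, j3). {(\<alpha>, \<beta>) \<in> T. pattern (\<beta> j1) (\<beta> j3) (\<alpha> i1) (\<alpha> i3) (\<alpha> i2) (\<beta> j2)})"
    have cov: "T - Bad \<subseteq> (\<Union>w\<in>Jx. PW w)"
    proof
      fix z assume z: "z \<in> T - Bad"
      obtain \<alpha> \<beta> where ab: "z = (\<alpha>, \<beta>)" by (cases z)
      have crT: "cr (\<alpha> i) (\<beta> j)" if "i < s" "j < s" for i j using z that by (auto simp: ab T_def)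
      have t1: "tm (\<alpha> i) (\<beta> j) \<noteq> tm (\<alpha> i) (\<beta> j')" if "i < s" "j < s" "j' < s" "j \<noteq> j'" for i j j'
      proof
        assume "tm (\<alpha> i) (\<beta> j) = tm (\<alpha> i) (\<beta> j')"
        then have "z \<in> B1 i j j'" using z by (auto simp: B1_def ab)
        moreover have "(i, j, j') \<in> Ix" using that by (simp add: Ix_def)
        ultimately have "z \<in> Bad" by (auto simp: Bad_def)
        then show False using z by blast
      qed
      have t2: "tm (\<beta> j) (\<alpha> i) \<noteq> tm (\<beta> j) (\<alpha> i')" if "i < s" "i' < s" "j < s" "i \<noteq> i'" for i i' j
      proof
        assume "tm (\<beta> j) (\<alpha> i) = tm (\<beta> j) (\<alpha> i')"
        then have "z \<in> B2 j i i'" using z by (auto simp: B2_def ab)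
        moreover have "(j, i, i') \<in> Ix" using that by (simp add: Ix_def)
        ultimately have "z \<in> Bad" by (auto simp: Bad_def)
        then show False using z by blast
      qed
      obtain i1 i2 i3 j1 j2 j3 where w: "(i1, i2, i3, j1, j2, j3) \<in> Jx" "pattern (\<beta> j1) (\<beta> j3) (\<alpha> i1) (\<alpha> i3) (\<alpha> i2) (\<beta> j2)"
        by (rule pattern_in_grid[of \<alpha> \<beta>, folded s_def, OF crT t1 t2]) (auto simp: Jx_def)
      then have "z \<in> PW (i1, i2, i3, j1, j2, j3)" using z by (auto simp: PW_def ab)
      then show "z \<in> (\<Union>w\<in>Jx. PW w)" using w(1) by blast
    qed
    \<comment> \<open>When all entries except the two chords are fixed, so are the four sides, and
      at most \<open>Kx\<close> pairs of chords fit them.\<close>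
    have PWc: "card (PW w) \<le> card X ^ (2 * (s - 1)) * Kx" if "w \<in> Jx" for w
    proof -
      obtain i1 i2 i3 j1 j2 j3 where w: "w = (i1, i2, i3, j1, j2, j3)" by (cases w)
      have lt: "i1 < s" "i2 < s" "i3 < s" "j1 < s" "j2 < s" "j3 < s" "i1 \<noteq> i2" "i2 \<noteq> i3" "j1 \<noteq> j2" "j2 \<noteq> j3"
        using that by (auto simp: w Jx_def)
      show ?thesis
      proof (rule tuple_pairs_fibre_bound[OF finite_X _ lt(2,5)])
        show "PW w \<subseteq> ({..<s} \<rightarrow>\<^sub>E X) \<times> ({..<s} \<rightarrow>\<^sub>E X)" using TP by (auto simp: PW_def w P_def)
        fix \<alpha> \<beta> assume "(\<alpha>, \<beta>) \<in> PW w"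
        then have "\<alpha> \<in> P" "\<beta> \<in> P" using TP by (auto simp: PW_def w)
        then have inX: "\<alpha> i1 \<in> X" "\<alpha> i3 \<in> X" "\<beta> j1 \<in> X" "\<beta> j3 \<in> X" using lt by (auto simp: P_def PiE_iff)
        have sub: "{(a, b). a \<in> X \<and> b \<in> X \<and> (\<alpha>(i2 := a), \<beta>(j2 := b)) \<in> PW w} \<subseteq> PP (\<beta> j1) (\<beta> j3) (\<alpha> i1) (\<alpha> i3)"
          using lt by (auto simp: PW_def w PP_def)
        have "finite (PP (\<beta> j1) (\<beta> j3) (\<alpha> i1) (\<alpha> i3))"
          by (rule finite_subset[of _ "X \<times> X"]) (use finite_X in \<open>auto simp: PP_def\<close>)
        then have "card {(a, b). a \<in> X \<and> b \<in> X \<and> (\<alpha>(i2 := a), \<beta>(j2 := b)) \<in> PW w} \<le> card (PP (\<beta> j1) (\<beta> j3) (\<alpha> i1) (\<alpha> i3))"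
          by (rule card_mono[OF _ sub])
        also have "\<dots> \<le> Kx" using inX by (intro Kx)
        finally show "card {(a, b). a \<in> X \<and> b \<in> X \<and> (\<alpha>(i2 := a), \<beta>(j2 := b)) \<in> PW w} \<le> Kx" .
      qed
    qed
    have "card (T - Bad) \<le> card (\<Union>w\<in>Jx. PW w)"
    proof (rule card_mono[OF _ cov])
      show "finite (\<Union>w\<in>Jx. PW w)" by (rule finite_subset[OF _ finT]) (auto simp: PW_def)
    qed
    also have "\<dots> \<le> (\<Sum>w\<in>Jx. card (PW w))" by (rule card_UN_le[OF Jx(1)])
    also have "\<dots> \<le> (\<Sum>w\<in>Jx. card X ^ (2 * (s - 1)) * Kx)" by (rule sum_mono) (rule PWc)
    also have "\<dots> = card Jx * (card X ^ (2 * (s - 1)) * Kx)" by simp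
    also have "\<dots> \<le> s ^ 6 * (card X ^ (2 * (s - 1)) * Kx)" using Jx(2) by (rule mult_right_mono) simp
    finally have "real (card (T - Bad)) \<le> real (s ^ 6 * (card X ^ (2 * (s - 1)) * Kx))" by (simp only: of_nat_le_iff)
    then have "\<eta> / 2 * m ^ (2 * s) \<le> real s ^ 6 * (m ^ (2 * (s - 1)) * Kx)" using good by (simp add: m_def)
    then have "m ^ (2 * (s - 1)) * (\<eta> / 2 * m\<^sup>2) \<le> m ^ (2 * (s - 1)) * (real s ^ 6 * Kx)"
      unfolding pw[symmetric] by (simp add: mult_ac)
    then have Kbig: "\<eta> / 2 * m\<^sup>2 \<le> real s ^ 6 * Kx" using m0 by (simp add: mult_le_cancel_left)
    have "Kx > 0"
    proof (rule ccontr)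
      assume "\<not> ?thesis"
      then have "\<eta> / 2 * m\<^sup>2 \<le> 0" using Kbig by simp
      moreover have "\<eta> / 2 * m\<^sup>2 > 0" using \<eta> m0 by simp
      ultimately show False by linarith
    qed
    then have "PP g h u v \<noteq> {}" using Qm by (metis card.empty less_irrefl)
    then have q: "quad g h u v" by (auto simp: PP_def pattern_def)
    obtain A B where AB: "A \<subseteq> X" "B \<subseteq> X" "\<And>a b. a \<in> A \<Longrightarrow> b \<in> B \<Longrightarrow> cr a b" "card (PP g h u v) \<le> 2 * (card A * card B)"
      by (rule biclique_of_quad[OF q, of "PP g h u v"]) (auto simp: PP_def pattern_def)
    have cAB: "real (card A) \<le> m" "real (card B) \<le> m" using AB finite_X by (auto simp: m_def card_mono)
    have "\<eta> / 2 * m\<^sup>2 \<le> real s ^ 6 * (2 * (real (card A) * real (card B)))"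
    proof -
      have "real Kx \<le> 2 * (real (card A) * real (card B))" using AB(4) Qm by (metis of_nat_le_iff of_nat_mult of_nat_numeral)
      then have "real s ^ 6 * Kx \<le> real s ^ 6 * (2 * (real (card A) * real (card B)))" by (intro mult_left_mono) auto
      then show ?thesis using Kbig by linarith
    qed
    \<comment> \<open>Neither part has more than \<open>m\<close> elements, so a product of order
      \<open>m^2\<close> makes both of order \<open>m\<close>.\<close>
    then have prod: "\<eta> * m * m \<le> 4 * real s ^ 6 * (real (card A) * real (card B))" by (simp add: power2_eq_square)
    have A': "\<eta> * m \<le> 4 * real s ^ 6 * card A"
    proof -
      have "4 * real s ^ 6 * (real (card A) * real (card B)) \<le> 4 * real s ^ 6 * (real (card A) * m)"
        using cAB by (intro mult_left_mono) auto
      then have "\<eta> * m * m \<le> 4 * real s ^ 6 * card A * m" using prod by (simp add: mult_ac)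
      then show ?thesis using m0 by simp
    qed
    have B': "\<eta> * m \<le> 4 * real s ^ 6 * card B"
    proof -
      have "4 * real s ^ 6 * (real (card A) * real (card B)) \<le> 4 * real s ^ 6 * (m * real (card B))"
        using cAB by (intro mult_left_mono mult_right_mono) auto
      then have "\<eta> * m * m \<le> 4 * real s ^ 6 * card B * m" using prod by (simp add: mult_ac)
      then show ?thesis using m0 by simp
    qed
    have x: "4 * real s ^ 6 * card A \<le> 12 * real s ^ 6 * card A" "4 * real s ^ 6 * card B \<le> 12 * real s ^ 6 * card B"
      by (intro mult_right_mono; simp)+
    show thesis by (rule finish[OF AB(1-3) order_trans[OF A' x(1)] order_trans[OF B' x(2)]])
  qed
qed

end

section \<open>The edge bound\<close>

definition crossing_clique :: "(complex set \<Rightarrow> real \<Rightarrow> complex) \<Rightarrow> nat \<Rightarrow> complex set set \<Rightarrow> bool" where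
  "crossing_clique dr k E \<longleftrightarrow> (\<exists>S\<subseteq>E. card S = k \<and> (\<forall>e\<in>S. \<forall>f\<in>S. e \<noteq> f \<longrightarrow> edges_cross dr e f))"

lemma stg_finite:
  assumes "simple_topological_graph V E dr"
  shows "finite V" "finite E" "\<And>e. e \<in> E \<Longrightarrow> e \<subseteq> V \<and> card e = 2"
proof -
  show V: "finite V" and e: "\<And>e. e \<in> E \<Longrightarrow> e \<subseteq> V \<and> card e = 2"
    using assms by (auto simp: simple_topological_graph_def topological_graph_def)
  show "finite E" by (rule finite_subset[of _ "Pow V"]) (use V e in auto)
qed

lemma stg_subgraph:
  assumes G: "simple_topological_graph V E dr" and U: "U \<subseteq> V" and A: "A \<subseteq> E" "\<And>e. e \<in> A \<Longrightarrow> e \<subseteq> U"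
  shows "simple_topological_graph U A dr"
proof -
  have tg: "topological_graph V E dr" using G by (simp add: simple_topological_graph_def)
  have "topological_graph U A dr" unfolding topological_graph_def
  proof (intro conjI ballI impI)
    show "finite U" using stg_finite(1)[OF G] U finite_subset by blast
    fix e assume e: "e \<in> A"
    then have eE: "e \<in> E" using A by blast
    show "e \<subseteq> U" using A e by blast
    show "card e = 2" "arc (dr e)" "{pathstart (dr e), pathfinish (dr e)} = e"
      using tg eE by (auto simp: topological_graph_def)
    have "path_image (dr e) \<inter> V = e" using tg eE by (auto simp: topological_graph_def)
    then show "path_image (dr e) \<inter> U = e" using U \<open>e \<subseteq> U\<close> by blast
    fix f p assume "f \<in> A" "e \<noteq> f" "p \<in> edge_interior dr e \<inter> edge_interior dr f"
    then show "proper_crossing_at (dr e) (dr f) p" using tg eE A unfolding topological_graph_def by blast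
  qed
  then show ?thesis using G A unfolding simple_topological_graph_def by (meson subsetD)
qed

text \<open>No edge passes through a vertex that is not one of its ends, so edges without a common
  end can only meet in interior points.\<close>

lemma edges_disjoint_iff:
  assumes G: "simple_topological_graph V E dr" and e: "e \<in> E" and f: "f \<in> E" and ef: "e \<inter> f = {}"
  shows "edges_disjoint dr e f \<longleftrightarrow> \<not> edges_cross dr e f"
proof -
  have tg: "topological_graph V E dr" using G by (simp add: simple_topological_graph_def)
  have im: "path_image (dr e) \<inter> V = e" "path_image (dr f) \<inter> V = f" "e \<subseteq> V" "f \<subseteq> V"
    using tg e f unfolding topological_graph_def by auto
  show ?thesis
  proof
    assume "edges_disjoint dr e f"
    then show "\<not> edges_cross dr e f" by (auto simp: edges_disjoint_def edges_cross_def edge_interior_def)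
  next
    assume "\<not> edges_cross dr e f"
    then have "path_image (dr e) \<inter> path_image (dr f) \<subseteq> e \<union> f" by (auto simp: edges_cross_def edge_interior_def)
    then have "path_image (dr e) \<inter> path_image (dr f) \<subseteq> e \<inter> f" using im by blast
    then show "edges_disjoint dr e f" using ef by (simp add: edges_disjoint_def)
  qed
qed

text \<open>Crossings of edges are points away from the ends, crossings of pseudo-segments are
  interior parameters; these agree because arcs are injective.\<close>

lemma stg_pseudo_segments:
  assumes G: "simple_topological_graph V E dr"
  shows "pseudo_segments E dr" "e \<in> E \<Longrightarrow> f \<in> E \<Longrightarrow> e \<noteq> f \<Longrightarrow> pseudo_segments.cr E dr e f \<longleftrightarrow> edges_cross dr e f"
proof -
  have tg: "topological_graph V E dr" using G by (simp add: simple_topological_graph_def)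
  show ps: "pseudo_segments E dr"
  proof
    show "finite E" by (rule stg_finite(2)[OF G])
    show "arc (dr e)" if "e \<in> E" for e using tg that by (auto simp: topological_graph_def)
    show "p = q" if "e \<in> E" "f \<in> E" "e \<noteq> f" "p \<in> path_image (dr e) \<inter> path_image (dr f)"
        "q \<in> path_image (dr e) \<inter> path_image (dr f)" for e f p q
      using G that unfolding simple_topological_graph_def by blast
  qed
  have int: "edge_interior dr e = dr e ` {0<..<1}" if "e \<in> E" for e
  proof -
    have a: "arc (dr e)" "{pathstart (dr e), pathfinish (dr e)} = e" using tg that by (auto simp: topological_graph_def)
    have inj: "inj_on (dr e) {0..1}" using a(1) by (simp add: arc_def)
    have "edge_interior dr e = dr e ` {0..1} - dr e ` {0, 1}"
      using a(2) by (auto simp: edge_interior_def path_image_def pathstart_def pathfinish_def)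
    also have "\<dots> = dr e ` ({0..1} - {0, 1})" by (rule inj_on_image_set_diff[OF inj, symmetric]) auto
    also have "{0..1::real} - {0, 1} = {0<..<1}" by auto
    finally show ?thesis .
  qed
  assume "e \<in> E" "f \<in> E" "e \<noteq> f"
  then show "pseudo_segments.cr E dr e f \<longleftrightarrow> edges_cross dr e f"
    unfolding pseudo_segments.cr_def[OF ps] edges_cross_def using int by (auto simp: image_iff set_eq_iff)
qed

lemma clique_of_biclique:
  assumes fin: "finite A" "finite B" and k: "k \<le> 2 * j"
    and AB: "\<And>a b. a \<in> A \<Longrightarrow> b \<in> B \<Longrightarrow> a \<noteq> b \<and> edges_cross dr a b"
    and cA: "crossing_clique dr j A" and cB: "crossing_clique dr j B" and E: "A \<subseteq> E" "B \<subseteq> E"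
  shows "crossing_clique dr k E"
proof -
  obtain S where S: "S \<subseteq> A" "card S = j" "\<And>e f. e \<in> S \<Longrightarrow> f \<in> S \<Longrightarrow> e \<noteq> f \<Longrightarrow> edges_cross dr e f"
    using cA unfolding crossing_clique_def by blast
  obtain T where T: "T \<subseteq> B" "card T = j" "\<And>e f. e \<in> T \<Longrightarrow> f \<in> T \<Longrightarrow> e \<noteq> f \<Longrightarrow> edges_cross dr e f"
    using cB unfolding crossing_clique_def by blast
  have "S \<inter> T = {}"
  proof (rule ccontr)
    assume "S \<inter> T \<noteq> {}"
    then obtain x where "x \<in> S" "x \<in> T" by auto
    then have "x \<noteq> x" using AB[OF subsetD[OF S(1)] subsetD[OF T(1)], of x x] by simp
    then show False by simp
  qed
  moreover have fST: "finite S" "finite T" using finite_subset[OF S(1) fin(1)] finite_subset[OF T(1) fin(2)] .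
  ultimately have "card (S \<union> T) = 2 * j" using S T by (simp add: card_Un_disjoint)
  then obtain R where R: "R \<subseteq> S \<union> T" "card R = k" using k by (metis obtain_subset_with_card_n)
  have sym: "edges_cross dr e f \<Longrightarrow> edges_cross dr f e" for e f by (auto simp: edges_cross_def)
  have "edges_cross dr e f" if ef: "e \<in> R" "f \<in> R" "e \<noteq> f" for e f
  proof -
    consider "e \<in> S" "f \<in> S" | "e \<in> T" "f \<in> T" | "e \<in> S" "f \<in> T" | "e \<in> T" "f \<in> S" using subsetD[OF R(1) ef(1)] subsetD[OF R(1) ef(2)] by auto
    then show ?thesis
    proof cases
      case 3 then show ?thesis using AB[OF subsetD[OF S(1)] subsetD[OF T(1)]] by simp
    next
      case 4 then show ?thesis using AB[OF subsetD[OF S(1)] subsetD[OF T(1)], of f e] sym by simp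
    qed (use S T ef in auto)
  qed
  moreover have "R \<subseteq> E" using R(1) S(1) T(1) E by (meson Un_least order_trans)
  ultimately show ?thesis unfolding crossing_clique_def using R(2) by (intro exI[of _ R]) simp
qed

section \<open>Induction on the logarithm of k\<close>

text \<open>At most \<open>N\<close> vertices carry at most \<open>N^2\<close> edges, so
  \<open>1 + 2 * log 2 N\<close> bounds \<open>lg (card E)\<close>. The guaranteed proportion of odd
  pairs is then \<open>1 / Wf N\<close>.\<close>

definition Wf :: "real \<Rightarrow> real" where "Wf N = 53290000 * (1 + 2 * log 2 N) ^ 6"

text \<open>The price of halving \<open>k\<close>: the density lost on passing to an expanding
  subgraph, times the loss of \<open>dense_crossing_biclique\<close> at density
  \<open>1 / Wf N\<close>.\<close>

definition Lf :: "real \<Rightarrow> real" where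
  "Lf N = 12 * real ramsey2 ^ 6 * (1 + 2 * log 2 N) * Wf N ^ (ramsey2 * ramsey2)"

lemma Wf_Lf:
  assumes "N \<ge> 2"
  shows "Wf N \<ge> 1" "Lf N \<ge> 1" "(1 + 2 * log 2 N) * Wf N \<le> Lf N" "1 + 2 * log 2 N \<ge> 1"
proof -
  show l: "1 + 2 * log 2 N \<ge> 1" using assms by simp
  then have "1 \<le> (1 + 2 * log 2 N) ^ 6" by (rule one_le_power)
  then show W: "Wf N \<ge> 1" unfolding Wf_def by linarith
  have s: "ramsey2 * ramsey2 \<ge> 1" "real ramsey2 \<ge> 1" using ramsey2_pos by auto
  have "Wf N ^ 1 \<le> Wf N ^ (ramsey2 * ramsey2)" using W s(1) by (intro power_increasing)
  then have Wp: "Wf N \<le> Wf N ^ (ramsey2 * ramsey2)" by simp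
  have "1 \<le> real ramsey2 ^ 6" using s(2) by (rule one_le_power)
  then have c: "1 \<le> 12 * real ramsey2 ^ 6" by linarith
  have "1 * (1 + 2 * log 2 N) * Wf N \<le> 12 * real ramsey2 ^ 6 * (1 + 2 * log 2 N) * Wf N ^ (ramsey2 * ramsey2)"
    using c l W Wp by (intro mult_mono) auto
  then show LW: "(1 + 2 * log 2 N) * Wf N \<le> Lf N" unfolding Lf_def by simp
  have "1 * 1 \<le> (1 + 2 * log 2 N) * Wf N" using l W by (intro mult_mono) auto
  then show "Lf N \<ge> 1" using LW by linarith
qed

text \<open>A single factor \<open>Lf N\<close> of excess density already meets the density
  condition for odd pairs; hence the exponent \<open>Suc t\<close>. The excess is inherited by the
  subgraph up to the factor \<open>1 + 2 * log 2 N\<close>.\<close>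

lemma extremal_subgraph:
  assumes G: "simple_topological_graph V E dr" and N: "real (card V) \<le> N" "N \<ge> 2" and rep: "parity_rep E c"
    and big: "Lf N ^ Suc t * card V < card E"
  obtains U F where "U \<subseteq> V" "F \<subseteq> E" "F \<noteq> {}" "\<And>e. e \<in> F \<Longrightarrow> e \<subseteq> U" "card U > 0"
    "Lf N ^ Suc t * card U < (1 + 2 * log 2 N) * card F"
    "(real (card F))\<^sup>2 \<le> Wf N * card {(e, f). e \<in> F \<and> f \<in> F \<and> e \<inter> f = {} \<and> c e f}"
proof -
  note fin = stg_finite[OF G]
  note WL = Wf_Lf[OF N(2)]
  let ?\<Lambda> = "1 + 2 * log 2 N"
  have L0: "Lf N ^ Suc t \<ge> 1" using WL(2) by (rule one_le_power)
  have cE: "card E > 0"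
  proof -
    have "Lf N ^ Suc t * card V \<ge> 0" using L0 by simp
    then show ?thesis using big by linarith
  qed
  then have ne: "E \<noteq> {}" by auto
  define lm where "lm = lg (card E)"
  have cV: "card V > 0"
  proof -
    obtain e where "e \<in> E" using ne by blast
    then have "e \<subseteq> V" "e \<noteq> {}" using fin(3)[of e] by auto
    then show ?thesis using fin(1) by (auto simp: card_gt_0_iff)
  qed
  have lm: "1 \<le> lm" "lm \<le> ?\<Lambda>"
  proof -
    show "1 \<le> lm" unfolding lm_def using cE by (intro lg_ge_1) simp
    have "E \<subseteq> (\<lambda>(x, y). {x, y}) ` (V \<times> V)"
    proof
      fix e assume "e \<in> E"
      then have "e \<subseteq> V" "card e = 2" using fin(3) by auto
      then show "e \<in> (\<lambda>(x, y). {x, y}) ` (V \<times> V)" by (auto simp: card_2_iff)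
    qed
    then have "card E \<le> card ((\<lambda>(x, y). {x, y}) ` (V \<times> V))" using fin(1) by (intro card_mono) auto
    also have "\<dots> \<le> card (V \<times> V)" using fin(1) by (intro card_image_le) auto
    finally have "real (card E) \<le> (real (card V))\<^sup>2" by (simp add: card_cartesian_product power2_eq_square flip: of_nat_mult)
    also have "\<dots> \<le> N\<^sup>2" using N by (intro power_mono) auto
    finally have "log 2 (card E) \<le> log 2 (N\<^sup>2)" using cE N(2) by (subst log_le_cancel_iff) auto
    also have "\<dots> = 2 * log 2 N" using N(2) by (simp add: log_nat_power)
    finally show "lm \<le> ?\<Lambda>" by (simp add: lm_def lg_def)
  qed
  obtain U F where UF: "U \<subseteq> V" "F \<subseteq> E" "F \<noteq> {}" "\<And>e. e \<in> F \<Longrightarrow> e \<subseteq> U" "real (card E) * card U \<le> lm * card F * card V"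
    "53290000 * lm ^ 6 * card U \<le> card F \<Longrightarrow>
      (real (card F))\<^sup>2 \<le> 53290000 * lm ^ 6 * card {(e, f). e \<in> F \<and> f \<in> F \<and> e \<inter> f = {} \<and> c e f}"
  proof (rule dense_odd_subgraph[OF fin(1) _ ne rep lm_def], goal_cases)
    case (1 e)
    show ?case using 1(2) by (rule fin(3))
  next
    case (2 U F)
    show ?case using 2(2-7) by (rule 2(1))
  qed
  have cU: "card U > 0"
  proof -
    obtain e where "e \<in> F" using UF(3) by blast
    then have "e \<subseteq> U" "e \<noteq> {}" using UF(2,4) fin(3)[of e] by auto
    then have "U \<noteq> {}" by auto
    moreover have "finite U" using UF(1) fin(1) finite_subset by blast
    ultimately show ?thesis by (simp add: card_gt_0_iff)
  qed
  have lW: "53290000 * lm ^ 6 \<le> Wf N" unfolding Wf_def using lm by (intro mult_left_mono power_mono) auto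
  have "Lf N ^ Suc t * card V * card U < real (card E) * card U" using big cU by (intro mult_strict_right_mono) auto
  also have "\<dots> \<le> lm * card F * card V" by (rule UF(5))
  also have "\<dots> \<le> ?\<Lambda> * card F * card V" using lm by (intro mult_right_mono) auto
  finally have "(Lf N ^ Suc t * card U) * card V < (?\<Lambda> * card F) * card V" by (simp add: mult_ac)
  then have lt: "Lf N ^ Suc t * card U < ?\<Lambda> * card F" using cV by (simp add: mult_less_cancel_right)
  have "?\<Lambda> * Wf N * card U \<le> Lf N ^ Suc t * card U"
  proof -
    have "Lf N ^ 1 \<le> Lf N ^ Suc t" using WL(2) by (intro power_increasing) auto
    then show ?thesis using WL(3) by (intro mult_right_mono) auto
  qed
  then have "?\<Lambda> * (Wf N * card U) < ?\<Lambda> * card F" using lt by (simp add: mult.assoc)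
  then have "Wf N * card U < card F" using WL(4) by (simp add: mult_less_cancel_left)
  moreover have "53290000 * lm ^ 6 * card U \<le> Wf N * card U" using lW by (intro mult_right_mono) auto
  ultimately have "(real (card F))\<^sup>2 \<le> 53290000 * lm ^ 6 * card {(e, f). e \<in> F \<and> f \<in> F \<and> e \<inter> f = {} \<and> c e f}"
    by (intro UF(6)) linarith
  also have "\<dots> \<le> Wf N * card {(e, f). e \<in> F \<and> f \<in> F \<and> e \<inter> f = {} \<and> c e f}" using lW by (intro mult_right_mono) auto
  finally show thesis using that[OF UF(1-4) cU lt] by blast
qed

text \<open>Let \<open>j\<close> be half of \<open>k\<close>, rounded up. One part of the biclique
  has no \<open>j\<close> pairwise crossing edges, since such sets in both parts would combine to
  \<open>k\<close>. The induction bounds this part, and the factors lost are those collected in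
  \<open>Lf N\<close>. Keeping \<open>N\<close> apart from \<open>card V\<close> lets the same
  \<open>N\<close> serve all subgraphs.\<close>

lemma quasi_planar_bound:
  assumes "simple_topological_graph V E dr" "real (card V) \<le> N" "N \<ge> 2" "k \<le> 2 ^ t" "\<not> crossing_clique dr k E"
  shows "real (card E) \<le> Lf N ^ t * card V"
  using assms
proof (induction t arbitrary: V E k)
  case 0
  have "E = {}"
  proof (rule ccontr)
    assume "E \<noteq> {}"
    then obtain e where "e \<in> E" by blast
    then have "crossing_clique dr 1 E" unfolding crossing_clique_def by (intro exI[of _ "{e}"]) auto
    moreover have "crossing_clique dr 0 E" unfolding crossing_clique_def by (intro exI[of _ "{}"]) auto
    moreover have "k = 0 \<or> k = 1" using 0 by auto
    ultimately show False using 0 by auto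
  qed
  then show ?case by simp
next
  case (Suc t)
  note G = Suc.prems(1) and N = Suc.prems(2,3)
  note WL = Wf_Lf[OF N(2)]
  let ?\<Lambda> = "1 + 2 * log 2 N"
  show ?case
  proof (rule ccontr)
    assume "\<not> ?thesis"
    then have big: "Lf N ^ Suc t * card V < card E" by simp
    obtain U F where UF: "U \<subseteq> V" "F \<subseteq> E" "F \<noteq> {}" "\<And>e. e \<in> F \<Longrightarrow> e \<subseteq> U" "card U > 0"
      "Lf N ^ Suc t * card U < ?\<Lambda> * card F"
      "(real (card F))\<^sup>2 \<le> Wf N * card {(e, f). e \<in> F \<and> f \<in> F \<and> e \<inter> f = {} \<and> edges_cross dr e f}"
      by (rule extremal_subgraph[OF G N crossing_parity_rep[OF G] big]) blast
    have GF: "simple_topological_graph U F dr" by (rule stg_subgraph[OF G UF(1,2,4)])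
    interpret pseudo_segments F dr by (rule stg_pseudo_segments(1)[OF GF])
    have crF: "cr e f \<longleftrightarrow> edges_cross dr e f" if "e \<in> F" "f \<in> F" "e \<noteq> f" for e f
      by (rule stg_pseudo_segments(2)[OF GF that])
    define \<delta> where "\<delta> = 1 / Wf N"
    have \<delta>: "0 < \<delta>" "\<delta> \<le> 1" using WL(1) by (auto simp: \<delta>_def)
    have sub: "{(e, f). e \<in> F \<and> f \<in> F \<and> e \<inter> f = {} \<and> edges_cross dr e f} \<subseteq> {(a, b). cr a b}"
    proof clarify
      fix e f assume A: "e \<in> F" "f \<in> F" "e \<inter> f = {}" "edges_cross dr e f"
      have "e \<noteq> {}" using stg_finite(3)[OF GF A(1)] by auto
      then have "e \<noteq> f" using A(3) by auto
      then show "cr e f" using crF A by blast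
    qed
    have finc: "finite {(a, b). cr a b}"
      by (rule finite_subset[of _ "F \<times> F"]) (use crD finite_X in auto)
    have "(real (card F))\<^sup>2 \<le> Wf N * card {(a, b). cr a b}"
    proof -
      have "real (card {(e, f). e \<in> F \<and> f \<in> F \<and> e \<inter> f = {} \<and> edges_cross dr e f}) \<le> card {(a, b). cr a b}"
        using card_mono[OF finc sub] by simp
      then have "Wf N * card {(e, f). e \<in> F \<and> f \<in> F \<and> e \<inter> f = {} \<and> edges_cross dr e f} \<le> Wf N * card {(a, b). cr a b}"
        using WL(1) by (intro mult_left_mono) auto
      then show ?thesis using UF(7) by linarith
    qed
    then have dense: "\<delta> * (real (card F))\<^sup>2 \<le> card {(a, b). cr a b}" using WL(1) by (simp add: \<delta>_def field_simps)
    obtain A B where AB: "A \<subseteq> F" "B \<subseteq> F" "\<And>a b. a \<in> A \<Longrightarrow> b \<in> B \<Longrightarrow> cr a b"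
      "\<delta> ^ (ramsey2 * ramsey2) * card F \<le> 12 * real ramsey2 ^ 6 * card A"
      "\<delta> ^ (ramsey2 * ramsey2) * card F \<le> 12 * real ramsey2 ^ 6 * card B"
      by (rule dense_crossing_biclique[OF \<delta> UF(3) dense]) blast
    define j where "j = (k + 1) div 2"
    have j: "k \<le> 2 * j" "j \<le> 2 ^ t" using Suc.prems(4) by (auto simp: j_def)
    have fin: "finite A" "finite B" using AB finite_X finite_subset by blast+
    have ABx: "a \<noteq> b \<and> edges_cross dr a b" if "a \<in> A" "b \<in> B" for a b
      using AB(3)[OF that] crD[of a b] crF by blast
    have "\<not> crossing_clique dr j A \<or> \<not> crossing_clique dr j B"
      using clique_of_biclique[OF fin j(1) ABx] AB(1,2) UF(2) Suc.prems(5) by blast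
    then obtain C where C: "C \<subseteq> F" "\<not> crossing_clique dr j C" "\<delta> ^ (ramsey2 * ramsey2) * card F \<le> 12 * real ramsey2 ^ 6 * card C"
      using AB(1,2,4,5) by blast
    have cU: "real (card U) \<le> N"
      using card_mono[OF stg_finite(1)[OF G] UF(1)] N(1) by linarith
    have "simple_topological_graph U C dr" by (rule stg_subgraph[OF GF order_refl C(1)]) (use UF(4) C(1) in blast)
    then have "real (card C) \<le> Lf N ^ t * card U" by (rule Suc.IH[OF _ cU N(2) j(2) C(2)])
    then have "12 * real ramsey2 ^ 6 * card C \<le> 12 * real ramsey2 ^ 6 * (Lf N ^ t * card U)" by (intro mult_left_mono) auto
    then have "\<delta> ^ (ramsey2 * ramsey2) * card F \<le> 12 * real ramsey2 ^ 6 * (Lf N ^ t * card U)" using C(3) by linarith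
    then have "Wf N ^ (ramsey2 * ramsey2) * (\<delta> ^ (ramsey2 * ramsey2) * card F)
        \<le> Wf N ^ (ramsey2 * ramsey2) * (12 * real ramsey2 ^ 6 * (Lf N ^ t * card U))"
      using WL(1) by (intro mult_left_mono) auto
    moreover have "Wf N ^ (ramsey2 * ramsey2) * (\<delta> ^ (ramsey2 * ramsey2) * card F) = card F"
    proof -
      have "Wf N ^ (ramsey2 * ramsey2) * \<delta> ^ (ramsey2 * ramsey2) = 1"
        using WL(1) by (simp add: \<delta>_def power_mult_distrib[symmetric])
      then show ?thesis by (simp only: mult.assoc[symmetric] mult_1)
    qed
    ultimately have "real (card F) \<le> Wf N ^ (ramsey2 * ramsey2) * (12 * real ramsey2 ^ 6 * (Lf N ^ t * card U))" by simp
    then have "?\<Lambda> * card F \<le> ?\<Lambda> * (Wf N ^ (ramsey2 * ramsey2) * (12 * real ramsey2 ^ 6 * (Lf N ^ t * card U)))"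
      using WL(4) by (intro mult_left_mono) auto
    also have "\<dots> = Lf N ^ Suc t * card U" unfolding Lf_def[of N] power_Suc by (simp only: mult_ac)
    finally show False using UF(6) by linarith
  qed
qed

section \<open>Disjoint pairs of edges and the final bound\<close>

lemma bipartite_noncrossing_parity_rep:
  assumes G: "simple_topological_graph V E dr" and bip: "bipartite_graph V E"
  shows "parity_rep E (\<lambda>e f. \<not> edges_cross dr e f)"
proof -
  obtain A B where AB: "A \<union> B = V \<and> A \<inter> B = {} \<and> (\<forall>e\<in>E. e \<inter> A \<noteq> {} \<and> e \<inter> B \<noteq> {})"
    using bip[unfolded bipartite_graph_def] by (elim exE) (rule that)
  show ?thesis
  proof (rule parity_rep_complement[OF crossing_parity_rep[OF G], of A B])
    show "A \<inter> B = {}" using AB by simp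
    show "e \<subseteq> A \<union> B \<and> e \<inter> A \<noteq> {} \<and> e \<inter> B \<noteq> {}" if "e \<in> E" for e
      using AB stg_finite(3)[OF G that] that by simp
  qed
qed

text \<open>The edges disjoint from a fixed edge contain no \<open>k\<close> pairwise crossing ones,
  so \<open>quasi_planar_bound\<close> makes them few. Summed over all edges of the dense subgraph,
  this contradicts its number of disjoint pairs, for which the extra factor \<open>Lf N\<close>
  pays.\<close>

lemma k1_free_bound:
  assumes G: "simple_topological_graph V E dr" and bip: "bipartite_graph V E" and N: "real (card V) \<le> N" "N \<ge> 2"
    and k: "k \<le> 2 ^ t" and no: "\<not> has_k1_crossing_family k E dr"
  shows "real (card E) \<le> Lf N ^ Suc t * card V"
proof (rule ccontr)
  assume "\<not> ?thesis"
  then have big: "Lf N ^ Suc t * card V < card E" by simp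
  note WL = Wf_Lf[OF N(2)]
  let ?\<Lambda> = "1 + 2 * log 2 N"
  note rep = bipartite_noncrossing_parity_rep[OF G bip]
  obtain U F where UF: "U \<subseteq> V" "F \<subseteq> E" "F \<noteq> {}" "\<And>e. e \<in> F \<Longrightarrow> e \<subseteq> U" "card U > 0"
    "Lf N ^ Suc t * card U < ?\<Lambda> * card F"
    "(real (card F))\<^sup>2 \<le> Wf N * card {(e, f). e \<in> F \<and> f \<in> F \<and> e \<inter> f = {} \<and> \<not> edges_cross dr e f}"
    by (rule extremal_subgraph[OF G N rep big]) blast
  have GF: "simple_topological_graph U F dr" by (rule stg_subgraph[OF G UF(1,2,4)])
  have finF: "finite F" by (rule stg_finite(2)[OF GF])
  define C where "C f = {e \<in> F. e \<inter> f = {} \<and> \<not> edges_cross dr e f}" for f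
  have cC: "real (card (C f)) \<le> Lf N ^ t * card U" if f: "f \<in> F" for f
  proof -
    have "\<not> crossing_clique dr k (C f)"
    proof
      assume "crossing_clique dr k (C f)"
      then obtain S where S: "S \<subseteq> C f" "card S = k" "\<forall>e\<in>S. \<forall>f\<in>S. e \<noteq> f \<longrightarrow> edges_cross dr e f"
        unfolding crossing_clique_def by blast
      have "\<forall>e\<in>S. edges_disjoint dr e f"
        using S(1) f edges_disjoint_iff[OF GF] by (auto simp: C_def)
      then have "has_k1_crossing_family k E dr" unfolding has_k1_crossing_family_def
        using S UF(2) f by (intro exI[of _ S] exI[of _ f]) (auto simp: C_def)
      then show False using no by blast
    qed
    moreover have "simple_topological_graph U (C f) dr"
      by (rule stg_subgraph[OF GF order_refl]) (use UF(4) in \<open>auto simp: C_def\<close>)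
    moreover have "real (card U) \<le> N" using card_mono[OF stg_finite(1)[OF G] UF(1)] N(1) by linarith
    ultimately show ?thesis by (intro quasi_planar_bound[OF _ _ N(2) k])
  qed
  have finC: "finite (Sigma F C)" using finF by (intro finite_SigmaI) (auto simp: C_def)
  have sub: "{(e, f). e \<in> F \<and> f \<in> F \<and> e \<inter> f = {} \<and> \<not> edges_cross dr e f} \<subseteq> prod.swap ` Sigma F C"
  proof (rule subsetI)
    fix p assume p: "p \<in> {(e, f). e \<in> F \<and> f \<in> F \<and> e \<inter> f = {} \<and> \<not> edges_cross dr e f}"
    show "p \<in> prod.swap ` Sigma F C"
      by (rule image_eqI[of _ _ "(snd p, fst p)"]) (use p in \<open>auto simp only: C_def prod.swap_def split_beta prod.collapse fst_conv snd_conv mem_Collect_eq mem_Sigma_iff\<close>)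
  qed
  have "card {(e, f). e \<in> F \<and> f \<in> F \<and> e \<inter> f = {} \<and> \<not> edges_cross dr e f} \<le> card (prod.swap ` Sigma F C)"
    using finC sub by (intro card_mono finite_imageI)
  also have "\<dots> \<le> card (Sigma F C)" by (rule card_image_le[OF finC])
  also have "\<dots> = (\<Sum>f\<in>F. card (C f))" using finF by (intro card_SigmaI) (auto simp: C_def)
  finally have "real (card {(e, f). e \<in> F \<and> f \<in> F \<and> e \<inter> f = {} \<and> \<not> edges_cross dr e f}) \<le> real (\<Sum>f\<in>F. card (C f))"
    by (rule of_nat_mono)
  also have "\<dots> = (\<Sum>f\<in>F. real (card (C f)))" by (rule of_nat_sum)
  also have "\<dots> \<le> (\<Sum>f\<in>F. Lf N ^ t * card U)" by (rule sum_mono) (rule cC)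
  also have "\<dots> = card F * (Lf N ^ t * card U)" by (rule sum_constant)
  finally have le: "real (card {(e, f). e \<in> F \<and> f \<in> F \<and> e \<inter> f = {} \<and> \<not> edges_cross dr e f}) \<le> card F * (Lf N ^ t * card U)" .
  have "(real (card F))\<^sup>2 \<le> Wf N * (card F * (Lf N ^ t * card U))"
    using WL(1) by (intro order_trans[OF UF(7) mult_left_mono[OF le]]) simp
  then have "card F * real (card F) \<le> card F * (Wf N * (Lf N ^ t * card U))" by (simp only: power2_eq_square mult_ac)
  moreover have "real (card F) > 0" using finF UF(3) by (simp add: card_gt_0_iff)
  ultimately have "real (card F) \<le> Wf N * (Lf N ^ t * card U)" by (rule mult_left_le_imp_le)
  then have "?\<Lambda> * card F \<le> ?\<Lambda> * (Wf N * (Lf N ^ t * card U))" using WL(4) by (intro mult_left_mono) auto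
  also have "\<dots> = (?\<Lambda> * Wf N) * (Lf N ^ t * card U)" by (simp only: mult.assoc)
  also have "\<dots> \<le> Lf N * (Lf N ^ t * card U)" using WL by (intro mult_right_mono) auto
  also have "\<dots> = Lf N ^ Suc t * card U" by (simp only: power_Suc mult.assoc)
  finally show False using UF(6) by simp
qed

text \<open>Here any two edges meet, so the drawing is a thrackle. An odd pair for the non-crossing
  relation has no common vertex and does not cross, hence is disjoint.\<close>

lemma thrackle_bound:
  assumes G: "simple_topological_graph V E dr" and bip: "bipartite_graph V E" and V: "V \<noteq> {}"
    and no: "\<not> has_k1_crossing_family 1 E dr"
  shows "real (card E) \<le> 16 * card V"
proof (rule ccontr)
  assume "\<not> ?thesis"
  then have many: "16 * card V \<le> card E" by linarith
  note rep = bipartite_noncrossing_parity_rep[OF G bip]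
  obtain e f where ef: "e \<in> E" "f \<in> E" "e \<inter> f = {}" "\<not> edges_cross dr e f"
    by (rule odd_pair_of_many_edges[OF stg_finite(1)[OF G] V stg_finite(3)[OF G] many rep])
  then have "edges_disjoint dr e f" using edges_disjoint_iff[OF G] by blast
  then have "has_k1_crossing_family 1 E dr" unfolding has_k1_crossing_family_def
    using ef by (intro exI[of _ "{e}"] exI[of _ f]) auto
  then show False using no by blast
qed

text \<open>From 3 on the logarithm is at least 3/2, because \<open>2^3 \<le> 3^2\<close>, so a
  further power of it absorbs the constants in \<open>Lf\<close>. At 2 the logarithm is 1 and
  absorbs nothing.\<close>

lemma Lf_polylog:
  obtains M :: nat where "\<And>n. (3::nat) \<le> n \<Longrightarrow> Lf (real n) \<le> log 2 (real n) ^ M"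
proof -
  define p where "p = ramsey2 * ramsey2"
  define q where "q = 6 * p + 1"
  define C where "C = 12 * real ramsey2 ^ 6 * 53290000 ^ p * 3 ^ q"
  obtain r where r: "C < (3/2) ^ r" using real_arch_pow[of "3/2" C] by auto
  show thesis
  proof (rule that[of "q + r"])
    fix n :: nat assume n: "3 \<le> n"
    define x where "x = log 2 (real n)"
    have x: "x \<ge> 3 / 2"
    proof -
      have "3 = log 2 (2 ^ 3)" by (subst log_nat_power) auto
      also have "\<dots> \<le> log 2 (real n ^ 2)"
      proof -
        have "(2::real) ^ 3 \<le> 3 ^ 2" by simp
        also have "\<dots> \<le> real n ^ 2" using n by (intro power_mono) auto
        finally show ?thesis using n by simp
      qed
      also have "\<dots> = 2 * x" using n by (simp add: log_nat_power x_def)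
      finally show ?thesis by simp
    qed
    have l: "0 \<le> 1 + 2 * x" "1 + 2 * x \<le> 3 * x" using x by auto
    have "Lf (real n) = 12 * real ramsey2 ^ 6 * 53290000 ^ p * (1 + 2 * x) ^ q"
      unfolding Lf_def Wf_def x_def p_def[symmetric] q_def power_add power_mult_distrib power_mult by (simp only: power_one_right mult_ac)
    also have "\<dots> \<le> 12 * real ramsey2 ^ 6 * 53290000 ^ p * (3 * x) ^ q"
      using l by (intro mult_left_mono power_mono) auto
    also have "\<dots> = C * x ^ q" unfolding C_def power_mult_distrib by (simp only: mult_ac)
    also have "\<dots> \<le> (3/2) ^ r * x ^ q" using r x by (intro mult_right_mono) auto
    also have "\<dots> \<le> x ^ r * x ^ q" using x by (intro mult_right_mono power_mono) auto
    also have "\<dots> = x ^ (q + r)" by (simp add: power_add)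
    finally show "Lf (real n) \<le> log 2 (real n) ^ (q + r)" by (simp add: x_def)
  qed
qed

theorem theorem11:
  shows "\<exists>c3 c4 :: real. \<forall>k::nat. k > 0 \<longrightarrow>
     (\<forall>V E dr. simple_topological_graph V E dr \<and> bipartite_graph V E \<and>
        card V \<ge> 2 \<and> \<not> has_k1_crossing_family k E dr \<longrightarrow>
        real (card E) \<le> c3 * real (card V) * (log 2 (real (card V))) powr (c4 * log 2 (real k)))"
proof -
  obtain M :: nat where M: "\<And>n. (3::nat) \<le> n \<Longrightarrow> Lf (real n) \<le> log 2 (real n) ^ M" by (rule Lf_polylog) blast
  show ?thesis
  \<comment> \<open>16 is the constant of the linear bound for \<open>k = 1\<close>. The 3 comes
    from \<open>t + 1 \<le> log 2 k + 2 \<le> 3 * log 2 k\<close> for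
    \<open>k \<ge> 2\<close>.\<close>
  proof (rule exI[of _ 16], rule exI[of _ "3 * real M"], intro allI impI, elim conjE)
    fix k :: nat and V E dr
    assume k: "k > 0" and G: "simple_topological_graph V E dr" and bip: "bipartite_graph V E"
      and V2: "2 \<le> card V" and no: "\<not> has_k1_crossing_family k E dr"
    define n where "n = card V"
    define x where "x = log 2 (real n)"
    have x1: "x \<ge> 1" using V2 by (simp add: x_def n_def)
    have Vne: "V \<noteq> {}" using V2 by auto
    \<comment> \<open>The power of the logarithm is 1 both for \<open>n = 2\<close>, where there is
      at most one edge, and for \<open>k = 1\<close>, where the exponent vanishes.\<close>
    consider "n = 2" | "k = 1" | "n \<ge> 3" "k \<ge> 2" using V2 k by (fastforce simp: n_def)
    then have "real (card E) \<le> 16 * real n * x powr (3 * real M * log 2 (real k))"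
    proof cases
      case 1
      have "E \<subseteq> {V}"
      proof
        fix e assume "e \<in> E"
        then have "e \<subseteq> V" "card e = card V" using stg_finite(3)[OF G] 1 by (auto simp: n_def)
        then show "e \<in> {V}" using card_subset_eq[OF stg_finite(1)[OF G]] by blast
      qed
      then have "card E \<le> card {V}" by (intro card_mono) auto
      then show ?thesis using 1 by (simp add: x_def)
    next
      case 2
      then show ?thesis using thrackle_bound[OF G bip Vne] no x1 by (simp add: n_def)
    next
      case 3
      define t where "t = nat \<lceil>log 2 (real k)\<rceil>"
      have lk: "log 2 (real k) \<ge> 1" using 3 by simp
      have t: "log 2 (real k) \<le> real t" "real t \<le> log 2 (real k) + 1" using lk by (auto simp: t_def)
      have "real k = 2 powr (log 2 (real k))" using k by simp
      also have "\<dots> \<le> 2 powr (real t)" using t(1) by (intro powr_mono) auto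
      also have "\<dots> = real (2 ^ t)" by (simp add: powr_realpow)
      finally have kt: "k \<le> 2 ^ t" by (simp only: of_nat_le_iff)
      have N2: "real n \<ge> 2" using 3 by simp
      have "real (card E) \<le> Lf (real n) ^ Suc t * card V"
        by (rule k1_free_bound[OF G bip _ N2 kt no]) (simp add: n_def)
      also have "\<dots> \<le> (x ^ M) ^ Suc t * card V"
        using M[OF 3(1)] Wf_Lf(2)[OF N2] by (intro mult_right_mono power_mono) (auto simp: x_def)
      also have "\<dots> = x powr (real (M * Suc t)) * real n"
        using x1 by (subst powr_realpow) (auto simp: power_mult[symmetric] n_def simp del: power_Suc mult_Suc_right)
      also have "\<dots> \<le> x powr (3 * real M * log 2 (real k)) * real n"
      proof (intro mult_right_mono powr_mono x1)
        have "real (Suc t) \<le> 3 * log 2 (real k)" using t lk by simp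
        then have "real M * real (Suc t) \<le> real M * (3 * log 2 (real k))" by (intro mult_left_mono) auto
        then show "real (M * Suc t) \<le> 3 * real M * log 2 (real k)" by (simp only: of_nat_mult mult_ac)
      qed simp
      also have "\<dots> \<le> 16 * real n * x powr (3 * real M * log 2 (real k))" by (simp add: mult_ac)
      finally show ?thesis .
    qed
    then show "real (card E) \<le> 16 * real (card V) * (log 2 (real (card V))) powr (3 * real M * log 2 (real k))"
      by (simp only: n_def x_def)
  qed
qed

end
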